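(* Let $K:(0,\infty)^2\to[0,\infty)$ be continuous and suppose there are constants $0<c_1\le c_2<\infty$ and real exponents $\gamma,\lambda$ with $|\gamma+2\lambda|<1$ and $\gamma<1$ such that for all $x,y\in(0,\infty)$ $$c_1\left(x^{\gamma+\lambda}y^{-\lambda}+x^{-\lambda}y^{\gamma+\lambda}\right)\le K(x,y)\le c_2\left(x^{\gamma+\lambda}y^{-\lambda}+x^{-\lambda}y^{\gamma+\lambda}\right).$$ Let $T>0$ and let $f_0\in\mathcal{M}_+((0,\infty))$ be such that the measure $xf_0$ belongs to $\mathcal{M}_{+,b}((0,\infty))$. Then there exists a weak flux solution $f\in C([0,T],\mathcal{M}_+((0,\infty)))$, with initial data $f_0$, to the coagulation equation with kernel $K$.
   Context: Notation: $\mathbb{R}_*=(0,\infty)$. $\mathcal{M}_+(X)$ is the set of positive Radon measures on $X$ and $\mathcal{M}_{+,b}(X)$ the set of those that are bounded ($\mu(X)<\infty$). For a measure $\mu$ on $\mathbb{R}_*$, $x\mu$ denotes the measure $x\,\mu(\mathrm{d}x)$. Continuity in time of measure-valued maps is with respect to the weak* topology on the target, i.e. $t\mapsto\int\phi\,\mathrm{d}\mu_t$ is continuous for every $\phi\in C_c(\mathbb{R}_* )$. For $z>0$ let $\Omega_z=\{(x,y)\in\mathbb{R}_*^2: 0<x\le z,\ z-x<y\}$ and $J_\mu(z)=\iint_{\Omega_z}xK(x,y)\,\mu(\mathrm{d}x)\mu(\mathrm{d}y)$. Definition (weak flux solution). $f\in C([0,T],\mathcal{M}_+(\mathbb{R}_*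 ))$ is a weak flux solution with initial data $f_0\in\mathcal{M}_+(\mathbb{R}_* )$, where $xf_0\in\mathcal{M}_{+,b}(\mathbb{R}_* )$, if (i) $xf\in C([0,T],\mathcal{M}_{+,b}(\mathbb{R}_* ))$ (weak* topology on the target); (ii) for almost every $(t,z)\in[0,T]\times\mathbb{R}_*$, $$\int_{(0,z]}x f_t(\mathrm{d}x)-\int_{(0,z]}x f_0(\mathrm{d}x)=-\int_0^tJ_{f_s}(z)\,\mathrm{d}s+t,$$ where the time-integrated flux $\int_0^tJ_{f_s}(z)\,\mathrm{d}s$ is finite for all $t\in[0,T]$ and almost every $z\in\mathbb{R}_*$. *)

theory Defs
  imports "HOL-Analysis.Analysis"
begin

(* A measure on (0,\<infinity>) is a Borel measure whose underlying space is {0<..}.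
   "Radon" is finiteness on compact sets; inner and outer regularity follow, since
   {0<..} is locally compact and second countable. *)
definition radon_measures :: "real measure set" where
  "radon_measures =
     {\<mu>. sets \<mu> = sets (restrict_space borel {0<..}) \<and>
         (\<forall>C. compact C \<longrightarrow> C \<subseteq> {0<..} \<longrightarrow> emeasure \<mu> C < \<infinity>)}"

definition bounded_radon_measures :: "real measure set" where
  "bounded_radon_measures = {\<mu> \<in> radon_measures. emeasure \<mu> (space \<mu>) < \<infinity>}"

definition times_x :: "real measure \<Rightarrow> real measure" where
  "times_x \<mu> = density \<mu> (\<lambda>x. ennreal x)"

(* C_c((0,\<infinity>)); values outside {0<..} are irrelevant. *)
definition test_functions :: "(real \<Rightarrow> real) set" where
  "test_functions =
     {\<phi>. continuous_on {0<..} \<phi> \<and>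
         (\<exists>C. compact C \<and> C \<subseteq> {0<..} \<and> (\<forall>x\<in>{0<..} - C. \<phi> x = 0))}"

(* C([0,T], S) for a set S of measures carrying the weak* topology (duality with C_c). *)
definition weak_star_continuous_maps ::
    "real \<Rightarrow> real measure set \<Rightarrow> (real \<Rightarrow> real measure) set" where
  "weak_star_continuous_maps T S =
     {\<mu>. (\<forall>t\<in>{0..T}. \<mu> t \<in> S) \<and>
         (\<forall>\<phi>\<in>test_functions. continuous_on {0..T} (\<lambda>t. \<integral>x. \<phi> x \<partial>\<mu> t))}"

definition Omega :: "real \<Rightarrow> (real \<times> real) set" where
  "Omega z = {(x, y). 0 < x \<and> 0 < y \<and> x \<le> z \<and> z - x < y}"

(* The flux and its time integral are [0,\<infinity>]-valued; finiteness of the latter is part of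
   the definition of a solution. *)
definition flux :: "(real \<Rightarrow> real \<Rightarrow> real) \<Rightarrow> real measure \<Rightarrow> real \<Rightarrow> ennreal" where
  "flux K \<mu> z = (\<integral>\<^sup>+p\<in>Omega z. ennreal (fst p * K (fst p) (snd p)) \<partial>(\<mu> \<Otimes>\<^sub>M \<mu>))"

definition integrated_flux ::
    "(real \<Rightarrow> real \<Rightarrow> real) \<Rightarrow> (real \<Rightarrow> real measure) \<Rightarrow> real \<Rightarrow> real \<Rightarrow> ennreal" where
  "integrated_flux K f t z = (\<integral>\<^sup>+s\<in>{0..t}. flux K (f s) z \<partial>lborel)"

(* enn2real is harmless in the last clause: by the clause before it, its argument is finite
   for almost every (t,z). *)
definition weak_flux_solution ::
    "(real \<Rightarrow> real \<Rightarrow> real) \<Rightarrow> real \<Rightarrow> real measure \<Rightarrow> (real \<Rightarrow> real measure) \<Rightarrow> bool" where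
  "weak_flux_solution K T f0 f \<longleftrightarrow>
     f \<in> weak_star_continuous_maps T radon_measures \<and>
     f 0 = f0 \<and>
     (\<lambda>t. times_x (f t)) \<in> weak_star_continuous_maps T bounded_radon_measures \<and>
     (\<forall>t\<in>{0..T}. AE z in lborel. z \<in> {0<..} \<longrightarrow> integrated_flux K f t z < \<infinity>) \<and>
     (AE (t, z) in (lborel :: (real \<times> real) measure). t \<in> {0..T} \<longrightarrow> z \<in> {0<..} \<longrightarrow>
        (LINT x:{0<..z}|f t. x) - (LINT x:{0<..z}|f0. x)
          = - enn2real (integrated_flux K f t z) + t)"

end

theory Submission
  imports Defs "HOL-Probability.Probability" "HOL-Complex_Analysis.Great_Picard"
begin

text \<open>In terms of the mass measure \<open>m = x f(dx)\<close> the equation says that mass at \<open>x\<close> jumps to \<open>x + y\<close> at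
  rate \<open>K(x,y)/y m(dy)\<close>, with unit influx at 0. An explicit Euler scheme on the grid \<open>{1/n, ..., n}\<close>, with
  the influx placed at \<open>1/n\<close>, keeps masses nonnegative, bounds the total mass by \<open>M\<close>, and satisfies the flux
  identity exactly.

  Write \<open>a = \<gamma> + \<lambda>\<close> and \<open>b = -\<lambda>\<close>. Since the flux through \<open>z\<close>, integrated in time, is at most \<open>M\<close>, the lower
  bound on \<open>K\<close> gives \<open>\<integral> m((z/2, z])\<^sup>2 dt \<le> C z\<^bsup>1-\<gamma>\<^esup>\<close>. Summing over dyadic scales, the time integrals of
  \<open>x\<^bsup>a\<^esup> m\<close>, \<open>x\<^bsup>b\<^esup> m\<close> and \<open>m\<close> over \<open>(0, \<delta>]\<close> tend to 0 with \<open>\<delta>\<close>, uniformly in \<open>n\<close>; this is where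
  \<open>|\<gamma> + 2\<lambda>| < 1\<close> and \<open>\<gamma> < 1\<close> enter. Together with \<open>a, b < 1\<close>, which makes \<open>K(x,y)/y\<close> decay for large \<open>y\<close>,
  these bounds control all the singular parts of the flux once it is averaged over \<open>z \<in> [z1, z2]\<close>, and they
  give equicontinuity in time.

  Hence a subsequence converges, at every time, weakly on the half-line compactified by \<open>u = x / (1 + x)\<close>;
  the averaged identity passes to the limit, and the bound for \<open>m\<close> itself excludes dust at 0 for almost
  every time.\<close>

section \<open>The kernel and the discrete scheme\<close>

text \<open>\<open>plateau z1 z2 x\<close> is the indicator of \<open>x \<le> z\<close> integrated over \<open>z \<in> [z1, z2]\<close>; accordingly \<open>jump\<close> below
  is the integrand of the flux through \<open>z\<close> integrated over the same interval.\<close>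

definition plateau :: "real \<Rightarrow> real \<Rightarrow> real \<Rightarrow> real" where
  "plateau z1 z2 x = min (max (z2 - x) 0) (z2 - z1)"

lemma powr_le_endpoints:
  fixes x p :: real
  assumes "0 < l" "l \<le> x" "x \<le> u"
  shows "x powr p \<le> l powr p + u powr p"
proof (cases "p \<ge> 0")
  case True
  then have "x powr p \<le> u powr p" using assms by (intro powr_mono2) auto
  then show ?thesis using powr_ge_zero[of l p] by linarith
next
  case False
  then have "x powr p \<le> l powr p" using assms by (intro powr_mono2') auto
  then show ?thesis using powr_ge_zero[of u p] by linarith
qed

locale coagulation_kernel =
  fixes K :: "real \<Rightarrow> real \<Rightarrow> real" and c1 c2 a b :: real
  assumes K_cont: "continuous_on ({0<..} \<times> {0<..}) (\<lambda>(x, y). K x y)"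
    and c1_pos: "0 < c1" and c1_le_c2: "c1 \<le> c2"
    and ab_sum: "a + b < 1" and ab: "\<bar>a - b\<bar> < 1"
    and K_lower: "\<And>x y. 0 < x \<Longrightarrow> 0 < y \<Longrightarrow>
      c1 * (x powr a * y powr b + x powr b * y powr a) \<le> K x y"
    and K_upper: "\<And>x y. 0 < x \<Longrightarrow> 0 < y \<Longrightarrow>
      K x y \<le> c2 * (x powr a * y powr b + x powr b * y powr a)"
begin

lemma a_less: "a < 1" and b_less: "b < 1"
  using ab_sum ab by linarith+

definition S :: "real \<Rightarrow> real" where "S x = x powr a + x powr b"

definition jump :: "real \<Rightarrow> real \<Rightarrow> real \<Rightarrow> real \<Rightarrow> real" where
  "jump z1 z2 x y = K x y / y * (plateau z1 z2 x - plateau z1 z2 (x + y))"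

lemma S_nonneg: "0 \<le> S x"
  by (simp add: S_def)

lemma c2_pos: "0 < c2"
  using c1_pos c1_le_c2 by linarith

lemma K_nonneg: "0 < x \<Longrightarrow> 0 < y \<Longrightarrow> 0 \<le> K x y"
  using K_lower[of x y] c1_pos
  by (smt (verit) mult_nonneg_nonneg powr_ge_zero)

lemma plateau_diff:
  assumes "z1 < z2" "0 < y"
  shows "0 \<le> plateau z1 z2 x - plateau z1 z2 (x + y)"
    and "plateau z1 z2 x - plateau z1 z2 (x + y) \<le> y"
    and "plateau z1 z2 x - plateau z1 z2 (x + y) \<le> z2 - z1"
    and "z2 \<le> x \<Longrightarrow> plateau z1 z2 x - plateau z1 z2 (x + y) = 0"
    and "x + y \<le> z1 \<Longrightarrow> plateau z1 z2 x - plateau z1 z2 (x + y) = 0"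
  using assms by (auto simp: plateau_def min_def max_def)

lemma jump_nonneg: "z1 < z2 \<Longrightarrow> 0 < x \<Longrightarrow> 0 < y \<Longrightarrow> 0 \<le> jump z1 z2 x y"
  unfolding jump_def using plateau_diff(1)[of z1 z2 y x] K_nonneg[of x y] by simp

lemma jump_eq_0:
  assumes "z1 < z2" "0 < y" "z2 \<le> x \<or> x + y \<le> z1"
  shows "jump z1 z2 x y = 0"
  using plateau_diff(4,5)[OF assms(1,2), of x] assms(3) by (auto simp: jump_def)

lemma jump_small_y:
  assumes z: "0 < z1" "z1 < z2" and x: "0 < x" and y: "0 < y" "y \<le> z1 / 2"
  shows "jump z1 z2 x y \<le> c2 * (S (z1/2) + S z2) * S y"
proof (cases "x \<le> z1 / 2 \<or> z2 \<le> x")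
  case True
  then have "jump z1 z2 x y = 0" using y z by (intro jump_eq_0) auto
  moreover have "0 \<le> c2 * (S (z1/2) + S z2) * S y"
    using S_nonneg c2_pos by simp
  ultimately show ?thesis by simp
next
  case False
  have "jump z1 z2 x y \<le> K x y / y * y"
    unfolding jump_def using K_nonneg[OF x y(1)] y plateau_diff(2)[OF z(2) y(1)]
    by (intro mult_left_mono) auto
  also have "\<dots> = K x y" using y by simp
  also have "\<dots> \<le> c2 * (x powr a * y powr b + x powr b * y powr a)"
    using K_upper x y by simp
  also have "\<dots> \<le> c2 * ((S (z1/2) + S z2) * y powr b + (S (z1/2) + S z2) * y powr a)"
  proof -
    have "x powr a \<le> S (z1/2) + S z2" "x powr b \<le> S (z1/2) + S z2"
      using powr_le_endpoints[of "z1/2" x z2 a] powr_le_endpoints[of "z1/2" x z2 b] False z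
        powr_ge_zero[of "z1/2" a] powr_ge_zero[of "z1/2" b] powr_ge_zero[of z2 a] powr_ge_zero[of z2 b]
      unfolding S_def by linarith+
    then show ?thesis using c2_pos
      by (intro mult_left_mono add_mono mult_right_mono) auto
  qed
  also have "\<dots> = c2 * (S (z1/2) + S z2) * S y"
    by (simp add: S_def[of y] algebra_simps)
  finally show ?thesis .
qed

lemma jump_large_y:
  assumes z: "z1 < z2" and x: "0 < x" and y: "0 < y"
  shows "jump z1 z2 x y \<le> c2 * (z2 - z1) * (S x * of_bool (x \<le> z2)) * (y powr (a - 1) + y powr (b - 1))"
proof (cases "z2 \<le> x")
  case True
  then have "jump z1 z2 x y = 0" using y z by (intro jump_eq_0) auto
  then show ?thesis using S_nonneg[of x] c2_pos z by simp
next
  case False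
  have "jump z1 z2 x y \<le> K x y / y * (z2 - z1)"
    unfolding jump_def using K_nonneg[OF x y(1)] y plateau_diff(3)[OF z y(1)]
    by (intro mult_left_mono) auto
  also have "\<dots> \<le> c2 * (x powr a * y powr b + x powr b * y powr a) / y * (z2 - z1)"
    using K_upper[OF x y] y z by (intro mult_right_mono divide_right_mono) auto
  also have "\<dots> = c2 * (z2 - z1) * (x powr a * y powr (b - 1) + x powr b * y powr (a - 1))"
    using y by (simp add: powr_diff field_simps)
  also have "\<dots> \<le> c2 * (z2 - z1) * (S x * (y powr (a - 1) + y powr (b - 1)))"
    using c2_pos z by (intro mult_left_mono) (auto simp: S_def algebra_simps)
  finally show ?thesis using False by simp
qed

end

locale coagulation = coagulation_kernel +
  fixes T :: real and f0 :: "real measure"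
  assumes T_pos: "0 < T"
    and f0_radon: "f0 \<in> radon_measures"
    and xf0_bounded: "times_x f0 \<in> bounded_radon_measures"
begin

abbreviation m0 :: "real measure" where "m0 \<equiv> times_x f0"

definition M0 :: real where "M0 = measure m0 (space m0)"
definition M :: real where "M = M0 + T"

lemma sets_m0: "sets m0 = sets (restrict_space borel {0<..})"
  using xf0_bounded by (simp add: bounded_radon_measures_def radon_measures_def)

lemma space_m0: "space m0 = {0<..}"
  using sets_eq_imp_space_eq[OF sets_m0] by (simp add: space_restrict_space)

lemma finite_m0: "finite_measure m0"
  using xf0_bounded by (intro finite_measureI) (auto simp: bounded_radon_measures_def)

lemma M0_nonneg: "0 \<le> M0" by (simp add: M0_def)
lemma M_pos: "0 < M" using M0_nonneg T_pos by (simp add: M_def)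

text \<open>Sizes above \<open>n\<close> are collapsed to \<open>n\<close>, which keeps the grid finite and closed under merging.
  Test functions that are constant above some \<open>z \<le> n\<close> do not notice this.\<close>

definition grid :: "nat \<Rightarrow> real set" where
  "grid n = (\<lambda>j. real j / real n) ` {1..n\<^sup>2}"

definition merge :: "nat \<Rightarrow> real \<Rightarrow> real \<Rightarrow> real" where
  "merge n x y = min (x + y) (real n)"

definition total_rate :: "nat \<Rightarrow> real" where
  "total_rate n = (\<Sum>x\<in>grid n. \<Sum>y\<in>grid n. K x y / y)"

text \<open>The time step \<open>h\<close> is so small that an Euler step cannot remove more mass than is present.\<close>

definition N :: "nat \<Rightarrow> nat" where
  "N n = Suc (max n (nat \<lceil>T * M * total_rate n\<rceil>))"

definition h :: "nat \<Rightarrow> real" where "h n = T / real (N n)"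

definition outflow :: "nat \<Rightarrow> (real \<Rightarrow> real) \<Rightarrow> real \<Rightarrow> real" where
  "outflow n w z = (\<Sum>x\<in>grid n. \<Sum>y\<in>grid n. w x * w y *
     (K x y / y * (of_bool (x = z) - of_bool (merge n x y = z))))"

text \<open>Explicit Euler steps for the mass measure \<open>x f(dx)\<close>: mass at \<open>x\<close> jumps to \<open>x + y\<close> at rate
  \<open>K x y / y\<close> times the mass at \<open>y\<close>. In this form no symmetry of \<open>K\<close> is needed.\<close>

primrec mass :: "nat \<Rightarrow> nat \<Rightarrow> real \<Rightarrow> real" where
  "mass n 0 = (\<lambda>z. measure m0 {z - 1 / real n<..z})"
| "mass n (Suc k) = (\<lambda>z. mass n k z + h n * (of_bool (z = 1 / real n) - outflow n (mass n k) z))"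

definition E :: "nat \<Rightarrow> nat \<Rightarrow> (real \<Rightarrow> real) \<Rightarrow> real" where
  "E n k \<phi> = (\<Sum>x\<in>grid n. mass n k x * \<phi> x)"

definition Q :: "nat \<Rightarrow> nat \<Rightarrow> (real \<Rightarrow> real \<Rightarrow> real) \<Rightarrow> real" where
  "Q n k \<psi> = (\<Sum>x\<in>grid n. \<Sum>y\<in>grid n. mass n k x * mass n k y * \<psi> x y)"

lemma finite_grid[simp]: "finite (grid n)"
  by (simp add: grid_def)

lemma grid_pos: "x \<in> grid n \<Longrightarrow> 0 < x"
  unfolding grid_def by (cases "n = 0") auto

lemma grid_ge: "x \<in> grid n \<Longrightarrow> 1 / real n \<le> x"
  by (auto simp: grid_def divide_simps)

lemma grid_le: "x \<in> grid n \<Longrightarrow> x \<le> real n"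
proof -
  assume "x \<in> grid n"
  then obtain j where j: "j \<le> n\<^sup>2" "1 \<le> j" "x = real j / real n" by (auto simp: grid_def)
  then have "n > 0" by (cases n) auto
  have "real j \<le> (real n)\<^sup>2" using j(1) by (metis of_nat_le_iff of_nat_power)
  then have "real j / real n \<le> (real n)\<^sup>2 / real n" by (intro divide_right_mono) auto
  then show ?thesis using j(3) \<open>n > 0\<close> by (simp add: power2_eq_square)
qed

lemma source_in_grid: "1 \<le> n \<Longrightarrow> 1 / real n \<in> grid n"
  unfolding grid_def by (rule image_eqI[of _ _ 1]) (auto simp: Suc_le_eq)

lemma merge_in_grid:
  assumes "x \<in> grid n" "y \<in> grid n"
  shows "merge n x y \<in> grid n"
proof -
  from assms obtain i j where ij: "1 \<le> i" "1 \<le> j" "i \<le> n\<^sup>2" "x = real i / real n" "y = real j / real n"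
    by (auto simp: grid_def)
  then have "n > 0" by (cases n) auto
  have nn: "real n = real (n\<^sup>2) / real n" using \<open>n > 0\<close> by (simp add: power2_eq_square)
  have "merge n x y = real (min (i + j) (n\<^sup>2)) / real n"
  proof (cases "i + j \<le> n\<^sup>2")
    case True
    then have "real (i + j) / real n \<le> real (n\<^sup>2) / real n"
      by (intro divide_right_mono) (auto simp only: of_nat_le_iff of_nat_0_le_iff)
    then show ?thesis using True ij nn by (simp add: merge_def add_divide_distrib min_def)
  next
    case False
    then have "real (n\<^sup>2) / real n \<le> real (i + j) / real n"
      by (intro divide_right_mono) (auto simp only: of_nat_le_iff of_nat_0_le_iff)
    then show ?thesis using False ij nn by (simp add: merge_def add_divide_distrib min_def)
  qed
  then show ?thesis unfolding grid_def using ij \<open>n > 0\<close>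
    by (intro image_eqI[of _ _ "min (i + j) (n\<^sup>2)"]) (auto simp: Suc_le_eq)
qed

lemma N_pos: "0 < N n" by (simp add: N_def)
lemma h_pos: "0 < h n" using T_pos N_pos by (simp add: h_def)
lemma N_ge: "n \<le> N n" by (simp add: N_def)
lemma h_N: "real (N n) * h n = T" using N_pos[of n] by (simp add: h_def)
lemma h_k_le: "k \<le> N n \<Longrightarrow> h n * real k \<le> T"
  using h_N[of n] h_pos[of n] by (metis less_le mult.commute mult_left_mono of_nat_mono)

lemma total_rate_nonneg: "0 \<le> total_rate n"
  unfolding total_rate_def using grid_pos K_nonneg
  by (intro sum_nonneg) (auto intro!: divide_nonneg_pos)

lemma h_rate: "h n * M * total_rate n \<le> 1"
proof -
  have "T * M * total_rate n \<le> real (N n)"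
    unfolding N_def by linarith
  then show ?thesis using N_pos[of n] by (simp add: h_def divide_simps)
qed

lemma evolution:
  assumes "1 \<le> n"
  shows "E n (Suc k) \<phi> = E n k \<phi> + h n * (\<phi> (1 / real n)
    - Q n k (\<lambda>x y. K x y / y * (\<phi> x - \<phi> (merge n x y))))"
proof -
  have s1: "(\<Sum>z\<in>grid n. of_bool (z = 1 / real n) * \<phi> z) = \<phi> (1 / real n)"
    using source_in_grid[OF assms] by (simp add: of_bool_def if_distrib[where f="\<lambda>x. x * _"] sum.delta cong: if_cong)
  have d: "(\<Sum>z\<in>grid n. of_bool (w = z) * \<phi> z) = \<phi> w" if "w \<in> grid n" for w
    using that by (simp add: of_bool_def if_distrib[where f="\<lambda>x. x * _"] sum.delta cong: if_cong)
  have "(\<Sum>z\<in>grid n. outflow n (mass n k) z * \<phi> z)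
     = (\<Sum>x\<in>grid n. \<Sum>y\<in>grid n. \<Sum>z\<in>grid n. mass n k x * mass n k y *
          (K x y / y * (of_bool (x = z) - of_bool (merge n x y = z))) * \<phi> z)"
    unfolding outflow_def sum_distrib_right
    by (subst sum.swap, rule sum.cong[OF refl], subst sum.swap, rule refl)
  also have "\<dots> = (\<Sum>x\<in>grid n. \<Sum>y\<in>grid n. mass n k x * mass n k y *
          (K x y / y * ((\<Sum>z\<in>grid n. of_bool (x = z) * \<phi> z) - (\<Sum>z\<in>grid n. of_bool (merge n x y = z) * \<phi> z))))"
    unfolding sum_subtractf[symmetric] sum_distrib_left by (intro sum.cong refl) algebra
  also have "\<dots> = Q n k (\<lambda>x y. K x y / y * (\<phi> x - \<phi> (merge n x y)))"
    unfolding Q_def by (intro sum.cong refl) (simp add: d merge_in_grid)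
  finally have s2: "(\<Sum>z\<in>grid n. outflow n (mass n k) z * \<phi> z)
     = Q n k (\<lambda>x y. K x y / y * (\<phi> x - \<phi> (merge n x y)))" .
  have "E n (Suc k) \<phi> = E n k \<phi> + (\<Sum>z\<in>grid n. h n * (of_bool (z = 1 / real n) * \<phi> z
     - outflow n (mass n k) z * \<phi> z))"
    unfolding E_def by (simp only: mass.simps sum.distrib[symmetric]) (simp add: algebra_simps)
  also have "\<dots> = E n k \<phi> + h n * ((\<Sum>z\<in>grid n. of_bool (z = 1 / real n) * \<phi> z)
     - (\<Sum>z\<in>grid n. outflow n (mass n k) z * \<phi> z))"
    by (simp only: sum_distrib_left[symmetric] sum_subtractf)
  finally show ?thesis by (simp only: s1 s2)
qed

lemma total_mass_0: "E n 0 (\<lambda>_. 1) \<le> M0"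
proof -
  interpret m0: finite_measure m0 by (rule finite_m0)
  show ?thesis
  proof (cases "n = 0")
    case True
    then show ?thesis by (simp add: E_def grid_def M0_nonneg)
  next
    case False
    define A where "A j = {real j / real n - 1 / real n<..real j / real n}" for j
    have "inj_on (\<lambda>j. real j / real n) {1..n\<^sup>2}" using False by (auto simp: inj_on_def)
    then have "E n 0 (\<lambda>_. 1) = (\<Sum>j\<in>{1..n\<^sup>2}. measure m0 (A j))"
      by (simp add: E_def grid_def sum.reindex A_def)
    also have "\<dots> = measure m0 (\<Union>j\<in>{1..n\<^sup>2}. A j)"
    proof (rule m0.finite_measure_finite_Union[symmetric])
      show "A ` {1..n\<^sup>2} \<subseteq> sets m0"
      proof safe
        fix j assume "j \<in> {1..n\<^sup>2}"
        then have "A j \<subseteq> {0<..}"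
          unfolding A_def using False
          using \<open>j \<in> {1..n\<^sup>2}\<close> by (auto simp: diff_divide_distrib[symmetric] intro: le_less_trans[rotated])
        then show "A j \<in> sets m0" unfolding sets_m0 by (auto simp: sets_restrict_space_iff A_def)
      qed
      have "A i \<inter> A j = {}" if "i < j" for i j
      proof -
        have "real i / real n \<le> real (j - 1) / real n"
          using that by (intro divide_right_mono) auto
        then show ?thesis using that by (auto simp: A_def diff_divide_distrib of_nat_diff)
      qed
      then show "disjoint_family_on A {1..n\<^sup>2}"
        unfolding disjoint_family_on_def by (metis inf_commute nat_neq_iff)
    qed simp
    also have "\<dots> \<le> M0" unfolding M0_def by (rule m0.bounded_measure)
    finally show ?thesis .
  qed
qed

lemma mass_nonneg_total:
  assumes n: "1 \<le> n" and k: "k \<le> N n"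
  shows "(\<forall>x\<in>grid n. 0 \<le> mass n k x) \<and> E n k (\<lambda>_. 1) \<le> M0 + h n * real k"
  using k
proof (induction k)
  case 0
  then show ?case using total_mass_0 by simp
next
  case (Suc k)
  then have IH: "\<And>x. x \<in> grid n \<Longrightarrow> 0 \<le> mass n k x" "E n k (\<lambda>_. 1) \<le> M0 + h n * real k" by auto
  have tot: "E n (Suc k) (\<lambda>_. 1) \<le> M0 + h n * real (Suc k)"
    unfolding evolution[OF n] using IH(2) by (simp add: Q_def algebra_simps)
  have "E n k (\<lambda>_. 1) \<le> M"
    using IH(2) h_k_le[of k n] Suc.prems by (simp add: M_def)
  then have EM: "sum (mass n k) (grid n) \<le> M" by (simp add: E_def)
  have "0 \<le> mass n (Suc k) z" if z: "z \<in> grid n" for z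
  proof -
    have r: "0 \<le> K x y / y" if "x \<in> grid n" "y \<in> grid n" for x y
      using that grid_pos K_nonneg by (auto intro!: divide_nonneg_pos)
    have "outflow n (mass n k) z
      \<le> (\<Sum>x\<in>grid n. \<Sum>y\<in>grid n. mass n k x * mass n k y * (K x y / y * of_bool (x = z)))"
      unfolding outflow_def using IH(1) r by (intro sum_mono mult_left_mono) (auto simp: grid_pos less_imp_le)
    also have "\<dots> = (\<Sum>x\<in>grid n. of_bool (x = z) * (\<Sum>y\<in>grid n. mass n k x * mass n k y * (K x y / y)))"
      by (intro sum.cong refl) auto
    also have "\<dots> = (\<Sum>y\<in>grid n. mass n k z * mass n k y * (K z y / y))"
      using z by (simp add: of_bool_def if_distrib[where f="\<lambda>x. x * _"] sum.delta cong: if_cong)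
    also have "\<dots> \<le> (\<Sum>y\<in>grid n. mass n k z * mass n k y * total_rate n)"
    proof (intro sum_mono mult_left_mono)
      fix y assume y: "y \<in> grid n"
      have "K z y / y \<le> (\<Sum>y\<in>grid n. K z y / y)"
        using y r z by (intro member_le_sum) auto
      also have "\<dots> \<le> total_rate n" unfolding total_rate_def
        using z r by (intro member_le_sum[where f="\<lambda>x. \<Sum>y\<in>grid n. K x y / y"] sum_nonneg) auto
      finally show "K z y / y \<le> total_rate n" .
    qed (use IH(1) z in auto)
    also have "\<dots> = mass n k z * (sum (mass n k) (grid n) * total_rate n)"
      by (simp add: sum_distrib_left sum_distrib_right mult_ac)
    also have "\<dots> \<le> mass n k z * (M * total_rate n)"
      using EM IH(1) z total_rate_nonneg by (intro mult_left_mono mult_right_mono) auto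
    finally have "h n * outflow n (mass n k) z
       \<le> h n * (mass n k z * (M * total_rate n))"
      using h_pos[of n] by (intro mult_left_mono) auto
    also have "\<dots> = mass n k z * (h n * M * total_rate n)" by (simp add: mult_ac)
    also have "\<dots> \<le> mass n k z * 1"
      using h_rate IH(1) z by (intro mult_left_mono) auto
    finally have le: "h n * outflow n (mass n k) z \<le> mass n k z" by simp
    have "0 \<le> h n * of_bool (z = 1 / real n)" using h_pos[of n] by simp
    then show ?thesis using le unfolding mass.simps right_diff_distrib by linarith
  qed
  then show ?case using tot by blast
qed

lemma mass_nonneg: "1 \<le> n \<Longrightarrow> k \<le> N n \<Longrightarrow> x \<in> grid n \<Longrightarrow> 0 \<le> mass n k x"
  using mass_nonneg_total by blast

lemma total_mass_le: "1 \<le> n \<Longrightarrow> k \<le> N n \<Longrightarrow> sum (mass n k) (grid n) \<le> M"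
  using mass_nonneg_total[of n k] h_k_le[of k n] by (auto simp: M_def E_def)

subsection \<open>A priori estimates\<close>

lemma E_mono:
  assumes "1 \<le> n" "k \<le> N n" "\<And>x. x \<in> grid n \<Longrightarrow> f x \<le> g x"
  shows "E n k f \<le> E n k g"
  unfolding E_def using assms mass_nonneg by (intro sum_mono mult_left_mono) auto

lemma E_nonneg:
  assumes "1 \<le> n" "k \<le> N n" "\<And>x. x \<in> grid n \<Longrightarrow> 0 \<le> f x"
  shows "0 \<le> E n k f"
  unfolding E_def using assms mass_nonneg by (intro sum_nonneg mult_nonneg_nonneg) auto

lemma E_add: "E n k (\<lambda>x. f x + g x) = E n k f + E n k g"
  by (simp add: E_def sum.distrib algebra_simps)

lemma E_cmult: "E n k (\<lambda>x. c * f x) = c * E n k f"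
  by (simp add: E_def sum_distrib_left mult_ac)

lemma E_one_le: "1 \<le> n \<Longrightarrow> k \<le> N n \<Longrightarrow> E n k (\<lambda>_. 1) \<le> M"
  using total_mass_le by (simp add: E_def)

lemma Q_mono:
  assumes "1 \<le> n" "k \<le> N n" "\<And>x y. x \<in> grid n \<Longrightarrow> y \<in> grid n \<Longrightarrow> f x y \<le> g x y"
  shows "Q n k f \<le> Q n k g"
  unfolding Q_def using assms mass_nonneg by (intro sum_mono mult_left_mono) auto

lemma Q_nonneg:
  assumes "1 \<le> n" "k \<le> N n" "\<And>x y. x \<in> grid n \<Longrightarrow> y \<in> grid n \<Longrightarrow> 0 \<le> f x y"
  shows "0 \<le> Q n k f"
  using Q_mono[of n k "\<lambda>_ _. 0" f] assms by (simp add: Q_def)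

lemma Q_diff: "Q n k (\<lambda>x y. f x y - g x y) = Q n k f - Q n k g"
  by (simp add: Q_def sum_subtractf algebra_simps)

lemma Q_prod: "Q n k (\<lambda>x y. f x * g y) = E n k f * E n k g"
  by (simp add: Q_def E_def sum_product mult_ac)

lemma Q_le_sum:
  assumes n: "1 \<le> n" "k \<le> N n"
    and le: "\<And>x y. x \<in> grid n \<Longrightarrow> y \<in> grid n \<Longrightarrow> \<psi> x y \<le> f x + g y"
    and nn: "\<And>x. x \<in> grid n \<Longrightarrow> 0 \<le> f x" "\<And>x. x \<in> grid n \<Longrightarrow> 0 \<le> g x"
  shows "Q n k \<psi> \<le> M * (E n k f + E n k g)"
proof -
  have "Q n k \<psi> \<le> Q n k (\<lambda>x y. f x + g y)" by (intro Q_mono n le)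
  also have "\<dots> = Q n k (\<lambda>x y. f x * 1) + Q n k (\<lambda>x y. 1 * g y)"
    by (simp add: Q_def sum.distrib algebra_simps)
  also have "\<dots> = E n k f * E n k (\<lambda>_. 1) + E n k (\<lambda>_. 1) * E n k g"
    by (simp only: Q_prod)
  also have "\<dots> \<le> E n k f * M + M * E n k g"
    using E_one_le[OF n] E_nonneg[OF n, of f] E_nonneg[OF n, of g] nn M_pos
    by (intro add_mono mult_left_mono mult_right_mono) auto
  finally show ?thesis by (simp add: algebra_simps)
qed

lemma evolution_sum:
  assumes "1 \<le> n" "k1 \<le> k2"
  shows "E n k2 \<phi> = E n k1 \<phi> + h n * real (k2 - k1) * \<phi> (1 / real n)
    - (\<Sum>j\<in>{k1..<k2}. h n * Q n j (\<lambda>x y. K x y / y * (\<phi> x - \<phi> (merge n x y))))"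
  using assms(2)
proof (induction k2 rule: dec_induct)
  case base
  then show ?case by simp
next
  case (step k)
  then have "real (Suc k - k1) = real (k - k1) + 1" by (simp add: Suc_diff_le)
  then show ?case
    using step by (simp add: evolution[OF assms(1)] algebra_simps)
qed

lemma flux_bound:
  assumes n: "1 \<le> n" and z: "0 < z" "z < real n"
  shows "(\<Sum>j\<in>{..<N n}. h n * (E n j (\<lambda>x. of_bool (z / 2 < x \<and> x \<le> z)))\<^sup>2)
    \<le> M * 2 powr \<bar>a\<bar> / c1 * z powr (1 - a - b)"
proof -
  define \<phi> where "\<phi> x = (of_bool (x \<le> z) :: real)" for x
  define \<beta> where "\<beta> x = (of_bool (z / 2 < x \<and> x \<le> z) :: real)" for x
  define c where "c = c1 * (2 powr (- \<bar>a\<bar>) * z powr a * z powr (b - 1))"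
  have c: "0 < c" using c1_pos z by (simp add: c_def)
  have lower: "c * (\<beta> x * \<beta> y) \<le> K x y / y * (\<phi> x - \<phi> (merge n x y))"
    if xy: "x \<in> grid n" "y \<in> grid n" for x y
  proof -
    have pos: "0 < x" "0 < y" "x \<le> real n" using grid_pos grid_le xy by auto
    have mge: "x \<le> merge n x y" using pos by (simp add: merge_def)
    show ?thesis
    proof (cases "z / 2 < x \<and> x \<le> z \<and> z / 2 < y \<and> y \<le> z")
      case True
      have "2 powr (- \<bar>a\<bar>) * z powr a \<le> x powr a"
      proof (cases "a \<ge> 0")
        case True
        have "2 powr (- \<bar>a\<bar>) * z powr a = (z / 2) powr a"
          using True z by (simp add: powr_divide powr_minus field_simps)
        also have "\<dots> \<le> x powr a" using True \<open>z / 2 < x \<and> _\<close> z by (intro powr_mono2) auto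
        finally show ?thesis .
      next
        case False
        have "2 powr (- \<bar>a\<bar>) * z powr a \<le> 1 * z powr a"
          using powr_mono[of "- \<bar>a\<bar>" 0 2] by (intro mult_right_mono) auto
        also have "\<dots> \<le> x powr a" using False \<open>z / 2 < x \<and> _\<close> pos by (simp add: powr_mono2')
        finally show ?thesis .
      qed
      moreover have "z powr (b - 1) \<le> y powr (b - 1)"
        using True pos b_less by (intro powr_mono2') auto
      ultimately have "c \<le> c1 * (x powr a * y powr (b - 1))"
        unfolding c_def using c1_pos by (intro mult_left_mono mult_mono) auto
      also have "\<dots> = c1 * (x powr a * y powr b) / y" using pos by (simp add: powr_diff)
      also have "\<dots> \<le> c1 * (x powr a * y powr b + x powr b * y powr a) / y"
        using c1_pos pos by (intro divide_right_mono mult_left_mono) auto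
      also have "\<dots> \<le> K x y / y" using K_lower pos by (intro divide_right_mono) auto
      finally have "c \<le> K x y / y" .
      moreover have "\<phi> x - \<phi> (merge n x y) = 1"
        using True z by (auto simp: \<phi>_def merge_def)
      ultimately show ?thesis using True by (simp add: \<beta>_def)
    next
      case False
      then have "c * (\<beta> x * \<beta> y) = 0" by (auto simp: \<beta>_def)
      moreover have "0 \<le> \<phi> x - \<phi> (merge n x y)" using mge by (auto simp: \<phi>_def)
      then have "0 \<le> K x y / y * (\<phi> x - \<phi> (merge n x y))" using K_nonneg[of x y] pos by simp
      ultimately show ?thesis by linarith
    qed
  qed
  have "c * (\<Sum>j\<in>{..<N n}. h n * (E n j \<beta>)\<^sup>2) = (\<Sum>j\<in>{..<N n}. h n * Q n j (\<lambda>x y. c * (\<beta> x * \<beta> y)))"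
    by (simp add: Q_prod[symmetric] power2_eq_square sum_distrib_left Q_def mult_ac)
  also have "\<dots> \<le> (\<Sum>j\<in>{..<N n}. h n * Q n j (\<lambda>x y. K x y / y * (\<phi> x - \<phi> (merge n x y))))"
    using h_pos[of n] n lower by (intro sum_mono mult_left_mono Q_mono) auto
  also have "\<dots> = E n 0 \<phi> - E n (N n) \<phi> + h n * real (N n) * \<phi> (1 / real n)"
    using evolution_sum[OF n, of 0 "N n" \<phi>] by (simp add: atLeast0LessThan)
  also have "\<dots> \<le> M0 - 0 + T * 1"
  proof (intro add_mono diff_mono)
    have "E n 0 \<phi> \<le> E n 0 (\<lambda>_. 1)" using n by (intro E_mono) (auto simp: \<phi>_def)
    then show "E n 0 \<phi> \<le> M0" using total_mass_0[of n] by simp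
    show "0 \<le> E n (N n) \<phi>" using n by (intro E_nonneg) (auto simp: \<phi>_def)
    show "h n * real (N n) * \<phi> (1 / real n) \<le> T * 1"
      using h_N[of n] T_pos by (intro mult_mono) (auto simp: \<phi>_def mult.commute)
  qed
  finally have "c * (\<Sum>j\<in>{..<N n}. h n * (E n j \<beta>)\<^sup>2) \<le> M" by (simp add: M_def)
  then have "(\<Sum>j\<in>{..<N n}. h n * (E n j \<beta>)\<^sup>2) \<le> M / c"
    using c by (simp add: field_simps)
  also have "M / c = M * 2 powr \<bar>a\<bar> / c1 * z powr (1 - a - b)"
    using z c1_pos by (simp add: c_def powr_diff powr_minus powr_add field_simps)
  finally show ?thesis unfolding \<beta>_def .
qed

text \<open>Split \<open>(0, \<delta>]\<close> into dyadic pieces: on each piece \<open>flux_bound\<close> controls the mass in \<open>L\<^sup>2\<close> in time,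
  and the resulting geometric series converges exactly when the exponent \<open>\<theta>\<close> is positive.\<close>

lemma small_masses:
  fixes \<kappa> :: real
  defines "\<theta> \<equiv> \<kappa> + (1 - a - b) / 2"
  assumes \<theta>: "0 < \<theta>"
  obtains C where "0 \<le> C"
    and "\<And>n \<delta> k1 k2. 1 \<le> n \<Longrightarrow> 0 < \<delta> \<Longrightarrow> \<delta> < real n \<Longrightarrow> k1 \<le> k2 \<Longrightarrow> k2 \<le> N n \<Longrightarrow>
    (\<Sum>j\<in>{k1..<k2}. h n * E n j (\<lambda>x. x powr \<kappa> * of_bool (x \<le> \<delta>)))
      \<le> C * sqrt (h n * real (k2 - k1)) * \<delta> powr \<theta>"
proof -
  define B where "B = M * 2 powr \<bar>a\<bar> / c1"
  define D where "D = 2 powr \<bar>\<kappa>\<bar> * sqrt B"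
  define C where "C = D / (1 - 2 powr (- \<theta>))"
  have B: "0 \<le> B" using M_pos c1_pos by (simp add: B_def)
  have lt1: "2 powr (- \<theta>) < 1" using \<theta> by (simp add: powr_less_one)
  have C: "0 \<le> C" using lt1 B by (simp add: C_def D_def)
  have CD: "C * 2 powr (- \<theta>) + D = C" 
  proof -
    have "1 - 2 powr (- \<theta>) \<noteq> 0" using lt1 by linarith
    then have "C * (1 - 2 powr (- \<theta>)) = D" unfolding C_def by simp
    then show ?thesis by (simp add: algebra_simps)
  qed
  have bound: "(\<Sum>j\<in>{k1..<k2}. h n * E n j (\<lambda>x. x powr \<kappa> * of_bool (x \<le> \<delta>)))
      \<le> C * sqrt (h n * real (k2 - k1)) * \<delta> powr \<theta>"
    if n: "1 \<le> n" and k: "k1 \<le> k2" "k2 \<le> N n" and \<delta>: "0 < \<delta>" "\<delta> < real n" "\<delta> < 2 ^ m / real n"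
    for n k1 k2 m \<delta>
    using \<delta>
  proof (induction m arbitrary: \<delta>)
    case 0
    have "E n j (\<lambda>x. x powr \<kappa> * of_bool (x \<le> \<delta>)) = 0" for j
      unfolding E_def using grid_ge[of _ n] 0 by (intro sum.neutral) fastforce
    then show ?case using C h_pos[of n] by simp
  next
    case (Suc m)
    define Y where "Y j = E n j (\<lambda>x. of_bool (\<delta> / 2 < x \<and> x \<le> \<delta>))" for j
    define s where "s = sqrt (h n * real (k2 - k1))"
    have s: "0 \<le> s" using h_pos[of n] by (simp add: s_def)
    have split: "E n j (\<lambda>x. x powr \<kappa> * of_bool (x \<le> \<delta>))
       \<le> E n j (\<lambda>x. x powr \<kappa> * of_bool (x \<le> \<delta> / 2)) + 2 powr \<bar>\<kappa>\<bar> * \<delta> powr \<kappa> * Y j"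
      if j: "j \<le> N n" for j
    proof -
      have "x powr \<kappa> * of_bool (x \<le> \<delta>) \<le> x powr \<kappa> * of_bool (x \<le> \<delta> / 2)
          + (2 powr \<bar>\<kappa>\<bar> * \<delta> powr \<kappa>) * of_bool (\<delta> / 2 < x \<and> x \<le> \<delta>)" if "x \<in> grid n" for x
      proof (cases "\<delta> / 2 < x \<and> x \<le> \<delta>")
        case True
        have "x powr \<kappa> \<le> 2 powr \<bar>\<kappa>\<bar> * \<delta> powr \<kappa>"
        proof (cases "\<kappa> \<ge> 0")
          case True
          have "x powr \<kappa> \<le> 1 * \<delta> powr \<kappa>"
            using True \<open>\<delta> / 2 < x \<and> _\<close> Suc.prems by (auto intro!: powr_mono2)
          also have "\<dots> \<le> 2 powr \<bar>\<kappa>\<bar> * \<delta> powr \<kappa>"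
            by (intro mult_right_mono) (auto intro!: ge_one_powr_ge_zero)
          finally show ?thesis .
        next
          case False
          have "x powr \<kappa> \<le> (\<delta> / 2) powr \<kappa>"
            using False \<open>\<delta> / 2 < x \<and> _\<close> Suc.prems by (intro powr_mono2') auto
          also have "\<dots> = 2 powr \<bar>\<kappa>\<bar> * \<delta> powr \<kappa>"
            using False Suc.prems by (simp add: powr_divide powr_minus field_simps)
          finally show ?thesis .
        qed
        then show ?thesis using True by simp
      next
        case False
        then show ?thesis using Suc.prems by auto
      qed
      then show ?thesis unfolding Y_def E_cmult[symmetric] E_add[symmetric]
        using n j by (intro E_mono) auto
    qed
    have "(\<Sum>j\<in>{k1..<k2}. h n * Y j)\<^sup>2 = (\<Sum>j\<in>{k1..<k2}. sqrt (h n) * (sqrt (h n) * Y j))\<^sup>2"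
      using h_pos[of n] by (simp add: mult.assoc[symmetric] less_imp_le)
    also have "\<dots> \<le> (\<Sum>j\<in>{k1..<k2}. (sqrt (h n))\<^sup>2) * (\<Sum>j\<in>{k1..<k2}. (sqrt (h n) * Y j)\<^sup>2)"
      by (rule Cauchy_Schwarz_ineq_sum)
    also have "\<dots> = (h n * real (k2 - k1)) * (\<Sum>j\<in>{k1..<k2}. h n * (Y j)\<^sup>2)"
      using h_pos[of n] by (simp add: power_mult_distrib less_imp_le)
    also have "\<dots> \<le> (h n * real (k2 - k1)) * (B * \<delta> powr (1 - a - b))"
    proof (rule mult_left_mono)
      have "(\<Sum>j\<in>{k1..<k2}. h n * (Y j)\<^sup>2) \<le> (\<Sum>j\<in>{..<N n}. h n * (Y j)\<^sup>2)"
        using k h_pos[of n] by (intro sum_mono2) auto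
      also have "\<dots> \<le> B * \<delta> powr (1 - a - b)"
        unfolding Y_def B_def by (intro flux_bound n Suc.prems)
      finally show "(\<Sum>j\<in>{k1..<k2}. h n * (Y j)\<^sup>2) \<le> B * \<delta> powr (1 - a - b)" .
    qed (use h_pos[of n] in simp)
    finally have "\<bar>\<Sum>j\<in>{k1..<k2}. h n * Y j\<bar> \<le> sqrt ((h n * real (k2 - k1)) * (B * \<delta> powr (1 - a - b)))"
      by (intro real_le_rsqrt) simp
    also have "\<dots> = s * (sqrt B * \<delta> powr ((1 - a - b) / 2))"
      using Suc.prems by (simp add: s_def real_sqrt_mult powr_half_sqrt[symmetric] powr_powr)
    finally have CS: "(\<Sum>j\<in>{k1..<k2}. h n * Y j) \<le> s * (sqrt B * \<delta> powr ((1 - a - b) / 2))" by simp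
    have "(\<Sum>j\<in>{k1..<k2}. h n * E n j (\<lambda>x. x powr \<kappa> * of_bool (x \<le> \<delta>)))
      \<le> (\<Sum>j\<in>{k1..<k2}. h n * (E n j (\<lambda>x. x powr \<kappa> * of_bool (x \<le> \<delta> / 2)) + 2 powr \<bar>\<kappa>\<bar> * \<delta> powr \<kappa> * Y j))"
      using k h_pos[of n] by (intro sum_mono mult_left_mono split) auto
    also have "\<dots> = (\<Sum>j\<in>{k1..<k2}. h n * E n j (\<lambda>x. x powr \<kappa> * of_bool (x \<le> \<delta> / 2)))
        + 2 powr \<bar>\<kappa>\<bar> * \<delta> powr \<kappa> * (\<Sum>j\<in>{k1..<k2}. h n * Y j)"
      by (simp add: distrib_left sum.distrib sum_distrib_left mult_ac)
    also have "\<dots> \<le> C * s * (\<delta> / 2) powr \<theta>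
        + 2 powr \<bar>\<kappa>\<bar> * \<delta> powr \<kappa> * (s * (sqrt B * \<delta> powr ((1 - a - b) / 2)))"
      using Suc.prems CS unfolding s_def
      by (intro add_mono Suc.IH mult_left_mono) (auto simp: field_simps)
    also have "\<dots> = s * \<delta> powr \<theta> * (C * 2 powr (- \<theta>) + D)"
    proof -
      have "\<delta> powr \<kappa> * \<delta> powr ((1 - a - b) / 2) = \<delta> powr \<theta>"
        by (simp add: \<theta>_def powr_add)
      moreover have "(\<delta> / 2) powr \<theta> = 2 powr (- \<theta>) * \<delta> powr \<theta>"
        using Suc.prems by (simp add: powr_divide powr_minus_divide)
      ultimately show ?thesis by (simp add: D_def algebra_simps)
    qed
    finally show ?case unfolding CD s_def by (simp add: mult_ac)
  qed
  have arch: "\<exists>m. \<delta> < 2 ^ m / real n" if "1 \<le> n" for n \<delta>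
    using real_arch_pow[of 2 "\<delta> * real n"] that by (auto simp: field_simps)
  show ?thesis
  proof (rule that[OF C])
    fix n \<delta> k1 k2 assume A: "1 \<le> n" "0 < \<delta>" "\<delta> < real n" "k1 \<le> k2" "k2 \<le> N n"
    from arch[OF A(1)] obtain m where "\<delta> < 2 ^ m / real n" ..
    with A show "(\<Sum>j\<in>{k1..<k2}. h n * E n j (\<lambda>x. x powr \<kappa> * of_bool (x \<le> \<delta>)))
      \<le> C * sqrt (h n * real (k2 - k1)) * \<delta> powr \<theta>"
      by (intro bound)
  qed
qed

lemma plateau_merge:
  assumes "z1 < z2" "z2 \<le> real n"
  shows "plateau z1 z2 (merge n x y) = plateau z1 z2 (x + y)"
  using assms by (auto simp: plateau_def merge_def min_def max_def)

lemma plateau_nonneg: "z1 < z2 \<Longrightarrow> 0 \<le> plateau z1 z2 x"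
  by (simp add: plateau_def)

lemma plateau_le: "plateau z1 z2 x \<le> z2 - z1"
  by (simp add: plateau_def)

lemma evolution_plateau:
  assumes "1 \<le> n" "k1 \<le> k2" "z1 < z2" "z2 \<le> real n"
  shows "E n k2 (plateau z1 z2) = E n k1 (plateau z1 z2) + h n * real (k2 - k1) * plateau z1 z2 (1 / real n)
    - (\<Sum>j\<in>{k1..<k2}. h n * Q n j (jump z1 z2))"
  using evolution_sum[OF assms(1,2), of "plateau z1 z2"]
  by (simp add: plateau_merge[OF assms(3,4)] jump_def[abs_def])

definition S_below :: "real \<Rightarrow> real \<Rightarrow> real" where
  "S_below \<delta> x = S x * of_bool (x \<le> \<delta>)"

lemma S_below_nonneg: "0 \<le> S_below \<delta> x"
  using S_nonneg by (simp add: S_below_def)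

definition \<theta>1 :: real where "\<theta>1 = (1 + a - b) / 2"
definition \<theta>2 :: real where "\<theta>2 = (1 + b - a) / 2"

lemma \<theta>_pos: "0 < \<theta>1" "0 < \<theta>2"
  using ab by (auto simp: \<theta>1_def \<theta>2_def)

lemma small_S:
  obtains C where "0 \<le> C"
    and "\<And>n \<delta> k1 k2. 1 \<le> n \<Longrightarrow> 0 < \<delta> \<Longrightarrow> \<delta> < real n \<Longrightarrow> k1 \<le> k2 \<Longrightarrow> k2 \<le> N n \<Longrightarrow>
    (\<Sum>j\<in>{k1..<k2}. h n * E n j (S_below \<delta>))
      \<le> C * sqrt (h n * real (k2 - k1)) * (\<delta> powr \<theta>1 + \<delta> powr \<theta>2)"
proof -
  have eq: "a + (1 - a - b) / 2 = \<theta>1" "b + (1 - a - b) / 2 = \<theta>2"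
    by (auto simp: \<theta>1_def \<theta>2_def field_simps)
  obtain C1 where C1: "C1 \<ge> 0" "\<And>n \<delta> k1 k2. 1 \<le> n \<Longrightarrow> 0 < \<delta> \<Longrightarrow> \<delta> < real n \<Longrightarrow> k1 \<le> k2 \<Longrightarrow> k2 \<le> N n \<Longrightarrow>
    (\<Sum>j\<in>{k1..<k2}. h n * E n j (\<lambda>x. x powr a * of_bool (x \<le> \<delta>)))
      \<le> C1 * sqrt (h n * real (k2 - k1)) * \<delta> powr \<theta>1"
    by (rule small_masses[of a, unfolded eq, OF \<theta>_pos(1)], rule that)
  obtain C2 where C2: "C2 \<ge> 0" "\<And>n \<delta> k1 k2. 1 \<le> n \<Longrightarrow> 0 < \<delta> \<Longrightarrow> \<delta> < real n \<Longrightarrow> k1 \<le> k2 \<Longrightarrow> k2 \<le> N n \<Longrightarrow>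
    (\<Sum>j\<in>{k1..<k2}. h n * E n j (\<lambda>x. x powr b * of_bool (x \<le> \<delta>)))
      \<le> C2 * sqrt (h n * real (k2 - k1)) * \<delta> powr \<theta>2"
    by (rule small_masses[of b, unfolded eq, OF \<theta>_pos(2)], rule that)
  show ?thesis
  proof (rule that[of "C1 + C2"])
    fix n \<delta> k1 k2 assume A: "1 \<le> n" "0 < \<delta>" "\<delta> < real n" "k1 \<le> k2" "k2 \<le> N n"
    define s where "s = sqrt (h n * real (k2 - k1))"
    have s: "0 \<le> s" using h_pos[of n] by (simp add: s_def)
    have "(\<Sum>j\<in>{k1..<k2}. h n * E n j (S_below \<delta>))
      = (\<Sum>j\<in>{k1..<k2}. h n * E n j (\<lambda>x. x powr a * of_bool (x \<le> \<delta>)))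
        + (\<Sum>j\<in>{k1..<k2}. h n * E n j (\<lambda>x. x powr b * of_bool (x \<le> \<delta>)))"
      unfolding sum.distrib[symmetric] distrib_left[symmetric] E_add[symmetric]
      by (simp add: S_below_def[abs_def] S_def distrib_right)
    also have "\<dots> \<le> C1 * s * \<delta> powr \<theta>1 + C2 * s * \<delta> powr \<theta>2"
      unfolding s_def by (intro add_mono C1(2) C2(2) A)
    also have "\<dots> \<le> (C1 + C2) * s * (\<delta> powr \<theta>1 + \<delta> powr \<theta>2)"
      using C1(1) C2(1) s by (simp add: algebra_simps)
    finally show "(\<Sum>j\<in>{k1..<k2}. h n * E n j (S_below \<delta>))
      \<le> (C1 + C2) * sqrt (h n * real (k2 - k1)) * (\<delta> powr \<theta>1 + \<delta> powr \<theta>2)" by (simp add: s_def)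
  qed (use C1(1) C2(1) in auto)
qed

lemma jump_far:
  assumes "z1 < z2" "0 < x" "0 < l" "l \<le> y"
  shows "jump z1 z2 x y \<le> c2 * (z2 - z1) * (l powr (a - 1) + l powr (b - 1)) * S_below z2 x"
proof -
  have "jump z1 z2 x y \<le> c2 * (z2 - z1) * S_below z2 x * (y powr (a - 1) + y powr (b - 1))"
    using jump_large_y[of z1 z2 x y] assms by (simp add: S_below_def)
  also have "\<dots> \<le> c2 * (z2 - z1) * S_below z2 x * (l powr (a - 1) + l powr (b - 1))"
    using c2_pos assms S_below_nonneg a_less b_less
    by (intro mult_left_mono add_mono powr_mono2') auto
  finally show ?thesis by (simp add: mult_ac)
qed

lemma jump_le_split:
  assumes z: "0 < z1" "z1 < z2"
  obtains A where "0 \<le> A" and "\<And>x y. 0 < x \<Longrightarrow> 0 < y \<Longrightarrow>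
    jump z1 z2 x y \<le> A * S_below z2 x + A * S_below (z1 / 2) y"
proof -
  define A1 where "A1 = c2 * (S (z1/2) + S z2)"
  define A2 where "A2 = c2 * (z2 - z1) * ((z1/2) powr (a - 1) + (z1/2) powr (b - 1))"
  have A: "0 \<le> A1" "0 \<le> A2" using c2_pos z S_nonneg by (auto simp: A1_def A2_def)
  have "jump z1 z2 x y \<le> (A1 + A2) * S_below z2 x + (A1 + A2) * S_below (z1 / 2) y"
    if xy: "0 < x" "0 < y" for x y
  proof (cases "y \<le> z1 / 2")
    case True
    then have "jump z1 z2 x y \<le> A1 * S_below (z1 / 2) y"
      using jump_small_y[OF z xy True] by (simp add: A1_def S_below_def)
    also have "\<dots> \<le> (A1 + A2) * S_below z2 x + (A1 + A2) * S_below (z1 / 2) y"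
      using A S_below_nonneg[of z2 x] S_below_nonneg[of "z1/2" y] by (simp add: algebra_simps)
    finally show ?thesis .
  next
    case False
    have "jump z1 z2 x y \<le> A2 * S_below z2 x"
      using jump_far[OF z(2) xy(1), of "z1 / 2" y] z False by (simp add: A2_def)
    also have "\<dots> \<le> (A1 + A2) * S_below z2 x + (A1 + A2) * S_below (z1 / 2) y"
      using A S_below_nonneg[of z2 x] S_below_nonneg[of "z1/2" y] by (simp add: algebra_simps)
    finally show ?thesis .
  qed
  then show ?thesis using A by (intro that[of "A1 + A2"]) auto
qed

lemma equicontinuity:
  assumes z: "0 < z1" "z1 < z2"
  obtains C where "0 \<le> C"
    and "\<And>n k1 k2. 1 \<le> n \<Longrightarrow> z2 < real n \<Longrightarrow> k1 \<le> k2 \<Longrightarrow> k2 \<le> N n \<Longrightarrow>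
    \<bar>E n k2 (plateau z1 z2) - E n k1 (plateau z1 z2)\<bar>
      \<le> C * (sqrt (h n * real (k2 - k1)) + h n * real (k2 - k1))"
proof -
  obtain A where A: "A \<ge> 0" "\<And>x y. 0 < x \<Longrightarrow> 0 < y \<Longrightarrow>
    jump z1 z2 x y \<le> A * S_below z2 x + A * S_below (z1 / 2) y"
    by (rule jump_le_split[OF z], rule that)
  obtain C where C: "C \<ge> 0" "\<And>n \<delta> k1 k2. 1 \<le> n \<Longrightarrow> 0 < \<delta> \<Longrightarrow> \<delta> < real n \<Longrightarrow> k1 \<le> k2 \<Longrightarrow> k2 \<le> N n \<Longrightarrow>
    (\<Sum>j\<in>{k1..<k2}. h n * E n j (S_below \<delta>))
      \<le> C * sqrt (h n * real (k2 - k1)) * (\<delta> powr \<theta>1 + \<delta> powr \<theta>2)"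
    by (rule small_S, rule that)
  define F where "F \<delta> = \<delta> powr \<theta>1 + \<delta> powr \<theta>2" for \<delta> :: real
  have F: "0 \<le> F \<delta>" for \<delta> by (simp add: F_def)
  define G where "G = M * A * C * (F z2 + F (z1/2))"
  have G: "0 \<le> G" using M_pos A C F by (simp add: G_def)
  show ?thesis
  proof (rule that[of "G + (z2 - z1)"])
    fix n k1 k2 assume n: "1 \<le> n" "z2 < real n" and k: "k1 \<le> k2" "k2 \<le> N n"
    define t where "t = h n * real (k2 - k1)"
    have t: "0 \<le> t" using h_pos[of n] by (simp add: t_def)
    have j0: "0 \<le> (\<Sum>j\<in>{k1..<k2}. h n * Q n j (jump z1 z2))"
      using n k h_pos[of n] z
      by (intro sum_nonneg mult_nonneg_nonneg Q_nonneg jump_nonneg) (auto simp: grid_pos)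
    have "(\<Sum>j\<in>{k1..<k2}. h n * Q n j (jump z1 z2))
        \<le> (\<Sum>j\<in>{k1..<k2}. h n * (M * (E n j (\<lambda>x. A * S_below z2 x) + E n j (\<lambda>y. A * S_below (z1/2) y))))"
      using n k h_pos[of n] A S_below_nonneg
      by (intro sum_mono mult_left_mono Q_le_sum) (auto simp: grid_pos)
    also have "\<dots> = M * A * ((\<Sum>j\<in>{k1..<k2}. h n * E n j (S_below z2)) + (\<Sum>j\<in>{k1..<k2}. h n * E n j (S_below (z1/2))))"
      by (simp add: E_cmult sum_distrib_left sum.distrib algebra_simps)
    also have "\<dots> \<le> M * A * (C * sqrt t * F z2 + C * sqrt t * F (z1/2))"
      unfolding t_def F_def using n k z M_pos A(1) by (intro mult_left_mono add_mono C(2)) auto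
    also have "\<dots> = G * sqrt t" by (simp add: G_def algebra_simps)
    finally have j1: "(\<Sum>j\<in>{k1..<k2}. h n * Q n j (jump z1 z2)) \<le> G * sqrt t" .
    have p: "0 \<le> t * plateau z1 z2 (1 / real n)" "t * plateau z1 z2 (1 / real n) \<le> t * (z2 - z1)"
      using t plateau_nonneg[OF z(2)] plateau_le by (auto intro: mult_left_mono)
    have "E n k2 (plateau z1 z2) = E n k1 (plateau z1 z2) + t * plateau z1 z2 (1 / real n)
      - (\<Sum>j\<in>{k1..<k2}. h n * Q n j (jump z1 z2))"
      unfolding t_def using n k z by (intro evolution_plateau) auto
    then have "\<bar>E n k2 (plateau z1 z2) - E n k1 (plateau z1 z2)\<bar> \<le> G * sqrt t + t * (z2 - z1)"
      using j0 j1 p by linarith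
    also have "\<dots> \<le> (G + (z2 - z1)) * (sqrt t + t)"
    proof -
      have "0 \<le> G * t" "0 \<le> (z2 - z1) * sqrt t" using G t z by auto
      then show ?thesis by (simp add: algebra_simps)
    qed
    finally show "\<bar>E n k2 (plateau z1 z2) - E n k1 (plateau z1 z2)\<bar>
      \<le> (G + (z2 - z1)) * (sqrt (h n * real (k2 - k1)) + h n * real (k2 - k1))" by (simp add: t_def)
  qed (use G z in auto)
qed

text \<open>\<open>cut i\<close> increases to 1 on \<open>(0, \<infinity>)\<close>; since \<open>x / 0 = 0\<close>, \<open>cut 0\<close> vanishes.\<close>

definition cut :: "nat \<Rightarrow> real \<Rightarrow> real" where
  "cut i x = max 0 (min 1 (real i * x - 1)) * max 0 (min 1 (2 - x / real i))"

lemma cut_nonneg: "0 \<le> cut i x" by (simp add: cut_def)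
lemma cut_le_1: "cut i x \<le> 1" by (simp add: cut_def mult_le_one)

lemma cut_eq_1: "1 \<le> i \<Longrightarrow> 2 / real i \<le> x \<Longrightarrow> x \<le> real i \<Longrightarrow> cut i x = 1"
proof -
  assume A: "1 \<le> i" "2 / real i \<le> x" "x \<le> real i"
  then have "2 \<le> real i * x" "x / real i \<le> 1" by (auto simp: divide_le_eq mult.commute)
  then show ?thesis by (simp add: cut_def)
qed

lemma cut_eq_0: "1 \<le> i \<Longrightarrow> x \<le> 1 / real i \<or> 2 * real i \<le> x \<Longrightarrow> cut i x = 0"
proof -
  assume A: "1 \<le> i" "x \<le> 1 / real i \<or> 2 * real i \<le> x"
  then have "real i * x \<le> 1 \<or> 2 \<le> x / real i" by (auto simp: le_divide_eq mult.commute)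
  then show ?thesis by (auto simp: cut_def)
qed

lemma cut_mono:
  assumes "1 \<le> i" "i \<le> j" "0 < x"
  shows "cut i x \<le> cut j x"
proof -
  have "real i * x \<le> real j * x" "x / real j \<le> x / real i"
    using assms by (auto intro!: mult_right_mono divide_left_mono)
  then show ?thesis unfolding cut_def by (intro mult_mono) auto
qed

definition jump_cut :: "real \<Rightarrow> real \<Rightarrow> nat \<Rightarrow> real \<Rightarrow> real \<Rightarrow> real" where
  "jump_cut z1 z2 i x y = jump z1 z2 x y * (cut i x * cut i y)"

lemma jump_cut_le:
  assumes "z1 < z2" "0 < x" "0 < y"
  shows "jump_cut z1 z2 i x y \<le> jump z1 z2 x y"
proof -
  have "cut i x * cut i y \<le> 1" using cut_le_1 cut_nonneg by (intro mult_le_one)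
  then show ?thesis unfolding jump_cut_def
    using jump_nonneg[OF assms] by (simp add: mult_left_le)
qed

lemma jump_cut_nonneg: "z1 < z2 \<Longrightarrow> 0 < x \<Longrightarrow> 0 < y \<Longrightarrow> 0 \<le> jump_cut z1 z2 i x y"
  using jump_nonneg cut_nonneg by (simp add: jump_cut_def)

lemma jump_tail:
  assumes z: "0 < z1" "z1 < z2"
  obtains A where "0 \<le> A"
    and "\<And>i x y. 1 \<le> i \<Longrightarrow> z2 < real i \<Longrightarrow> 2 / real i \<le> z1 / 2 \<Longrightarrow> 0 < x \<Longrightarrow> 0 < y \<Longrightarrow>
    jump z1 z2 x y - jump_cut z1 z2 i x y
      \<le> (A * S_below (2 / real i) x + A * (real i powr (a - 1) + real i powr (b - 1)) * S_below z2 x)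
        + A * S_below (2 / real i) y"
proof -
  define A1 where "A1 = c2 * (S (z1/2) + S z2)"
  define A2 where "A2 = c2 * (z2 - z1) * ((z1/2) powr (a - 1) + (z1/2) powr (b - 1))"
  define A3 where "A3 = c2 * (z2 - z1)"
  define A where "A = A1 + A2 + A3"
  have A: "0 \<le> A1" "0 \<le> A2" "0 \<le> A3" using c2_pos z S_nonneg by (auto simp: A1_def A2_def A3_def)
  have Ale: "A1 \<le> A" "A2 \<le> A" "A3 \<le> A" "0 \<le> A" using A by (auto simp: A_def)
  have "jump z1 z2 x y - jump_cut z1 z2 i x y
      \<le> (A * S_below (2 / real i) x + A * (real i powr (a - 1) + real i powr (b - 1)) * S_below z2 x)
        + A * S_below (2 / real i) y"
    if i: "1 \<le> i" "z2 < real i" "2 / real i \<le> z1 / 2" and xy: "0 < x" "0 < y" for i x y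
  proof -
    let ?P = "real i powr (a - 1) + real i powr (b - 1)"
    have nn: "0 \<le> A * S_below (2 / real i) x" "0 \<le> A * ?P * S_below z2 x" "0 \<le> A * S_below (2 / real i) y"
      using Ale S_below_nonneg by auto
    have le: "jump z1 z2 x y - jump_cut z1 z2 i x y \<le> jump z1 z2 x y"
      using jump_cut_nonneg[OF z(2) xy, of i] by simp
    consider "z2 \<le> x \<or> x + y \<le> z1" | "y < 2 / real i" | "x < z2" "z1 / 2 < y" "x < 2 / real i" "2 / real i \<le> y"
      | "x < z2" "real i < y" | "x < z2" "2 / real i \<le> x" "2 / real i \<le> y" "y \<le> real i"
      using i z by linarith
    then show ?thesis
    proof cases
      case 1
      then have "jump z1 z2 x y = 0" using z xy by (intro jump_eq_0) auto
      then show ?thesis using le nn by linarith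
    next
      case 2
      have "jump z1 z2 x y \<le> A1 * S y"
        using jump_small_y[OF z xy] 2 i by (simp add: A1_def)
      also have "\<dots> \<le> A * S y" using Ale S_nonneg by (intro mult_right_mono)
      also have "A * S y = A * S_below (2 / real i) y" using 2 by (simp add: S_below_def)
      finally show ?thesis using le nn by linarith
    next
      case 3
      have "jump z1 z2 x y \<le> A2 * S x"
        using jump_far[OF z(2) xy(1), of "z1 / 2" y] z 3 by (simp add: A2_def S_below_def)
      also have "\<dots> \<le> A * S x" using Ale S_nonneg by (intro mult_right_mono)
      also have "A * S x = A * S_below (2 / real i) x" using 3 by (simp add: S_below_def)
      finally show ?thesis using le nn by linarith
    next
      case 4
      have "jump z1 z2 x y \<le> A3 * (?P * S_below z2 x)"
        using jump_far[OF z(2) xy(1), of "real i" y] i 4 by (simp add: A3_def mult.assoc)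
      also have "\<dots> \<le> A * (?P * S_below z2 x)"
        using Ale S_below_nonneg by (intro mult_right_mono) auto
      finally show ?thesis using le nn by (simp add: mult.assoc)
    next
      case 5
      then have "cut i x = 1" "cut i y = 1" using i by (auto intro!: cut_eq_1)
      then have "jump z1 z2 x y - jump_cut z1 z2 i x y = 0" by (simp add: jump_cut_def)
      then show ?thesis using nn by linarith
    qed
  qed
  then show ?thesis using Ale(4) by (intro that[of A])
qed

lemma truncation_error:
  assumes z: "0 < z1" "z1 < z2"
  obtains err where "err \<longlonglongrightarrow> 0"
    and "\<And>i n k. 1 \<le> i \<Longrightarrow> z2 < real i \<Longrightarrow> 2 / real i \<le> z1 / 2 \<Longrightarrow>
     1 \<le> n \<Longrightarrow> z2 < real n \<Longrightarrow> k \<le> N n \<Longrightarrow>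
     (\<Sum>j\<in>{..<k}. h n * Q n j (jump z1 z2)) - (\<Sum>j\<in>{..<k}. h n * Q n j (jump_cut z1 z2 i)) \<le> err i"
proof -
  obtain A where A: "A \<ge> 0" "\<And>i x y. 1 \<le> i \<Longrightarrow> z2 < real i \<Longrightarrow> 2 / real i \<le> z1 / 2 \<Longrightarrow> 0 < x \<Longrightarrow> 0 < y \<Longrightarrow>
    jump z1 z2 x y - jump_cut z1 z2 i x y
      \<le> (A * S_below (2 / real i) x + A * (real i powr (a - 1) + real i powr (b - 1)) * S_below z2 x)
        + A * S_below (2 / real i) y"
    by (rule jump_tail[OF z], rule that)
  obtain C where C: "C \<ge> 0" "\<And>n \<delta> k1 k2. 1 \<le> n \<Longrightarrow> 0 < \<delta> \<Longrightarrow> \<delta> < real n \<Longrightarrow> k1 \<le> k2 \<Longrightarrow> k2 \<le> N n \<Longrightarrow>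
    (\<Sum>j\<in>{k1..<k2}. h n * E n j (S_below \<delta>))
      \<le> C * sqrt (h n * real (k2 - k1)) * (\<delta> powr \<theta>1 + \<delta> powr \<theta>2)"
    by (rule small_S, rule that)
  define F where "F \<delta> = \<delta> powr \<theta>1 + \<delta> powr \<theta>2" for \<delta> :: real
  define P where "P i = real i powr (a - 1) + real i powr (b - 1)" for i :: nat
  have P0: "0 \<le> P i" for i by (simp add: P_def)
  define err where "err i = M * A * C * sqrt T * (2 * F (2 / real i) + P i * F z2)" for i
  have small: "(\<Sum>j\<in>{..<k}. h n * E n j (S_below \<delta>)) \<le> C * sqrt T * F \<delta>"
    if "1 \<le> n" "0 < \<delta>" "\<delta> < real n" "k \<le> N n" for n \<delta> k
  proof -
    have "(\<Sum>j\<in>{0..<k}. h n * E n j (S_below \<delta>)) \<le> C * sqrt (h n * real (k - 0)) * F \<delta>"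
      unfolding F_def using that by (intro C(2)) auto
    also have "\<dots> \<le> C * sqrt T * F \<delta>"
      using h_k_le[of k n] that C(1) by (intro mult_right_mono mult_left_mono) (auto simp: F_def)
    finally show ?thesis by (simp add: atLeast0LessThan)
  qed
  have "(\<lambda>i. F (2 / real i)) \<longlonglongrightarrow> 0 + 0"
    unfolding F_def using \<theta>_pos
    by (intro tendsto_add tendsto_zero_powrI[OF lim_const_over_n tendsto_const]) auto
  moreover have "P \<longlonglongrightarrow> 0 + 0"
    unfolding P_def using a_less b_less
    by (intro tendsto_add tendsto_neg_powr) (auto intro!: filterlim_real_sequentially)
  ultimately have "err \<longlonglongrightarrow> M * A * C * sqrt T * (2 * (0 + 0) + (0 + 0) * F z2)"
    unfolding err_def by (intro tendsto_intros) auto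
  then have "err \<longlonglongrightarrow> 0" by simp
  moreover have "(\<Sum>j\<in>{..<k}. h n * Q n j (jump z1 z2)) - (\<Sum>j\<in>{..<k}. h n * Q n j (jump_cut z1 z2 i)) \<le> err i"
    if i: "1 \<le> i" "z2 < real i" "2 / real i \<le> z1 / 2" and n: "1 \<le> n" "z2 < real n" "k \<le> N n" for i n k
  proof -
    have i2: "0 < 2 / real i" "2 / real i < real n" using i n z by auto
    have "(\<Sum>j\<in>{..<k}. h n * Q n j (jump z1 z2)) - (\<Sum>j\<in>{..<k}. h n * Q n j (jump_cut z1 z2 i))
       = (\<Sum>j\<in>{..<k}. h n * Q n j (\<lambda>x y. jump z1 z2 x y - jump_cut z1 z2 i x y))"
      by (simp add: Q_diff sum_subtractf right_diff_distrib)
    also have "\<dots> \<le> (\<Sum>j\<in>{..<k}. h n * (M * (E n j (\<lambda>x. A * S_below (2 / real i) x + A * P i * S_below z2 x)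
          + E n j (\<lambda>y. A * S_below (2 / real i) y))))"
      unfolding P_def using A S_below_nonneg i n h_pos[of n]
      by (intro sum_mono mult_left_mono Q_le_sum) (auto simp: grid_pos)
    also have "\<dots> = M * A * (2 * (\<Sum>j\<in>{..<k}. h n * E n j (S_below (2 / real i)))
        + P i * (\<Sum>j\<in>{..<k}. h n * E n j (S_below z2)))"
      by (simp add: E_cmult E_add sum_distrib_left sum.distrib algebra_simps)
    also have "\<dots> \<le> M * A * (2 * (C * sqrt T * F (2 / real i)) + P i * (C * sqrt T * F z2))"
      using M_pos A(1) P0[of i] n i2 z
      by (intro mult_left_mono add_mono small) auto
    also have "\<dots> = err i" by (simp add: err_def algebra_simps)
    finally show ?thesis .
  qed
  ultimately show ?thesis by (rule that)
qed

end

section \<open>Weak convergence on the compactified half-line\<close>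

text \<open>The half-line is compactified by \<open>u = x / (1 + x)\<close>. An atom at \<open>u = 0\<close> then stands for dust,
  an atom at \<open>u = 1\<close> for mass that has escaped to infinity.\<close>

definition hat :: "(real \<Rightarrow> real) \<Rightarrow> real \<Rightarrow> real" where
  "hat f u = (if 0 < u \<and> u < 1 then f (u / (1 - u)) else 0)"

definition plateau_hat :: "real \<Rightarrow> real \<Rightarrow> real \<Rightarrow> real" where
  "plateau_hat z1 z2 u = (if u < 1 then plateau z1 z2 (u / (1 - u)) else 0)"

lemma plateau_hat_bounds: "z1 < z2 \<Longrightarrow> 0 \<le> plateau_hat z1 z2 u" "z1 < z2 \<Longrightarrow> plateau_hat z1 z2 u \<le> z2 - z1"
  by (auto simp: plateau_hat_def plateau_def)

lemma div_one_minus_le_iff: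
  fixes u z :: real
  assumes "u < 1" "0 < 1 + z"
  shows "u / (1 - u) \<le> z \<longleftrightarrow> u \<le> z / (1 + z)"
  using assms by (simp add: field_simps)

lemma plateau_hat_eq_0:
  assumes "0 < z1" "z1 < z2" "z2 / (1 + z2) \<le> u"
  shows "plateau_hat z1 z2 u = 0"
proof (cases "u < 1")
  case True
  then have "z2 \<le> u / (1 - u)" using assms by (simp add: field_simps)
  then show ?thesis using assms by (simp add: plateau_hat_def plateau_def)
qed (simp add: plateau_hat_def)

lemma plateau_hat_eq_max:
  assumes "0 < z1" "z1 < z2" "u \<le> z1 / (1 + z1)"
  shows "plateau_hat z1 z2 u = z2 - z1"
proof -
  have "z1 / (1 + z1) < 1" using assms by (simp add: divide_simps)
  then have "u < 1" using assms by linarith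
  then have "u / (1 - u) \<le> z1" using div_one_minus_le_iff[of u z1] assms by simp
  then show ?thesis using assms \<open>u < 1\<close> by (simp add: plateau_hat_def plateau_def)
qed

lemma plateau_hat_isCont:
  assumes "0 < z1" "z1 < z2"
  shows "isCont (plateau_hat z1 z2) u"
proof -
  let ?w = "z2 / (1 + z2)"
  have w: "?w < 1" using assms by (simp add: divide_simps)
  have "continuous_on {..<1} (plateau_hat z1 z2)"
    unfolding plateau_def
    by (rule continuous_on_eq[where f="\<lambda>u. plateau z1 z2 (u / (1 - u))"])
      (auto simp: plateau_hat_def plateau_def intro!: continuous_intros)
  moreover have "continuous_on {?w<..} (plateau_hat z1 z2)"
    by (rule continuous_on_eq[where f="\<lambda>u. 0"])
      (use plateau_hat_eq_0[OF assms] in \<open>auto intro!: continuous_intros\<close>)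
  ultimately have "continuous_on ({..<1} \<union> {?w<..}) (plateau_hat z1 z2)"
    by (intro continuous_on_open_Un) auto
  moreover have "{..<1} \<union> {?w<..} = UNIV" using w by auto
  ultimately show ?thesis by (simp add: continuous_on_eq_continuous_at)
qed

lemma plateau_hat_measurable: "0 < z1 \<Longrightarrow> z1 < z2 \<Longrightarrow> plateau_hat z1 z2 \<in> borel_measurable borel"
  using plateau_hat_isCont
  by (intro borel_measurable_continuous_onI) (simp add: continuous_at_imp_continuous_on)

definition on_unit :: "real measure \<Rightarrow> bool" where
  "on_unit \<nu> \<longleftrightarrow> real_distribution \<nu> \<and> (AE u in \<nu>. 0 \<le> u \<and> u \<le> 1)"

lemma on_unit_cdf:
  assumes "on_unit \<nu>"
  shows "x < 0 \<Longrightarrow> cdf \<nu> x = 0" "1 \<le> x \<Longrightarrow> cdf \<nu> x = 1"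
proof -
  interpret real_distribution \<nu> using assms by (simp add: on_unit_def)
  have ae: "AE u in \<nu>. 0 \<le> u \<and> u \<le> 1" using assms by (simp add: on_unit_def)
  show "cdf \<nu> x = 0" if "x < 0"
    unfolding cdf_def using ae that by (intro prob_eq_0[THEN iffD2]) (auto elim!: eventually_mono)
  show "cdf \<nu> x = 1" if "1 \<le> x"
  proof -
    have "AE u in \<nu>. u \<in> {..x}" using ae by eventually_elim (use that in auto)
    then show ?thesis unfolding cdf_def by (intro prob_eq_1[THEN iffD2]) auto
  qed
qed

lemma plateau_hat_cdf:
  assumes "real_distribution \<nu>" "0 < p" "p < q" "q < 1"
  defines "z1 \<equiv> p / (1 - p)" and "z2 \<equiv> q / (1 - q)"
  shows "0 < z1" "z1 < z2" "cdf \<nu> p \<le> (\<integral>u. plateau_hat z1 z2 u \<partial>\<nu>) / (z2 - z1)"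
    "(\<integral>u. plateau_hat z1 z2 u \<partial>\<nu>) / (z2 - z1) \<le> cdf \<nu> q"
proof -
  interpret real_distribution \<nu> by fact
  show z: "0 < z1" "z1 < z2" using assms by (auto simp: z1_def z2_def field_simps)
  have pq: "p = z1 / (1 + z1)" "q = z2 / (1 + z2)" using assms by (auto simp: z1_def z2_def field_simps)
  have int: "integrable \<nu> (plateau_hat z1 z2)"
    using plateau_hat_bounds[OF z(2)] plateau_hat_measurable[OF z]
    by (intro integrable_const_bound[where B="z2 - z1"]) auto
  have ind: "integrable \<nu> (\<lambda>u. (z2 - z1) * indicator {..x} u)" for x :: real
    using z by (intro integrable_const_bound[where B="z2 - z1"]) (auto split: split_indicator)
  have "(z2 - z1) * cdf \<nu> p = (\<integral>u. (z2 - z1) * indicator {..p} u \<partial>\<nu>)" by (simp add: cdf_def)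
  also have "\<dots> \<le> (\<integral>u. plateau_hat z1 z2 u \<partial>\<nu>)"
    using int ind plateau_hat_bounds(1)[OF z(2)] plateau_hat_eq_max[OF z] pq
    by (intro integral_mono) (auto split: split_indicator)
  finally show "cdf \<nu> p \<le> (\<integral>u. plateau_hat z1 z2 u \<partial>\<nu>) / (z2 - z1)"
    using z by (simp add: pos_le_divide_eq mult.commute)
  have "(\<integral>u. plateau_hat z1 z2 u \<partial>\<nu>) \<le> (\<integral>u. (z2 - z1) * indicator {..q} u \<partial>\<nu>)"
    using int ind plateau_hat_bounds(2)[OF z(2)] plateau_hat_eq_0[OF z] pq z
    by (intro integral_mono) (auto split: split_indicator)
  also have "\<dots> = (z2 - z1) * cdf \<nu> q" by (simp add: cdf_def)
  finally show "(\<integral>u. plateau_hat z1 z2 u \<partial>\<nu>) / (z2 - z1) \<le> cdf \<nu> q"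
    using z by (simp add: pos_divide_le_eq mult.commute)
qed

lemma weak_conv_plateau:
  assumes \<nu>n: "\<And>n. on_unit (\<nu>n n)" and \<nu>: "on_unit \<nu>"
    and conv: "\<And>z1 z2. z1 \<in> \<rat> \<Longrightarrow> z2 \<in> \<rat> \<Longrightarrow> 0 < z1 \<Longrightarrow> z1 < z2 \<Longrightarrow>
      (\<lambda>n. \<integral>u. plateau_hat z1 z2 u \<partial>\<nu>n n) \<longlonglongrightarrow> (\<integral>u. plateau_hat z1 z2 u \<partial>\<nu>)"
  shows "weak_conv_m \<nu>n \<nu>"
  unfolding weak_conv_m_def weak_conv_def
proof (intro allI impI)
  fix x assume cont: "isCont (cdf \<nu>) x"
  have rd: "real_distribution (\<nu>n n)" for n using \<nu>n by (simp add: on_unit_def)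
  interpret real_distribution \<nu> using \<nu> by (simp add: on_unit_def)
  interpret \<nu>n: real_distribution "\<nu>n n" for n by (rule rd)
  have conv': "(\<lambda>n. (\<integral>u. plateau_hat (p / (1 - p)) (q / (1 - q)) u \<partial>\<nu>n n) / (q / (1 - q) - p / (1 - p)))
      \<longlonglongrightarrow> (\<integral>u. plateau_hat (p / (1 - p)) (q / (1 - q)) u \<partial>\<nu>) / (q / (1 - q) - p / (1 - p))"
    if "0 < p" "p < q" "q < 1" "p \<in> \<rat>" "q \<in> \<rat>" for p q
    using plateau_hat_cdf(1,2)[OF real_distribution_axioms that(1-3)] that
    by (intro tendsto_intros conv) auto
  consider "x < 0" | "1 \<le> x" | "0 \<le> x" "x < 1" by linarith
  then show "(\<lambda>n. cdf (\<nu>n n) x) \<longlonglongrightarrow> cdf \<nu> x"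
  proof cases
    case 1
    then show ?thesis using on_unit_cdf(1) \<nu>n \<nu> by simp
  next
    case 2
    then show ?thesis using on_unit_cdf(2) \<nu>n \<nu> by simp
  next
    case 3
    show ?thesis
    proof (rule order_tendstoI)
      fix l assume l: "cdf \<nu> x < l"
      have "(cdf \<nu> \<longlongrightarrow> cdf \<nu> x) (at_right x)"
        using cdf_is_right_cont[of x] by (simp add: continuous_within)
      then have "\<forall>\<^sub>F y in at_right x. cdf \<nu> y < l" using l by (rule order_tendstoD)
      moreover have "\<forall>\<^sub>F y in at_right x. y < 1"
        using 3 eventually_at_right_field[of "\<lambda>y. y < 1" x] by auto
      ultimately have "\<forall>\<^sub>F y in at_right x. cdf \<nu> y < l \<and> y < 1" by (rule eventually_conj)
      then obtain y0 where "x < y0" "\<And>y. x < y \<Longrightarrow> y < y0 \<Longrightarrow> cdf \<nu> y < l \<and> y < 1"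
        unfolding eventually_at_right_field by auto
      then obtain q where q: "q \<in> \<rat>" "x < q" "cdf \<nu> q < l" "q < 1"
        using Rats_dense_in_real[of x y0] by metis
      obtain p where p: "p \<in> \<rat>" "x < p" "p < q" using Rats_dense_in_real[OF q(2)] by metis
      have pq: "0 < p" "p < q" "q < 1" using p q 3 by auto
      have "(\<integral>u. plateau_hat (p / (1 - p)) (q / (1 - q)) u \<partial>\<nu>) / (q / (1 - q) - p / (1 - p)) < l"
        using plateau_hat_cdf(4)[OF real_distribution_axioms pq] q by linarith
      from order_tendstoD(2)[OF conv'[OF pq p(1) q(1)] this]
      show "\<forall>\<^sub>F n in sequentially. cdf (\<nu>n n) x < l"
      proof eventually_elim
        case (elim n)
        have "cdf (\<nu>n n) x \<le> cdf (\<nu>n n) p" using p by (intro \<nu>n.cdf_nondecreasing) auto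
        then show ?case using elim plateau_hat_cdf(3)[OF rd[of n] pq] by linarith
      qed
    next
      fix l assume l: "l < cdf \<nu> x"
      show "\<forall>\<^sub>F n in sequentially. l < cdf (\<nu>n n) x"
      proof (cases "l < 0")
        case True
        then have "l < cdf (\<nu>n n) x" for n using \<nu>n.cdf_nonneg[of n x] by linarith
        then show ?thesis by simp
      next
        case False
        have "(cdf \<nu> \<longlongrightarrow> cdf \<nu> x) (at_left x)"
          using cont by (simp add: isCont_def filterlim_at_split)
        then have "\<forall>\<^sub>F y in at_left x. l < cdf \<nu> y" using l by (rule order_tendstoD)
        then obtain y0 where y0: "y0 < x" "\<And>y. y0 < y \<Longrightarrow> y < x \<Longrightarrow> l < cdf \<nu> y"
          unfolding eventually_at_left_field by auto
        then obtain p where p: "p \<in> \<rat>" "p < x" "l < cdf \<nu> p"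
          using Rats_dense_in_real[of y0 x] by metis
        have "0 \<le> p" using on_unit_cdf(1)[OF \<nu>, of p] p False by fastforce
        obtain p' where p': "p' \<in> \<rat>" "p < p'" "p' < x" using Rats_dense_in_real[OF p(2)] by metis
        obtain q where q: "q \<in> \<rat>" "p' < q" "q < x" using Rats_dense_in_real[OF p'(3)] by metis
        have pq: "0 < p'" "p' < q" "q < 1" using p' q 3 \<open>0 \<le> p\<close> by auto
        have "l < cdf \<nu> p'" using p p' cdf_nondecreasing[of p p'] by linarith
        then have "l < (\<integral>u. plateau_hat (p' / (1 - p')) (q / (1 - q)) u \<partial>\<nu>) / (q / (1 - q) - p' / (1 - p'))"
          using plateau_hat_cdf(3)[OF real_distribution_axioms pq] by linarith
        from order_tendstoD(1)[OF conv'[OF pq p'(1) q(1)] this]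
        show ?thesis
        proof eventually_elim
          case (elim n)
          have "cdf (\<nu>n n) q \<le> cdf (\<nu>n n) x" using q by (intro \<nu>n.cdf_nondecreasing) auto
          then show ?case using elim plateau_hat_cdf(4)[OF rd[of n] pq] by linarith
        qed
      qed
    qed
  qed
qed

lemma weak_conv_integral:
  fixes f :: "real \<Rightarrow> real"
  assumes "\<And>n. on_unit (\<nu>n n)" "on_unit \<nu>" "weak_conv_m \<nu>n \<nu>"
    and "\<And>x. isCont f x" "\<And>x. \<bar>f x\<bar> \<le> B"
  shows "(\<lambda>n. \<integral>u. f u \<partial>\<nu>n n) \<longlonglongrightarrow> (\<integral>u. f u \<partial>\<nu>)"
  using assms by (intro weak_conv_imp_integral_bdd_continuous_conv[where B=B]) (auto simp: on_unit_def)

lemma on_unit_weak_limit: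
  assumes \<nu>n: "\<And>n. on_unit (\<nu>n n)" and \<nu>: "real_distribution \<nu>" and conv: "weak_conv_m \<nu>n \<nu>"
  shows "on_unit \<nu>"
proof -
  interpret real_distribution \<nu> by fact
  define \<psi> :: "real \<Rightarrow> real" where "\<psi> u = min 1 (max 0 (max (- u) (u - 1)))" for u
  have \<psi>c: "isCont \<psi> u" for u unfolding \<psi>_def by (intro continuous_intros)
  have \<psi>m[measurable]: "\<psi> \<in> borel_measurable borel" unfolding \<psi>_def by measurable
  have "(\<lambda>n. \<integral>u. \<psi> u \<partial>\<nu>n n) \<longlonglongrightarrow> (\<integral>u. \<psi> u \<partial>\<nu>)"
  proof (rule weak_conv_imp_integral_bdd_continuous_conv[where B=1])
    show "norm (\<psi> u) \<le> 1" for u by (simp add: \<psi>_def)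
  qed (use \<nu>n conv \<nu> \<psi>c in \<open>auto simp: on_unit_def\<close>)
  moreover have "(\<integral>u. \<psi> u \<partial>\<nu>n n) = 0" for n
  proof (rule integral_eq_zero_AE)
    have "AE u in \<nu>n n. 0 \<le> u \<and> u \<le> 1" using \<nu>n[of n] by (simp add: on_unit_def)
    then show "AE u in \<nu>n n. \<psi> u = 0" by eventually_elim (simp add: \<psi>_def)
  qed
  ultimately have "(\<integral>u. \<psi> u \<partial>\<nu>) = 0" by (simp add: LIMSEQ_const_iff)
  moreover have "integrable \<nu> \<psi>"
    by (intro integrable_const_bound[where B=1]) (auto simp: \<psi>_def)
  ultimately have "AE u in \<nu>. \<psi> u = 0"
    by (subst (asm) integral_nonneg_eq_0_iff_AE) (auto simp: \<psi>_def)
  then have "AE u in \<nu>. 0 \<le> u \<and> u \<le> 1"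
    by (elim eventually_mono) (auto simp: \<psi>_def min_def max_def split: if_splits)
  then show ?thesis using \<nu> by (simp add: on_unit_def)
qed

lemma plateau_convergent_imp_weak_limit:
  assumes \<nu>n: "\<And>n. on_unit (\<nu>n n)"
    and conv: "\<And>z1 z2. z1 \<in> \<rat> \<Longrightarrow> z2 \<in> \<rat> \<Longrightarrow> 0 < z1 \<Longrightarrow> z1 < z2 \<Longrightarrow>
      convergent (\<lambda>n. \<integral>u. plateau_hat z1 z2 u \<partial>\<nu>n n)"
  shows "\<exists>\<nu>. on_unit \<nu> \<and> weak_conv_m \<nu>n \<nu>"
proof -
  have rd: "real_distribution (\<nu>n n)" for n using \<nu>n by (simp add: on_unit_def)
  have "tight \<nu>n"
    unfolding tight_def
  proof (intro conjI allI impI)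
    fix e :: real assume e: "0 < e"
    have "measure (\<nu>n n) {-1<..1} = 1" for n
    proof -
      interpret real_distribution "\<nu>n n" by (rule rd)
      show ?thesis using \<nu>n[of n]
        by (intro prob_eq_1[THEN iffD2]) (auto simp: on_unit_def elim!: eventually_mono)
    qed
    then show "\<exists>a b. a < b \<and> (\<forall>n. 1 - e < measure (\<nu>n n) {a<..b})"
      using e by (intro exI[of _ "-1"] exI[of _ 1]) auto
  qed (rule rd)
  from tight_imp_convergent_subsubsequence[OF this strict_mono_id]
  obtain r \<nu> where r: "strict_mono (r :: nat \<Rightarrow> nat)" "real_distribution \<nu>" "weak_conv_m (\<nu>n \<circ> r) \<nu>"
    by auto
  have \<nu>: "on_unit \<nu>" using on_unit_weak_limit[OF _ r(2,3)] \<nu>n by auto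
  have "weak_conv_m \<nu>n \<nu>"
  proof (rule weak_conv_plateau[OF \<nu>n \<nu>])
    fix z1 z2 :: real assume z: "z1 \<in> \<rat>" "z2 \<in> \<rat>" "0 < z1" "z1 < z2"
    obtain L where L: "(\<lambda>n. \<integral>u. plateau_hat z1 z2 u \<partial>\<nu>n n) \<longlonglongrightarrow> L"
      using conv[OF z] by (auto simp: convergent_def)
    from LIMSEQ_subseq_LIMSEQ[OF this r(1)]
    have "(\<lambda>n. \<integral>u. plateau_hat z1 z2 u \<partial>(\<nu>n \<circ> r) n) \<longlonglongrightarrow> L" by (simp add: comp_def)
    moreover have "(\<lambda>n. \<integral>u. plateau_hat z1 z2 u \<partial>(\<nu>n \<circ> r) n) \<longlonglongrightarrow> (\<integral>u. plateau_hat z1 z2 u \<partial>\<nu>)"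
      using \<nu>n plateau_hat_bounds[OF z(4)] plateau_hat_isCont[OF z(3,4)]
      by (intro weak_conv_integral[OF _ \<nu> r(3), where B="z2 - z1"]) auto
    ultimately show "(\<lambda>n. \<integral>u. plateau_hat z1 z2 u \<partial>\<nu>n n) \<longlonglongrightarrow> (\<integral>u. plateau_hat z1 z2 u \<partial>\<nu>)"
      using L LIMSEQ_unique by metis
  qed
  then show ?thesis using \<nu> by blast
qed

lemma weak_conv_double_integral:
  fixes W :: "real \<times> real \<Rightarrow> real"
  assumes \<nu>n: "\<And>n. on_unit (\<nu>n n)" and \<nu>: "on_unit \<nu>" and conv: "weak_conv_m \<nu>n \<nu>"
    and W: "continuous_on UNIV W" and B: "\<And>p. \<bar>W p\<bar> \<le> B"
  shows "(\<lambda>n. \<integral>u. (\<integral>v. W (u, v) \<partial>\<nu>n n) \<partial>\<nu>n n) \<longlonglongrightarrow> (\<integral>u. (\<integral>v. W (u, v) \<partial>\<nu>) \<partial>\<nu>)"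
proof -
  have rd: "real_distribution (\<nu>n n)" for n using \<nu>n by (simp add: on_unit_def)
  have rd\<nu>: "real_distribution \<nu>" using \<nu> by (simp add: on_unit_def)
  from Skorohod[OF rd rd\<nu> conv] obtain \<Omega> :: "real measure" and Yn :: "nat \<Rightarrow> real \<Rightarrow> real" and Y :: "real \<Rightarrow> real"
    where \<Omega>: "prob_space \<Omega>" and Ynm: "\<And>n. Yn n \<in> measurable \<Omega> borel"
    and Yn: "\<And>n. distr \<Omega> borel (Yn n) = \<nu>n n" and Ym: "Y \<in> measurable \<Omega> lborel"
    and Y: "distr \<Omega> borel Y = \<nu>" and lim: "\<And>x. x \<in> space \<Omega> \<Longrightarrow> (\<lambda>n. Yn n x) \<longlonglongrightarrow> Y x"
    by blast
  note [measurable] = Ynm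
  have Ym'[measurable]: "Y \<in> measurable \<Omega> borel" using Ym by simp
  interpret \<Omega>: prob_space \<Omega> by fact
  have Wm[measurable]: "W \<in> borel_measurable (borel \<Otimes>\<^sub>M borel)"
    using W by (simp add: borel_prod borel_measurable_continuous_onI)
  have inner: "(\<integral>u. (\<integral>v. W (u, v) \<partial>distr \<Omega> borel Z) \<partial>distr \<Omega> borel Z)
     = (\<integral>x. (\<integral>y. W (Z x, Z y) \<partial>\<Omega>) \<partial>\<Omega>)" if [measurable]: "Z \<in> measurable \<Omega> borel" for Z
  proof -
    have "(\<integral>v. W (u, v) \<partial>distr \<Omega> borel Z) = (\<integral>y. W (u, Z y) \<partial>\<Omega>)" for u
      by (intro integral_distr) measurable
    then show ?thesis
      by (simp add: integral_distr \<Omega>.borel_measurable_lebesgue_integral)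
  qed
  have bnd: "\<bar>\<integral>y. W (z, Z y) \<partial>\<Omega>\<bar> \<le> B" if [measurable]: "Z \<in> measurable \<Omega> borel" for z Z
  proof -
    have "norm (\<integral>y. W (z, Z y) \<partial>\<Omega>) \<le> (\<integral>y. B \<partial>\<Omega>)"
    proof (rule Bochner_Integration.integral_norm_bound_integral)
      show "integrable \<Omega> (\<lambda>y. W (z, Z y))"
        using B by (intro \<Omega>.integrable_const_bound[where B=B]) auto
    qed (use B in auto)
    then show ?thesis by (simp add: \<Omega>.prob_space)
  qed
  have "(\<lambda>n. \<integral>x. (\<integral>y. W (Yn n x, Yn n y) \<partial>\<Omega>) \<partial>\<Omega>) \<longlonglongrightarrow> (\<integral>x. (\<integral>y. W (Y x, Y y) \<partial>\<Omega>) \<partial>\<Omega>)"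
  proof (rule integral_dominated_convergence[where w="\<lambda>_. B"])
    show "AE x in \<Omega>. (\<lambda>n. \<integral>y. W (Yn n x, Yn n y) \<partial>\<Omega>) \<longlonglongrightarrow> (\<integral>y. W (Y x, Y y) \<partial>\<Omega>)"
    proof (rule AE_I2, rule integral_dominated_convergence[where w="\<lambda>_. B"])
      fix x assume x: "x \<in> space \<Omega>"
      show "AE y in \<Omega>. (\<lambda>n. W (Yn n x, Yn n y)) \<longlonglongrightarrow> W (Y x, Y y)"
      proof (intro AE_I2)
        fix y assume y: "y \<in> space \<Omega>"
        have "isCont W (Y x, Y y)" using W by (simp add: continuous_on_eq_continuous_at)
        then show "(\<lambda>n. W (Yn n x, Yn n y)) \<longlonglongrightarrow> W (Y x, Y y)"
          by (rule isCont_tendsto_compose) (intro tendsto_Pair lim x y)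
      qed
    qed (use B in auto)
    show "(\<lambda>x. \<integral>y. W (Y x, Y y) \<partial>\<Omega>) \<in> borel_measurable \<Omega>"
      by (intro \<Omega>.borel_measurable_lebesgue_integral) measurable
    show "(\<lambda>x. \<integral>y. W (Yn n x, Yn n y) \<partial>\<Omega>) \<in> borel_measurable \<Omega>" for n
      by (intro \<Omega>.borel_measurable_lebesgue_integral) measurable
    show "AE x in \<Omega>. norm (\<integral>y. W (Yn n x, Yn n y) \<partial>\<Omega>) \<le> B" for n
      using bnd[OF Ynm] by simp
  qed simp
  then show ?thesis
    using inner[OF Ynm] inner[OF Ym'] by (simp only: Yn Y)
qed

section \<open>Compactness of the approximate solutions\<close>

lemma convergent_approx:
  fixes X :: "nat \<Rightarrow> real"
  assumes "\<And>e. 0 < e \<Longrightarrow> \<exists>Y. convergent Y \<and> (\<forall>\<^sub>F i in sequentially. \<bar>X i - Y i\<bar> < e)"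
  shows "convergent X"
proof -
  have "Cauchy X"
  proof (rule metric_CauchyI)
    fix e :: real assume e: "0 < e"
    obtain Y where Y: "convergent Y" "\<forall>\<^sub>F i in sequentially. \<bar>X i - Y i\<bar> < e / 3"
      using assms[of "e / 3"] e by auto
    from Y(2) obtain n1 where n1: "\<And>i. n1 \<le> i \<Longrightarrow> \<bar>X i - Y i\<bar> < e / 3"
      by (auto simp: eventually_sequentially)
    have "Cauchy Y" using Y(1) by (rule convergent_Cauchy)
    then obtain n2 where n2: "\<And>i j. n2 \<le> i \<Longrightarrow> n2 \<le> j \<Longrightarrow> dist (Y i) (Y j) < e / 3"
      using metric_CauchyD[of Y "e / 3"] e by (metis divide_pos_pos zero_less_numeral)
    show "\<exists>n. \<forall>i\<ge>n. \<forall>j\<ge>n. dist (X i) (X j) < e"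
    proof (intro exI[of _ "max n1 n2"] allI impI)
      fix i j assume "max n1 n2 \<le> i" "max n1 n2 \<le> j"
      then show "dist (X i) (X j) < e"
        using n1[of i] n1[of j] n2[of i j] unfolding dist_real_def by linarith
    qed
  qed
  then show ?thesis by (rule Cauchy_convergent)
qed

lemma small_modulus:
  fixes C e :: real
  assumes "0 < e"
  obtains d where "0 < d" "C * (sqrt d + d) < e"
proof -
  have "((\<lambda>d. C * (sqrt d + d)) \<longlongrightarrow> C * (sqrt 0 + 0)) (at_right 0)"
    by (intro tendsto_intros)
  then have "\<forall>\<^sub>F d in at_right 0. C * (sqrt d + d) < e"
    using assms by (intro order_tendstoD) auto
  moreover have "\<forall>\<^sub>F d in at_right (0::real). 0 < d" by (rule eventually_at_right_less)
  ultimately have "\<forall>\<^sub>F d in at_right 0. 0 < d \<and> C * (sqrt d + d) < e" by eventually_elim auto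
  then show ?thesis using that by (auto dest!: eventually_happens)
qed

context coagulation
begin

definition idx :: "nat \<Rightarrow> real \<Rightarrow> nat" where "idx n t = nat \<lfloor>t / h n\<rfloor>"

lemma idx_bounds:
  assumes "0 \<le> t"
  shows "h n * real (idx n t) \<le> t" "t < h n * real (idx n t) + h n"
proof -
  have "0 \<le> t / h n" using assms h_pos[of n] by simp
  then have "real (idx n t) = of_int \<lfloor>t / h n\<rfloor>" by (simp add: idx_def)
  then have "real (idx n t) \<le> t / h n" "t / h n < real (idx n t) + 1" by linarith+
  then show "h n * real (idx n t) \<le> t" "t < h n * real (idx n t) + h n"
    using h_pos[of n] by (auto simp: field_simps)
qed

lemma idx_le: "0 \<le> t \<Longrightarrow> t \<le> T \<Longrightarrow> idx n t \<le> N n"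
proof -
  assume t: "0 \<le> t" "t \<le> T"
  have "h n * real (idx n t) \<le> h n * real (N n)"
    using idx_bounds(1)[OF t(1), of n] t(2) h_N[of n] by (simp add: mult.commute)
  then show ?thesis using h_pos[of n] by simp
qed

lemma idx_mono: "s \<le> t \<Longrightarrow> idx n s \<le> idx n t"
  using h_pos[of n] unfolding idx_def by (intro nat_mono floor_mono divide_right_mono) auto

lemma idx_0[simp]: "idx n 0 = 0" by (simp add: idx_def)

lemma h_tendsto_0: "h \<longlonglongrightarrow> 0"
proof (rule real_tendsto_sandwich[OF _ _ tendsto_const lim_const_over_n])
  show "\<forall>\<^sub>F n in sequentially. h n \<le> T / real n"
    using eventually_gt_at_top[of 0]
    by eventually_elim (use N_ge N_pos T_pos in \<open>auto simp: h_def intro!: divide_left_mono\<close>)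
qed (use h_pos in \<open>auto intro: always_eventually less_imp_le\<close>)

text \<open>Index 0, which is not in the grid, carries the mass missing from the total \<open>M\<close>; it sits at \<open>u = 1\<close>.\<close>

definition site :: "real \<Rightarrow> real" where "site x = (if x = 0 then 1 else x / (1 + x))"

definition weight :: "nat \<Rightarrow> nat \<Rightarrow> real \<Rightarrow> real" where
  "weight n k x = (if x = 0 then 1 - sum (mass n k) (grid n) / M else mass n k x / M)"

definition law :: "nat \<Rightarrow> nat \<Rightarrow> real measure" where
  "law n k = distr (point_measure (insert 0 (grid n)) (\<lambda>x. ennreal (weight n k x))) borel site"

lemma zero_notin_grid: "0 \<notin> grid n" using grid_pos by blast

lemma sum_weight:
  "(\<Sum>x\<in>insert 0 (grid n). weight n k x * f x)
    = (1 - sum (mass n k) (grid n) / M) * f 0 + E n k f / M"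
proof -
  have "(\<Sum>x\<in>grid n. weight n k x * f x) = (\<Sum>x\<in>grid n. mass n k x * f x / M)"
    using zero_notin_grid[of n] by (intro sum.cong) (auto simp: weight_def)
  then show ?thesis
    using zero_notin_grid[of n] by (simp add: weight_def E_def sum_divide_distrib)
qed

lemma weight_nonneg:
  assumes "1 \<le> n" "k \<le> N n" "x \<in> insert 0 (grid n)"
  shows "0 \<le> weight n k x"
  using assms mass_nonneg[OF assms(1,2)] total_mass_le[OF assms(1,2)] M_pos
  by (auto simp: weight_def)

lemma law_integral:
  assumes n: "1 \<le> n" "k \<le> N n" and f: "f \<in> borel_measurable borel"
  shows "(\<integral>u. f u \<partial>law n k)
    = (1 - sum (mass n k) (grid n) / M) * f 1 + E n k (\<lambda>x. f (x / (1 + x))) / M"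
proof -
  have "(\<integral>u. f u \<partial>law n k) = (\<integral>x. f (site x) \<partial>point_measure (insert 0 (grid n)) (weight n k))"
    unfolding law_def using f by (intro integral_distr) auto
  also have "\<dots> = (\<Sum>x\<in>insert 0 (grid n). weight n k x *\<^sub>R f (site x))"
    using weight_nonneg[OF n] by (intro lebesgue_integral_point_measure_finite) auto
  also have "\<dots> = (1 - sum (mass n k) (grid n) / M) * f (site 0) + E n k (\<lambda>x. f (site x)) / M"
    using sum_weight[of n k "\<lambda>x. f (site x)"] by simp
  also have "E n k (\<lambda>x. f (site x)) = E n k (\<lambda>x. f (x / (1 + x)))"
    unfolding E_def using zero_notin_grid[of n] by (intro sum.cong) (auto simp: site_def)
  finally show ?thesis by (simp add: site_def)
qed

lemma law_on_unit:
  assumes n: "1 \<le> n" "k \<le> N n"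
  shows "on_unit (law n k)"
proof -
  let ?P = "point_measure (insert 0 (grid n)) (\<lambda>x. ennreal (weight n k x))"
  have "emeasure ?P (space ?P) = (\<Sum>x\<in>insert 0 (grid n). ennreal (weight n k x))"
    by (simp only: space_point_measure) (intro emeasure_point_measure_finite; simp)
  also have "\<dots> = ennreal (\<Sum>x\<in>insert 0 (grid n). weight n k x)"
    using weight_nonneg[OF n] by (intro sum_ennreal) auto
  also have "(\<Sum>x\<in>insert 0 (grid n). weight n k x) = 1"
    using sum_weight[of n k "\<lambda>_. 1"] by (simp add: E_def)
  finally interpret P: prob_space ?P by (intro prob_spaceI) simp
  have m: "site \<in> measurable ?P borel" by simp
  interpret L: prob_space "law n k"
    unfolding law_def by (rule P.prob_space_distr[OF m])
  have "real_distribution (law n k)"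
    by unfold_locales (auto simp: law_def)
  moreover have "AE u in law n k. 0 \<le> u \<and> u \<le> 1"
    unfolding law_def
    by (subst AE_distr_iff[OF m]) (force intro!: AE_I2 simp: space_point_measure site_def divide_simps dest: grid_pos)+
  ultimately show ?thesis by (simp add: on_unit_def)
qed

lemma law_plateau:
  assumes n: "1 \<le> n" "k \<le> N n" and z: "0 < z1" "z1 < z2"
  shows "M * (\<integral>u. plateau_hat z1 z2 u \<partial>law n k) = E n k (plateau z1 z2)"
proof -
  have eq: "plateau_hat z1 z2 (x / (1 + x)) = plateau z1 z2 x" if "x \<in> grid n" for x
  proof -
    have x: "0 < x" using that by (rule grid_pos)
    then have "x / (1 + x) < 1" "x / (1 + x) / (1 - x / (1 + x)) = x" by (auto simp: field_simps)
    then show ?thesis unfolding plateau_hat_def by simp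
  qed
  have "E n k (\<lambda>x. plateau_hat z1 z2 (x / (1 + x))) = E n k (plateau z1 z2)"
    unfolding E_def using eq by (intro sum.cong) auto
  then show ?thesis
    using law_integral[OF n plateau_hat_measurable[OF z]] M_pos
    by (simp add: plateau_hat_def)
qed

lemma law_double:
  assumes n: "1 \<le> n" "k \<le> N n" and W: "W \<in> borel_measurable (borel \<Otimes>\<^sub>M borel)"
    and W1: "\<And>u. W (u, 1) = 0" "\<And>u. W (1, u) = (0::real)"
  shows "M\<^sup>2 * (\<integral>u. (\<integral>v. W (u, v) \<partial>law n k) \<partial>law n k)
    = Q n k (\<lambda>x y. W (x / (1 + x), y / (1 + y)))"
proof -
  note [measurable] = W
  interpret L: real_distribution "law n k" using law_on_unit[OF n] by (simp add: on_unit_def)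
  have "(\<integral>v. W (u, v) \<partial>law n k) = E n k (\<lambda>y. W (u, y / (1 + y))) / M" for u
    using law_integral[OF n, of "\<lambda>v. W (u, v)"] W1 by simp
  moreover have "(\<lambda>u. \<integral>v. W (u, v) \<partial>law n k) \<in> borel_measurable borel"
    by (intro L.borel_measurable_lebesgue_integral) simp
  ultimately have "(\<integral>u. (\<integral>v. W (u, v) \<partial>law n k) \<partial>law n k)
      = E n k (\<lambda>x. E n k (\<lambda>y. W (x / (1 + x), y / (1 + y))) / M) / M"
    using law_integral[OF n, of "\<lambda>u. \<integral>v. W (u, v) \<partial>law n k"] W1 by (simp add: E_def)
  also have "\<dots> = Q n k (\<lambda>x y. W (x / (1 + x), y / (1 + y))) / M\<^sup>2"
    by (simp add: E_def Q_def power2_eq_square sum_divide_distrib sum_distrib_left mult_ac)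
  finally show ?thesis using M_pos by simp
qed

lemma plateau_measurable[measurable]: "plateau z1 z2 \<in> borel_measurable borel"
  unfolding plateau_def by measurable

lemma measurable_m0: "f \<in> borel_measurable borel \<Longrightarrow> f \<in> borel_measurable m0"
  using measurable_restrict_space1[of f borel borel "{0<..}"] measurable_cong_sets[OF sets_m0 refl] by blast

lemma initial_error:
  assumes n: "1 \<le> n" "z2 \<le> real n" and z: "0 < z1" "z1 < z2"
  shows "\<bar>E n 0 (plateau z1 z2) - (\<integral>u. plateau z1 z2 u \<partial>m0)\<bar> \<le> M0 / real n"
proof -
  interpret m0: finite_measure m0 by (rule finite_m0)
  define A where "A x = {x - 1 / real n<..x}" for x
  have A: "A x \<in> sets m0" if "x \<in> grid n" for x
  proof -
    have "A x \<subseteq> {0<..}" using grid_ge[OF that] by (auto simp: A_def)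
    then show ?thesis unfolding sets_m0 by (auto simp: sets_restrict_space_iff A_def)
  qed
  have uniq: "x = y" if "x \<in> grid n" "y \<in> grid n" "u \<in> A x" "u \<in> A y" for x y u
  proof -
    obtain i j where ij: "x = real i / real n" "y = real j / real n"
      using \<open>x \<in> grid n\<close> \<open>y \<in> grid n\<close> by (auto simp: grid_def)
    have "\<bar>x - y\<bar> < 1 / real n" using that(3,4) by (auto simp: A_def)
    then have "\<bar>real i - real j\<bar> < 1" using n unfolding ij by (simp add: diff_divide_distrib[symmetric] divide_simps split: if_splits)
    then have "i = j" by linarith
    then show ?thesis by (simp add: ij)
  qed
  have ex: "\<exists>x\<in>grid n. u \<in> A x" if u: "0 < u" "u \<le> real n" for u
  proof -
    define j where "j = nat \<lceil>u * real n\<rceil>"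
    have un: "0 < u * real n" using u n by simp
    have j: "real j - 1 < u * real n" "u * real n \<le> real j" unfolding j_def using un by linarith+
    have "1 \<le> j" using j un by linarith
    have "u * real n \<le> real (n\<^sup>2)" using u n by (simp add: power2_eq_square)
    then have "real j < real (n\<^sup>2) + 1" using j by linarith
    then have "j \<le> n\<^sup>2" by linarith
    have "u \<in> A (real j / real n)" using j n by (simp add: A_def field_simps)
    then show ?thesis using \<open>1 \<le> j\<close> \<open>j \<le> n\<^sup>2\<close> unfolding grid_def by auto
  qed
  define F where "F u = (\<Sum>x\<in>grid n. plateau z1 z2 x * indicator (A x) u)" for u
  have intA: "integrable m0 (\<lambda>u. plateau z1 z2 x * indicator (A x) u)" if "x \<in> grid n" for x
    using A[OF that] m0.emeasure_finite[of "A x"]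
    by (intro integrable_mult_right integrable_real_indicator) (auto simp: less_top[symmetric])
  have intF: "integrable m0 F" unfolding F_def using intA by (intro Bochner_Integration.integrable_sum)
  have int: "integrable m0 (plateau z1 z2)"
    using z by (intro m0.integrable_const_bound[where B="z2 - z1"]) (auto simp: plateau_def intro: measurable_m0)
  have "E n 0 (plateau z1 z2) = (\<Sum>x\<in>grid n. \<integral>u. plateau z1 z2 x * indicator (A x) u \<partial>m0)"
    unfolding E_def using A by (intro sum.cong) (auto simp: A_def mult.commute)
  also have "\<dots> = (\<integral>u. F u \<partial>m0)" unfolding F_def by (rule Bochner_Integration.integral_sum[OF intA, symmetric])
  finally have "E n 0 (plateau z1 z2) - (\<integral>u. plateau z1 z2 u \<partial>m0) = (\<integral>u. F u - plateau z1 z2 u \<partial>m0)"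
    using intF int by simp
  moreover have "\<bar>\<integral>u. F u - plateau z1 z2 u \<partial>m0\<bar> \<le> (\<integral>u. 1 / real n \<partial>m0)"
  proof (rule integral_abs_bound_integral)
    fix u assume "u \<in> space m0"
    then have u: "0 < u" by (simp add: space_m0)
    show "\<bar>F u - plateau z1 z2 u\<bar> \<le> 1 / real n"
    proof (cases "u \<le> real n")
      case True
      then obtain x where x: "x \<in> grid n" "u \<in> A x" using ex u by blast
      have "F u = (\<Sum>y\<in>grid n. if y = x then plateau z1 z2 x else 0)"
        unfolding F_def using x uniq by (intro sum.cong) (auto split: split_indicator)
      then have "F u = plateau z1 z2 x" using x by simp
      moreover have "\<bar>x - u\<bar> \<le> 1 / real n" using x by (auto simp: A_def)
      ultimately show ?thesis by (auto simp: plateau_def min_def max_def)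
    next
      case False
      then have "F u = 0" unfolding F_def using grid_le by (intro sum.neutral) (force simp: A_def split: split_indicator)
      moreover have "plateau z1 z2 u = 0" using False n z by (simp add: plateau_def)
      ultimately show ?thesis by simp
    qed
  qed (use intF int in auto)
  ultimately show ?thesis by (simp add: M0_def)
qed

lemma initial_limit:
  assumes z: "0 < z1" "z1 < z2"
  shows "(\<lambda>n. E n 0 (plateau z1 z2)) \<longlonglongrightarrow> (\<integral>u. plateau z1 z2 u \<partial>m0)"
proof (rule Lim_transform2[OF tendsto_const])
  have "\<forall>\<^sub>F n in sequentially. norm ((\<integral>u. plateau z1 z2 u \<partial>m0) - E n 0 (plateau z1 z2)) \<le> M0 / real n"
    using eventually_ge_at_top[of "max 1 (nat \<lceil>z2\<rceil>)"]
  proof eventually_elim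
    case (elim n)
    then have "1 \<le> n" "z2 \<le> real n" by linarith+
    then show ?case using initial_error[OF _ _ z, of n] by (simp add: abs_minus_commute)
  qed
  then show "(\<lambda>n. (\<integral>u. plateau z1 z2 u \<partial>m0) - E n 0 (plateau z1 z2)) \<longlonglongrightarrow> 0"
    by (rule Lim_null_comparison[OF _ lim_const_over_n])
qed

lemma E_plateau_bounds:
  assumes "1 \<le> n" "k \<le> N n" "z1 < z2"
  shows "0 \<le> E n k (plateau z1 z2)" "E n k (plateau z1 z2) \<le> M * (z2 - z1)"
proof -
  show "0 \<le> E n k (plateau z1 z2)" using assms plateau_nonneg by (intro E_nonneg) auto
  have "E n k (plateau z1 z2) \<le> E n k (\<lambda>_. (z2 - z1) * 1)"
    using assms plateau_le by (intro E_mono) auto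
  also have "\<dots> \<le> (z2 - z1) * M"
    unfolding E_cmult using assms E_one_le by (intro mult_left_mono) auto
  finally show "E n k (plateau z1 z2) \<le> M * (z2 - z1)" by (simp add: mult.commute)
qed

lemma time_increment:
  assumes z: "0 < z1" "z1 < z2"
  obtains C where "0 \<le> C" and "\<And>n t t' d. 1 \<le> n \<Longrightarrow> z2 < real n \<Longrightarrow> 0 \<le> t \<Longrightarrow> t \<le> T \<Longrightarrow> 0 \<le> t' \<Longrightarrow> t' \<le> T \<Longrightarrow>
     \<bar>t - t'\<bar> + h n \<le> d \<Longrightarrow>
     \<bar>E n (idx n t) (plateau z1 z2) - E n (idx n t') (plateau z1 z2)\<bar> \<le> C * (sqrt d + d)"
proof -
  obtain C where C: "0 \<le> C" "\<And>n k1 k2. 1 \<le> n \<Longrightarrow> z2 < real n \<Longrightarrow> k1 \<le> k2 \<Longrightarrow> k2 \<le> N n \<Longrightarrow>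
    \<bar>E n k2 (plateau z1 z2) - E n k1 (plateau z1 z2)\<bar>
      \<le> C * (sqrt (h n * real (k2 - k1)) + h n * real (k2 - k1))"
    by (rule equicontinuity[OF z], rule that)
  have le: "\<bar>E n (idx n t) (plateau z1 z2) - E n (idx n t') (plateau z1 z2)\<bar> \<le> C * (sqrt d + d)"
    if n: "1 \<le> n" "z2 < real n" and t: "0 \<le> t'" "t' \<le> t" "t \<le> T" and d: "t - t' + h n \<le> d" for n t t' d
  proof -
    have k: "idx n t' \<le> idx n t" "idx n t \<le> N n" using t by (auto intro: idx_mono idx_le)
    have "h n * real (idx n t - idx n t') = h n * real (idx n t) - h n * real (idx n t')"
      using k by (simp add: of_nat_diff algebra_simps)
    also have "\<dots> \<le> d" using idx_bounds[of t n] idx_bounds[of t' n] t d by linarith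
    finally have hd: "h n * real (idx n t - idx n t') \<le> d" .
    show ?thesis using C(2)[OF n k] C(1) hd
      by (elim order_trans) (intro mult_left_mono add_mono, auto)
  qed
  show ?thesis
  proof (rule that[OF C(1)])
    fix n t t' d assume A: "1 \<le> n" "z2 < real n" "0 \<le> t" "t \<le> T" "0 \<le> t'" "t' \<le> T" "\<bar>t - t'\<bar> + h n \<le> d"
    show "\<bar>E n (idx n t) (plateau z1 z2) - E n (idx n t') (plateau z1 z2)\<bar> \<le> C * (sqrt d + d)"
    proof (cases "t' \<le> t")
      case True
      then show ?thesis using A by (intro le) auto
    next
      case False
      then show ?thesis using A le[of n t t' d] by (simp add: abs_minus_commute)
    qed
  qed
qed

lemma limit_laws:
  obtains s \<mu> where "strict_mono s" "\<And>i. 1 \<le> s i" "\<And>t. on_unit (\<mu> t)"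
    "\<And>t. 0 \<le> t \<Longrightarrow> t \<le> T \<Longrightarrow> weak_conv_m (\<lambda>i. law (s i) (idx (s i) t)) (\<mu> t)"
    "\<And>t. \<mu> t = \<mu> (max 0 (min T t))"
proof -
  define f where "f n p = (case p of (t, z1, z2) \<Rightarrow> E n (idx n t) (plateau z1 z2) / (z2 - z1))"
    for n and p :: "real \<times> real \<times> real"
  define R :: "(real \<times> real \<times> real) set" where "R = {(t, z1, z2). t \<in> \<rat> \<and> 0 \<le> t \<and> t \<le> T \<and> z1 \<in> \<rat> \<and> z2 \<in> \<rat> \<and> 0 < z1 \<and> z1 < z2}"
  have "R \<subseteq> \<rat> \<times> \<rat> \<times> \<rat>" by (auto simp: R_def)
  then have R: "countable R" by (rule countable_subset) (intro countable_SIGMA countable_rat)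
  have bnd: "norm (f n p) \<le> M" if "p \<in> R" for n p
  proof (cases "n = 0")
    case True
    then show ?thesis using M_pos by (simp add: f_def E_def grid_def split: prod.split)
  next
    case False
    obtain t z1 z2 where p: "p = (t, z1, z2)" by (cases p)
    have "0 \<le> E n (idx n t) (plateau z1 z2)" "E n (idx n t) (plateau z1 z2) \<le> M * (z2 - z1)"
      using that False by (auto simp: p R_def intro!: E_plateau_bounds idx_le)
    then show ?thesis using that by (simp add: p f_def R_def pos_divide_le_eq)
  qed
  obtain s0 where s0: "strict_mono (s0 :: nat \<Rightarrow> nat)" "\<And>p. p \<in> R \<Longrightarrow> \<exists>l. (\<lambda>n. f (s0 n) p) \<longlonglongrightarrow> l"
    by (rule function_convergent_subsequence[OF R, of f M], erule bnd, rule that)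
  define s where "s i = s0 (Suc i)" for i
  have s: "strict_mono s" using s0(1) by (simp add: s_def strict_mono_def)
  have s1: "1 \<le> s i" for i using strict_mono_imp_increasing[OF s0(1), of "Suc i"] by (simp add: s_def)
  have si: "i \<le> s i" for i using strict_mono_imp_increasing[OF s] .
  have conv_rat: "convergent (\<lambda>i. E (s i) (idx (s i) t) (plateau z1 z2))" if p: "(t, z1, z2) \<in> R" for t z1 z2
  proof -
    obtain l where "(\<lambda>n. f (s0 n) (t, z1, z2)) \<longlonglongrightarrow> l" using s0(2)[OF p] by blast
    then have "(\<lambda>i. f (s i) (t, z1, z2)) \<longlonglongrightarrow> l" unfolding s_def by (rule LIMSEQ_Suc)
    then have "(\<lambda>i. (z2 - z1) * f (s i) (t, z1, z2)) \<longlonglongrightarrow> (z2 - z1) * l" by (intro tendsto_intros)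
    moreover have "(\<lambda>i. (z2 - z1) * f (s i) (t, z1, z2)) = (\<lambda>i. E (s i) (idx (s i) t) (plateau z1 z2))"
      using p by (auto simp: f_def R_def)
    ultimately show ?thesis by (auto simp: convergent_def)
  qed
  have conv: "convergent (\<lambda>i. E (s i) (idx (s i) t) (plateau z1 z2))"
    if t: "0 \<le> t" "t \<le> T" and z: "z1 \<in> \<rat>" "z2 \<in> \<rat>" "0 < z1" "z1 < z2" for t z1 z2
  proof (rule convergent_approx)
    fix e :: real assume e: "0 < e"
    obtain C where C: "0 \<le> C" "\<And>n t t' d. 1 \<le> n \<Longrightarrow> z2 < real n \<Longrightarrow> 0 \<le> t \<Longrightarrow> t \<le> T \<Longrightarrow> 0 \<le> t' \<Longrightarrow> t' \<le> T \<Longrightarrow>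
     \<bar>t - t'\<bar> + h n \<le> d \<Longrightarrow>
     \<bar>E n (idx n t) (plateau z1 z2) - E n (idx n t') (plateau z1 z2)\<bar> \<le> C * (sqrt d + d)"
      by (rule time_increment[OF z(3,4)], rule that)
    obtain d where d: "0 < d" "C * (sqrt d + d) < e" by (rule small_modulus[OF e])
    obtain t' where t': "t' \<in> \<rat>" "0 \<le> t'" "t' \<le> T" "\<bar>t - t'\<bar> < d / 2"
    proof -
      have "max 0 (t - d / 2) < min T (t + d / 2)" using t d T_pos by auto
      then obtain r where r: "r \<in> \<rat>" "max 0 (t - d / 2) < r" "r < min T (t + d / 2)"
        using Rats_dense_in_real by blast
      then have "0 \<le> r" "r \<le> T" "t - r < d / 2" "r - t < d / 2" by auto
      moreover from this have "\<bar>t - r\<bar> < d / 2" by linarith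
      ultimately show ?thesis using r(1) by (intro that[of r])
    qed
    have "convergent (\<lambda>i. E (s i) (idx (s i) t') (plateau z1 z2))"
      using t' z by (intro conv_rat) (auto simp: R_def)
    moreover have "\<forall>\<^sub>F i in sequentially. \<bar>E (s i) (idx (s i) t) (plateau z1 z2) - E (s i) (idx (s i) t') (plateau z1 z2)\<bar> < e"
    proof -
      have "(\<lambda>i. h (s i)) \<longlonglongrightarrow> 0" using LIMSEQ_subseq_LIMSEQ[OF h_tendsto_0 s] by (simp add: comp_def)
      then have "\<forall>\<^sub>F i in sequentially. h (s i) < d / 2" using d by (intro order_tendstoD) auto
      moreover have "\<forall>\<^sub>F i in sequentially. nat \<lceil>z2\<rceil> < i" by (rule eventually_gt_at_top)
      ultimately show ?thesis
      proof eventually_elim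
        case (elim i)
        then have "z2 < real (s i)" using si[of i] by linarith
        then have "\<bar>E (s i) (idx (s i) t) (plateau z1 z2) - E (s i) (idx (s i) t') (plateau z1 z2)\<bar> \<le> C * (sqrt d + d)"
          using elim t t' s1 by (intro C(2)) auto
        then show ?case using d by linarith
      qed
    qed
    ultimately show "\<exists>Y. convergent Y \<and> (\<forall>\<^sub>F i in sequentially. \<bar>E (s i) (idx (s i) t) (plateau z1 z2) - Y i\<bar> < e)"
      by blast
  qed
  have "\<exists>\<nu>. on_unit \<nu> \<and> weak_conv_m (\<lambda>i. law (s i) (idx (s i) t)) \<nu>" if t: "0 \<le> t" "t \<le> T" for t
  proof (rule plateau_convergent_imp_weak_limit)
    show "on_unit (law (s i) (idx (s i) t))" for i using s1 t by (intro law_on_unit idx_le)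
    fix z1 z2 :: real assume z: "z1 \<in> \<rat>" "z2 \<in> \<rat>" "0 < z1" "z1 < z2"
    have "(\<integral>u. plateau_hat z1 z2 u \<partial>law (s i) (idx (s i) t)) = inverse M * E (s i) (idx (s i) t) (plateau z1 z2)" for i
      using law_plateau[OF s1 idx_le[OF t] z(3,4), of i] M_pos by (simp add: field_simps)
    moreover obtain l where "(\<lambda>i. E (s i) (idx (s i) t) (plateau z1 z2)) \<longlonglongrightarrow> l"
      using conv[OF t z] by (auto simp: convergent_def)
    ultimately show "convergent (\<lambda>i. \<integral>u. plateau_hat z1 z2 u \<partial>law (s i) (idx (s i) t))"
      by (auto simp: convergent_def intro!: tendsto_intros)
  qed
  then obtain \<mu> where \<mu>: "\<And>t. 0 \<le> t \<Longrightarrow> t \<le> T \<Longrightarrow> on_unit (\<mu> t) \<and> weak_conv_m (\<lambda>i. law (s i) (idx (s i) t)) (\<mu> t)"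
    by metis
  show ?thesis
  proof (rule that[OF s s1, of "\<lambda>t. \<mu> (max 0 (min T t))"])
    show "on_unit (\<mu> (max 0 (min T t)))" for t using \<mu>[of "max 0 (min T t)"] T_pos by auto
    show "weak_conv_m (\<lambda>i. law (s i) (idx (s i) t)) (\<mu> (max 0 (min T t)))" if "0 \<le> t" "t \<le> T" for t
    proof -
      have "max 0 (min T t) = t" using that by auto
      then show ?thesis using \<mu>[OF that] by (simp only:)
    qed
  qed (auto simp: T_pos less_imp_le)
qed

end

section \<open>Passage to the limit\<close>

lemma cts_step_bound: "a < b \<Longrightarrow> \<bar>cts_step a b x\<bar> \<le> 1"
  by (auto simp: cts_step_def divide_simps)

lemma (in finite_borel_measure) cdf_right_sequence:
  assumes "X \<longlonglongrightarrow> x" "\<And>k. x < X k"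
  shows "(\<lambda>k. cdf M (X k)) \<longlonglongrightarrow> cdf M x"
proof -
  have "filterlim X (at_right x) sequentially"
    using assms by (intro filterlim_at_withinI) auto
  then show ?thesis
    using cdf_is_right_cont[of x] unfolding continuous_within by (rule filterlim_compose[rotated])
qed

lemma LIMSEQ_add_inverse_Suc: "(\<lambda>k. x + 1 / real (Suc k)) \<longlonglongrightarrow> x"
  using tendsto_add[OF tendsto_const LIMSEQ_Suc[OF lim_const_over_n], of x 1] by simp

context coagulation
begin

lemma idx_measurable[measurable]: "idx n \<in> measurable borel (count_space UNIV)"
  unfolding idx_def by measurable

lemma idx_eq: "h n * real j \<le> \<tau> \<Longrightarrow> \<tau> < h n * real (Suc j) \<Longrightarrow> idx n \<tau> = j"
proof -
  assume A: "h n * real j \<le> \<tau>" "\<tau> < h n * real (Suc j)"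
  then have "real j \<le> \<tau> / h n" "\<tau> / h n < real j + 1"
    using h_pos[of n] by (auto simp: field_simps)
  then have "\<lfloor>\<tau> / h n\<rfloor> = int j" by linarith
  then show ?thesis by (simp add: idx_def)
qed

lemma step_sum_integral:
  "has_bochner_integral lborel (\<lambda>\<tau>. indicator {0..<h n * real k} \<tau> * \<alpha> (idx n \<tau>)) (\<Sum>j\<in>{..<k}. h n * \<alpha> j)"
proof (induction k)
  case 0
  then show ?case by (simp add: has_bochner_integral_zero)
next
  case (Suc k)
  have le: "h n * real k \<le> h n * real (Suc k)" using h_pos[of n] by simp
  have "has_bochner_integral lborel (\<lambda>\<tau>. \<alpha> k * indicator {h n * real k..<h n * real (Suc k)} \<tau>) (\<alpha> k * (h n * real (Suc k) - h n * real k))"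
    using le by (intro has_bochner_integral_mult_right)
      (use has_bochner_integral_real_indicator[of "{h n * real k..<h n * real (Suc k)}" lborel] in \<open>simp add: less_top[symmetric]\<close>)
  from has_bochner_integral_add[OF Suc.IH this]
  have "has_bochner_integral lborel (\<lambda>\<tau>. indicator {0..<h n * real k} \<tau> * \<alpha> (idx n \<tau>)
     + \<alpha> k * indicator {h n * real k..<h n * real (Suc k)} \<tau>) (\<Sum>j\<in>{..<Suc k}. h n * \<alpha> j)"
    by (simp add: algebra_simps)
  moreover have "indicator {0..<h n * real k} \<tau> * \<alpha> (idx n \<tau>)
     + \<alpha> k * indicator {h n * real k..<h n * real (Suc k)} \<tau> = indicator {0..<h n * real (Suc k)} \<tau> * \<alpha> (idx n \<tau>)" for \<tau>
  proof -
    have "0 \<le> h n * real k" using h_pos[of n] by simp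
    then show ?thesis using le idx_eq[of n k \<tau>] by (auto split: split_indicator)
  qed
  ultimately show ?case by simp
qed

lemma Q_bound:
  assumes "1 \<le> n" "k \<le> N n" "\<And>x y. x \<in> grid n \<Longrightarrow> y \<in> grid n \<Longrightarrow> \<bar>\<psi> x y\<bar> \<le> B" "0 \<le> B"
  shows "\<bar>Q n k \<psi>\<bar> \<le> B * M\<^sup>2"
proof -
  have "E n k (\<lambda>_. 1) * E n k (\<lambda>_. 1) \<le> M * M"
    using E_one_le[OF assms(1,2)] E_nonneg[OF assms(1,2), of "\<lambda>_. 1"] M_pos by (intro mult_mono) auto
  then have one: "B * (E n k (\<lambda>_. 1) * E n k (\<lambda>_. 1)) \<le> B * M\<^sup>2"
    using assms(4) by (simp add: power2_eq_square mult_left_mono)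
  have c: "Q n k (\<lambda>x y. c) = c * (E n k (\<lambda>_. 1) * E n k (\<lambda>_. 1))" for c
    using Q_prod[of n k "\<lambda>_. c" "\<lambda>_. 1"] E_cmult[of n k c "\<lambda>_. 1"] by simp
  have "Q n k \<psi> \<le> Q n k (\<lambda>x y. B)"
    using assms by (intro Q_mono) (auto simp: abs_le_iff)
  moreover have "Q n k (\<lambda>x y. - B) \<le> Q n k \<psi>"
    using assms(3) by (intro Q_mono assms(1,2)) (fastforce simp: abs_le_iff)
  ultimately show ?thesis using one c[of B] c[of "- B"] by (simp add: abs_le_iff)
qed

definition jump_cut_hat :: "real \<Rightarrow> real \<Rightarrow> nat \<Rightarrow> real \<times> real \<Rightarrow> real" where
  "jump_cut_hat z1 z2 i p = (if 0 < fst p \<and> fst p < 1 \<and> 0 < snd p \<and> snd p < 1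
     then jump_cut z1 z2 i (fst p / (1 - fst p)) (snd p / (1 - snd p)) else 0)"

definition jump_hat :: "real \<Rightarrow> real \<Rightarrow> real \<times> real \<Rightarrow> real" where
  "jump_hat z1 z2 p = (if 0 < fst p \<and> fst p < 1 \<and> 0 < snd p \<and> snd p < 1
     then jump z1 z2 (fst p / (1 - fst p)) (snd p / (1 - snd p)) else 0)"

lemma jump_cut_hat_continuous: "continuous_on UNIV (jump_cut_hat z1 z2 i)"
proof (cases "i = 0")
  case True
  then have "jump_cut_hat z1 z2 i = (\<lambda>_. 0)"
    by (auto simp: jump_cut_hat_def jump_cut_def cut_def fun_eq_iff)
  then show ?thesis by simp
next
  case False
  define p where "p = 1 / (1 + real i)"
  define q where "q = 2 * real i / (1 + 2 * real i)"
  have pq: "0 < p" "q < 1" using False by (auto simp: p_def q_def)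
  define U :: "(real \<times> real) set" where "U = {0<..<1} \<times> {0<..<1}"
  define V :: "(real \<times> real) set" where "V = - ({p..q} \<times> {p..q})"
  have "continuous_on U (\<lambda>u. jump_cut z1 z2 i (fst u / (1 - fst u)) (snd u / (1 - snd u)))"
  proof -
    have "continuous_on U (\<lambda>u. (\<lambda>(x, y). K x y) (fst u / (1 - fst u), snd u / (1 - snd u)))"
      by (rule continuous_on_compose2[OF K_cont]) (auto simp: U_def intro!: continuous_intros)
    then have "continuous_on U (\<lambda>u. K (fst u / (1 - fst u)) (snd u / (1 - snd u)))" by simp
    then show ?thesis unfolding jump_cut_def jump_def plateau_def cut_def
      using False by (intro continuous_intros) (auto simp: U_def)
  qed
  then have "continuous_on U (jump_cut_hat z1 z2 i)"
    by (rule continuous_on_eq) (auto simp: U_def jump_cut_hat_def)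
  moreover have zero: "jump_cut_hat z1 z2 i u = 0" if "u \<in> V" for u
  proof (cases "u \<in> U")
    case True
    have aux: "cut i (w / (1 - w)) = 0" if "0 < w" "w < 1" "\<not> (p \<le> w \<and> w \<le> q)" for w
    proof (rule cut_eq_0)
      show "w / (1 - w) \<le> 1 / real i \<or> 2 * real i \<le> w / (1 - w)"
        using that False by (simp add: p_def q_def field_simps) linarith
    qed (use False in simp)
    from True obtain v w where u: "u = (v, w)" "0 < v" "v < 1" "0 < w" "w < 1" by (auto simp: U_def)
    then have "\<not> (p \<le> v \<and> v \<le> q) \<or> \<not> (p \<le> w \<and> w \<le> q)" using that by (auto simp: V_def)
    then show ?thesis using aux[of v] aux[of w] u by (auto simp: jump_cut_hat_def jump_cut_def)
  qed (cases u, auto simp: U_def jump_cut_hat_def)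
  have "continuous_on V (jump_cut_hat z1 z2 i)"
    by (rule continuous_on_eq[where f="\<lambda>_. 0"]) (use zero in auto)
  moreover have "open U" "open V" unfolding U_def V_def by (auto intro!: open_Times closed_Times simp: open_Compl)
  ultimately have "continuous_on (U \<union> V) (jump_cut_hat z1 z2 i)" by (intro continuous_on_open_Un)
  moreover have "U \<union> V = UNIV" using pq by (auto simp: U_def V_def)
  ultimately show ?thesis by simp
qed

lemma jump_cut_hat_bounded:
  obtains B where "0 \<le> B" "\<And>p. \<bar>jump_cut_hat z1 z2 i p\<bar> \<le> B"
proof -
  have "compact (jump_cut_hat z1 z2 i ` ({0..1} \<times> {0..1}))"
    by (intro compact_continuous_image compact_Times continuous_on_subset[OF jump_cut_hat_continuous]) auto
  then have "bounded (jump_cut_hat z1 z2 i ` ({0..1} \<times> {0..1}))" by (rule compact_imp_bounded)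
  then obtain B where B: "\<And>p. p \<in> {0..1} \<times> {0..1} \<Longrightarrow> norm (jump_cut_hat z1 z2 i p) \<le> B"
    by (auto simp: bounded_iff)
  have "\<bar>jump_cut_hat z1 z2 i p\<bar> \<le> \<bar>B\<bar>" for p
  proof (cases "p \<in> {0..1} \<times> {0..1}")
    case True
    then show ?thesis using B[of p] by simp
  next
    case False
    then have "jump_cut_hat z1 z2 i p = 0" by (cases p) (auto simp: jump_cut_hat_def)
    then show ?thesis by simp
  qed
  then show ?thesis by (intro that[of "\<bar>B\<bar>"]) auto
qed

lemma jump_cut_hat_nonneg: "z1 < z2 \<Longrightarrow> 0 \<le> jump_cut_hat z1 z2 i p"
  by (auto simp: jump_cut_hat_def intro!: jump_cut_nonneg)

lemma jump_cut_hat_measurable[measurable]: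
  "jump_cut_hat z1 z2 i \<in> borel_measurable (borel \<Otimes>\<^sub>M borel)"
  using jump_cut_hat_continuous by (simp add: borel_prod borel_measurable_continuous_onI)

lemma cut_incseq:
  assumes "0 < x"
  shows "incseq (\<lambda>i. cut i x)"
proof (rule incseq_SucI)
  fix i show "cut i x \<le> cut (Suc i) x"
  proof (cases "i = 0")
    case True
    then show ?thesis using cut_nonneg by (simp add: cut_def)
  qed (use assms in \<open>auto intro: cut_mono\<close>)
qed

lemma cut_eventually_1: "0 < x \<Longrightarrow> \<forall>\<^sub>F i in sequentially. cut i x = 1"
  using eventually_ge_at_top[of "max 1 (nat \<lceil>max (2 / x) x\<rceil>)"]
proof eventually_elim
  case (elim i)
  then have i: "1 \<le> i" "2 / x \<le> real i" "x \<le> real i" by linarith+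
  then show ?case using elim by (intro cut_eq_1) (auto simp: field_simps)
qed

lemma jump_cut_hat_incseq:
  assumes "z1 < z2"
  shows "incseq (\<lambda>i. jump_cut_hat z1 z2 i p)"
proof (rule incseq_SucI)
  fix i
  show "jump_cut_hat z1 z2 i p \<le> jump_cut_hat z1 z2 (Suc i) p"
    using jump_nonneg[OF assms] incseq_SucD[OF cut_incseq, of "fst p / (1 - fst p)" i]
      incseq_SucD[OF cut_incseq, of "snd p / (1 - snd p)" i] cut_nonneg
    by (auto simp: jump_cut_hat_def jump_cut_def intro!: mult_left_mono mult_mono)
qed

lemma jump_cut_hat_limit: "(\<lambda>i. jump_cut_hat z1 z2 i p) \<longlonglongrightarrow> jump_hat z1 z2 p"
proof (cases "0 < fst p \<and> fst p < 1 \<and> 0 < snd p \<and> snd p < 1")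
  case True
  then have "0 < fst p / (1 - fst p)" "0 < snd p / (1 - snd p)" by auto
  from cut_eventually_1[OF this(1)] cut_eventually_1[OF this(2)]
  have "\<forall>\<^sub>F i in sequentially. jump_cut_hat z1 z2 i p = jump_hat z1 z2 p"
    by eventually_elim (use True in \<open>simp add: jump_cut_hat_def jump_hat_def jump_cut_def\<close>)
  then show ?thesis by (rule tendsto_eventually)
qed (auto simp: jump_cut_hat_def jump_hat_def)

lemma jump_hat_measurable[measurable]: "jump_hat z1 z2 \<in> borel_measurable (borel \<Otimes>\<^sub>M borel)"
  by (rule borel_measurable_LIMSEQ_real[OF jump_cut_hat_limit]) measurable

lemma jump_cut_hat_site:
  assumes "0 < x" "0 < y"
  shows "jump_cut_hat z1 z2 i (x / (1 + x), y / (1 + y)) = jump_cut z1 z2 i x y"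
proof -
  have *: "0 < x / (1 + x)" "x / (1 + x) < 1" "x / (1 + x) / (1 - x / (1 + x)) = x" if "0 < x" for x :: real
    using that by (auto simp: field_simps)
  show ?thesis using *[OF assms(1)] *[OF assms(2)]
    unfolding jump_cut_hat_def fst_conv snd_conv by simp
qed

lemma Q_jump_cut_law:
  assumes n: "1 \<le> n" "k \<le> N n"
  shows "Q n k (jump_cut z1 z2 i) = M\<^sup>2 * (\<integral>u. (\<integral>v. jump_cut_hat z1 z2 i (u, v) \<partial>law n k) \<partial>law n k)"
proof -
  have "Q n k (jump_cut z1 z2 i) = Q n k (\<lambda>x y. jump_cut_hat z1 z2 i (x / (1 + x), y / (1 + y)))"
    unfolding Q_def by (intro sum.cong refl) (simp add: jump_cut_hat_site grid_pos)
  also have "\<dots> = M\<^sup>2 * (\<integral>u. (\<integral>v. jump_cut_hat z1 z2 i (u, v) \<partial>law n k) \<partial>law n k)"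
    by (rule law_double[OF n jump_cut_hat_measurable, symmetric]) (simp_all add: jump_cut_hat_def)
  finally show ?thesis .
qed

end

locale coagulation_limit = coagulation +
  fixes s :: "nat \<Rightarrow> nat" and \<mu> :: "real \<Rightarrow> real measure"
  assumes s_mono: "strict_mono s" and s_ge_1: "\<And>i. 1 \<le> s i"
    and \<mu>_on_unit: "\<And>t. on_unit (\<mu> t)"
    and \<mu>_limit: "\<And>t. 0 \<le> t \<Longrightarrow> t \<le> T \<Longrightarrow> weak_conv_m (\<lambda>i. law (s i) (idx (s i) t)) (\<mu> t)"
    and \<mu>_clamp: "\<And>t. \<mu> t = \<mu> (max 0 (min T t))"
begin

lemma \<mu>_real_distribution: "real_distribution (\<mu> t)"
  using \<mu>_on_unit by (simp add: on_unit_def)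

lemma s_ge: "i \<le> s i" using strict_mono_imp_increasing[OF s_mono] .

lemma law_s_on_unit: "0 \<le> t \<Longrightarrow> t \<le> T \<Longrightarrow> on_unit (law (s i) (idx (s i) t))"
  using s_ge_1 by (intro law_on_unit idx_le)

lemma h_s_tendsto: "(\<lambda>i. h (s i)) \<longlonglongrightarrow> 0"
  using LIMSEQ_subseq_LIMSEQ[OF h_tendsto_0 s_mono] by (simp add: comp_def)

definition Ebar :: "real \<Rightarrow> real \<Rightarrow> real \<Rightarrow> real" where
  "Ebar z1 z2 t = M * (\<integral>u. plateau_hat z1 z2 u \<partial>\<mu> t)"

lemma E_limit:
  assumes t: "0 \<le> t" "t \<le> T" and z: "0 < z1" "z1 < z2"
  shows "(\<lambda>i. E (s i) (idx (s i) t) (plateau z1 z2)) \<longlonglongrightarrow> Ebar z1 z2 t"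
proof -
  have "(\<lambda>i. \<integral>u. plateau_hat z1 z2 u \<partial>law (s i) (idx (s i) t)) \<longlonglongrightarrow> (\<integral>u. plateau_hat z1 z2 u \<partial>\<mu> t)"
    using law_s_on_unit[OF t] plateau_hat_bounds[OF z(2)] plateau_hat_isCont[OF z]
    by (intro weak_conv_integral[OF _ \<mu>_on_unit \<mu>_limit[OF t], where B="z2 - z1"]) auto
  then have "(\<lambda>i. M * (\<integral>u. plateau_hat z1 z2 u \<partial>law (s i) (idx (s i) t))) \<longlonglongrightarrow> Ebar z1 z2 t"
    unfolding Ebar_def by (intro tendsto_intros)
  then show ?thesis using law_plateau[OF s_ge_1 idx_le[OF t] z] by simp
qed

lemma Ebar_0: "0 < z1 \<Longrightarrow> z1 < z2 \<Longrightarrow> Ebar z1 z2 0 = (\<integral>u. plateau z1 z2 u \<partial>m0)"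
  using E_limit[of 0 z1 z2] T_pos LIMSEQ_subseq_LIMSEQ[OF initial_limit s_mono, of z1 z2]
  by (intro LIMSEQ_unique[of "\<lambda>i. E (s i) 0 (plateau z1 z2)"]) (auto simp: comp_def)

lemma Ebar_modulus:
  assumes z: "0 < z1" "z1 < z2"
  obtains C where "0 \<le> C" "\<And>t t' d. 0 \<le> t \<Longrightarrow> t \<le> T \<Longrightarrow> 0 \<le> t' \<Longrightarrow> t' \<le> T \<Longrightarrow> \<bar>t - t'\<bar> < d \<Longrightarrow>
    \<bar>Ebar z1 z2 t - Ebar z1 z2 t'\<bar> \<le> C * (sqrt d + d)"
proof -
  obtain C where C: "0 \<le> C" "\<And>n t t' d. 1 \<le> n \<Longrightarrow> z2 < real n \<Longrightarrow> 0 \<le> t \<Longrightarrow> t \<le> T \<Longrightarrow> 0 \<le> t' \<Longrightarrow> t' \<le> T \<Longrightarrow>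
     \<bar>t - t'\<bar> + h n \<le> d \<Longrightarrow>
     \<bar>E n (idx n t) (plateau z1 z2) - E n (idx n t') (plateau z1 z2)\<bar> \<le> C * (sqrt d + d)"
    by (rule time_increment[OF z], rule that)
  show ?thesis
  proof (rule that[OF C(1)])
    fix t t' d assume t: "0 \<le> t" "t \<le> T" "0 \<le> t'" "t' \<le> T" and d: "\<bar>t - t'\<bar> < d"
    have "\<forall>\<^sub>F i in sequentially. h (s i) < d - \<bar>t - t'\<bar>"
      using h_s_tendsto d by (intro order_tendstoD) auto
    moreover have "\<forall>\<^sub>F i in sequentially. nat \<lceil>z2\<rceil> < i" by (rule eventually_gt_at_top)
    ultimately have "\<forall>\<^sub>F i in sequentially.
      \<bar>E (s i) (idx (s i) t) (plateau z1 z2) - E (s i) (idx (s i) t') (plateau z1 z2)\<bar> \<le> C * (sqrt d + d)"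
    proof eventually_elim
      case (elim i)
      then have "z2 < real (s i)" using s_ge[of i] by linarith
      then show ?case using elim t s_ge_1 by (intro C(2)) auto
    qed
    then show "\<bar>Ebar z1 z2 t - Ebar z1 z2 t'\<bar> \<le> C * (sqrt d + d)"
      using E_limit[OF _ _ z] t by (intro tendsto_upperbound[OF tendsto_rabs[OF tendsto_diff]]) auto
  qed
qed

lemma \<mu>_weakly_continuous:
  assumes X: "\<And>j. 0 \<le> X j" "\<And>j. X j \<le> T" and t: "0 \<le> t" "t \<le> T" and lim: "X \<longlonglongrightarrow> t"
  shows "weak_conv_m (\<lambda>j. \<mu> (X j)) (\<mu> t)"
proof (rule weak_conv_plateau[OF \<mu>_on_unit \<mu>_on_unit])
  fix z1 z2 :: real assume z: "0 < z1" "z1 < z2"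
  obtain C where C: "0 \<le> C" "\<And>t t' d. 0 \<le> t \<Longrightarrow> t \<le> T \<Longrightarrow> 0 \<le> t' \<Longrightarrow> t' \<le> T \<Longrightarrow> \<bar>t - t'\<bar> < d \<Longrightarrow>
    \<bar>Ebar z1 z2 t - Ebar z1 z2 t'\<bar> \<le> C * (sqrt d + d)"
    by (rule Ebar_modulus[OF z], rule that)
  have "(\<lambda>j. Ebar z1 z2 (X j)) \<longlonglongrightarrow> Ebar z1 z2 t"
  proof (rule LIMSEQ_I)
    fix e :: real assume "0 < e"
    then obtain d where d: "0 < d" "C * (sqrt d + d) < e" by (rule small_modulus)
    obtain j0 where j0: "\<And>j. j0 \<le> j \<Longrightarrow> \<bar>X j - t\<bar> < d"
      using LIMSEQ_D[OF lim d(1)] by auto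
    show "\<exists>no. \<forall>j\<ge>no. norm (Ebar z1 z2 (X j) - Ebar z1 z2 t) < e"
    proof (intro exI[of _ j0] allI impI)
      fix j assume "j0 \<le> j"
      then show "norm (Ebar z1 z2 (X j) - Ebar z1 z2 t) < e"
        using C(2)[OF X t j0] d(2) by fastforce
    qed
  qed
  then have "(\<lambda>j. inverse M * Ebar z1 z2 (X j)) \<longlonglongrightarrow> inverse M * Ebar z1 z2 t" by (intro tendsto_intros)
  then show "(\<lambda>j. \<integral>u. plateau_hat z1 z2 u \<partial>\<mu> (X j)) \<longlonglongrightarrow> (\<integral>u. plateau_hat z1 z2 u \<partial>\<mu> t)"
    using M_pos by (simp add: Ebar_def)
qed

lemma continuous_on_clampI:
  fixes F :: "real \<Rightarrow> real"
  assumes "\<And>X t. (\<And>j. 0 \<le> X j) \<Longrightarrow> (\<And>j. X j \<le> T) \<Longrightarrow> 0 \<le> t \<Longrightarrow> t \<le> T \<Longrightarrow> X \<longlonglongrightarrow> t \<Longrightarrow>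
      (\<lambda>j. F (X j)) \<longlonglongrightarrow> F t"
    and "\<And>t. F t = F (max 0 (min T t))"
  shows "continuous_on UNIV F"
proof -
  have "continuous_on UNIV (\<lambda>t. F (max 0 (min T t)))"
    unfolding continuous_on_sequentially comp_def
  proof safe
    fix X :: "nat \<Rightarrow> real" and t assume "X \<longlonglongrightarrow> t"
    then have "(\<lambda>j. max 0 (min T (X j))) \<longlonglongrightarrow> max 0 (min T t)" by (intro tendsto_intros)
    then show "(\<lambda>j. F (max 0 (min T (X j)))) \<longlonglongrightarrow> F (max 0 (min T t))"
      using T_pos by (intro assms(1)) auto
  qed
  then show ?thesis using assms(2) by simp
qed

lemma \<mu>_integral_continuous:
  fixes f :: "real \<Rightarrow> real"
  assumes "\<And>x. isCont f x" "\<And>x. \<bar>f x\<bar> \<le> B"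
  shows "continuous_on UNIV (\<lambda>t. \<integral>u. f u \<partial>\<mu> t)"
proof (rule continuous_on_clampI)
  fix X :: "nat \<Rightarrow> real" and t
  assume A: "\<And>j. 0 \<le> X j" "\<And>j. X j \<le> T" "0 \<le> t" "t \<le> T" "X \<longlonglongrightarrow> t"
  show "(\<lambda>j. \<integral>u. f u \<partial>\<mu> (X j)) \<longlonglongrightarrow> (\<integral>u. f u \<partial>\<mu> t)"
    by (rule weak_conv_integral[OF \<mu>_on_unit \<mu>_on_unit \<mu>_weakly_continuous[OF A] assms])
qed (use \<mu>_clamp in simp)

definition Rcut :: "real \<Rightarrow> real \<Rightarrow> nat \<Rightarrow> real \<Rightarrow> real" where
  "Rcut z1 z2 i t = M\<^sup>2 * (\<integral>u. (\<integral>v. jump_cut_hat z1 z2 i (u, v) \<partial>\<mu> t) \<partial>\<mu> t)"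

lemma Rcut_continuous: "continuous_on UNIV (Rcut z1 z2 i)"
proof (rule continuous_on_clampI)
  fix X :: "nat \<Rightarrow> real" and t
  assume A: "\<And>j. 0 \<le> X j" "\<And>j. X j \<le> T" "0 \<le> t" "t \<le> T" "X \<longlonglongrightarrow> t"
  obtain B where B: "\<And>p. \<bar>jump_cut_hat z1 z2 i p\<bar> \<le> B" using jump_cut_hat_bounded by blast
  show "(\<lambda>j. Rcut z1 z2 i (X j)) \<longlonglongrightarrow> Rcut z1 z2 i t"
    unfolding Rcut_def
    by (intro tendsto_intros weak_conv_double_integral[OF \<mu>_on_unit \<mu>_on_unit \<mu>_weakly_continuous[OF A] jump_cut_hat_continuous B])
qed (use \<mu>_clamp in \<open>simp add: Rcut_def\<close>)

lemma Q_jump_cut_limit: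
  assumes t: "0 \<le> t" "t \<le> T"
  shows "(\<lambda>m. Q (s m) (idx (s m) t) (jump_cut z1 z2 i)) \<longlonglongrightarrow> Rcut z1 z2 i t"
proof -
  obtain B where B: "\<And>p. \<bar>jump_cut_hat z1 z2 i p\<bar> \<le> B" using jump_cut_hat_bounded by blast
  show ?thesis
    unfolding Rcut_def Q_jump_cut_law[OF s_ge_1 idx_le[OF t]]
    by (intro tendsto_intros weak_conv_double_integral[OF law_s_on_unit[OF t] \<mu>_on_unit \<mu>_limit[OF t] jump_cut_hat_continuous B])
qed

lemma step_limit:
  assumes t: "0 \<le> t" "t \<le> T"
    and lim: "\<And>\<tau>. 0 \<le> \<tau> \<Longrightarrow> \<tau> < t \<Longrightarrow> (\<lambda>i. A (s i) (idx (s i) \<tau>)) \<longlonglongrightarrow> g \<tau>"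
    and bnd: "\<And>i k. k \<le> N (s i) \<Longrightarrow> \<bar>A (s i) k\<bar> \<le> B" and g[measurable]: "g \<in> borel_measurable borel"
  shows "(\<lambda>i. \<Sum>j\<in>{..<idx (s i) t}. h (s i) * A (s i) j) \<longlonglongrightarrow> (\<integral>\<tau>. indicator {0..<t} \<tau> * g \<tau> \<partial>lborel)"
proof -
  have B0: "0 \<le> B" using bnd[of 0 0] by simp
  define F where "F i \<tau> = indicator {0..<h (s i) * real (idx (s i) t)} \<tau> * A (s i) (idx (s i) \<tau>)" for i \<tau>
  have sub: "h (s i) * real (idx (s i) t) \<le> t" for i by (rule idx_bounds[OF t(1)])
  have "(\<lambda>i. \<integral>\<tau>. F i \<tau> \<partial>lborel) \<longlonglongrightarrow> (\<integral>\<tau>. indicator {0..<t} \<tau> * g \<tau> \<partial>lborel)"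
  proof (rule integral_dominated_convergence[where w="\<lambda>\<tau>. B * indicator {0..T} \<tau>"])
    show "AE \<tau> in lborel. (\<lambda>i. F i \<tau>) \<longlonglongrightarrow> indicator {0..<t} \<tau> * g \<tau>"
    proof (intro AE_I2)
      fix \<tau>
      show "(\<lambda>i. F i \<tau>) \<longlonglongrightarrow> indicator {0..<t} \<tau> * g \<tau>"
      proof (cases "0 \<le> \<tau> \<and> \<tau> < t")
        case True
        have "\<forall>\<^sub>F i in sequentially. h (s i) < t - \<tau>" using h_s_tendsto True by (intro order_tendstoD) auto
        then have "\<forall>\<^sub>F i in sequentially. A (s i) (idx (s i) \<tau>) = F i \<tau>"
        proof eventually_elim
          case (elim i)
          then have "\<tau> < h (s i) * real (idx (s i) t)" using idx_bounds[OF t(1), of "s i"] by linarith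
          then show ?case using True by (simp add: F_def)
        qed
        then have "(\<lambda>i. F i \<tau>) \<longlonglongrightarrow> g \<tau>" using lim True by (auto intro: Lim_transform_eventually)
        then show ?thesis using True by simp
      next
        case False
        then have "F i \<tau> = 0" for i using sub[of i] by (auto simp: F_def split: split_indicator)
        then show ?thesis using False by (auto split: split_indicator)
      qed
    qed
    show "AE \<tau> in lborel. norm (F i \<tau>) \<le> B * indicator {0..T} \<tau>" for i
    proof (intro AE_I2)
      fix \<tau>
      show "norm (F i \<tau>) \<le> B * indicator {0..T} \<tau>"
      proof (cases "0 \<le> \<tau> \<and> \<tau> < h (s i) * real (idx (s i) t)")
        case True
        then have "\<tau> \<le> T" using sub[of i] t by linarith
        then show ?thesis using True bnd[OF idx_le] by (simp add: F_def)
      qed (use B0 in \<open>auto simp: F_def split: split_indicator\<close>)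
    qed
    show "integrable lborel (\<lambda>\<tau>. B * indicator {0..T} \<tau>)"
      by (intro integrable_mult_right integrable_real_indicator) (auto simp: emeasure_lborel_Icc_eq)
  qed (auto simp: F_def)
  moreover have "(\<integral>\<tau>. F i \<tau> \<partial>lborel) = (\<Sum>j\<in>{..<idx (s i) t}. h (s i) * A (s i) j)" for i
    unfolding F_def by (rule has_bochner_integral_integral_eq[OF step_sum_integral])
  ultimately show ?thesis by simp
qed

lemma Rcut_integrals:
  assumes z: "z1 < z2"
  shows "(\<integral>\<^sup>+u. (\<integral>\<^sup>+v. ennreal (M\<^sup>2 * jump_cut_hat z1 z2 i (u, v)) \<partial>\<mu> t) \<partial>\<mu> t) = ennreal (Rcut z1 z2 i t)"
    and "0 \<le> Rcut z1 z2 i t"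
proof -
  interpret real_distribution "\<mu> t" by (rule \<mu>_real_distribution)
  obtain B where B: "0 \<le> B" "\<And>p. \<bar>jump_cut_hat z1 z2 i p\<bar> \<le> B" using jump_cut_hat_bounded by blast
  note nn = jump_cut_hat_nonneg[OF z]
  have int1: "integrable (\<mu> t) (\<lambda>v. jump_cut_hat z1 z2 i (u, v))" for u
    using B by (intro integrable_const_bound[where B=B]) auto
  have nn1: "0 \<le> (\<integral>v. jump_cut_hat z1 z2 i (u, v) \<partial>\<mu> t)" for u using nn by simp
  have bnd1: "(\<integral>v. jump_cut_hat z1 z2 i (u, v) \<partial>\<mu> t) \<le> B" for u
  proof -
    have "prob UNIV = 1" using prob_space by simp
    then show ?thesis using integral_mono[OF int1, of "\<lambda>_. B" u] B(2) by (simp add: abs_le_iff)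
  qed
  have int2: "integrable (\<mu> t) (\<lambda>u. \<integral>v. jump_cut_hat z1 z2 i (u, v) \<partial>\<mu> t)"
    using nn1 bnd1 by (intro integrable_const_bound[where B=B] borel_measurable_lebesgue_integral) auto
  show "0 \<le> Rcut z1 z2 i t" unfolding Rcut_def using nn1 by simp
  have "(\<integral>\<^sup>+v. ennreal (M\<^sup>2 * jump_cut_hat z1 z2 i (u, v)) \<partial>\<mu> t) = ennreal (M\<^sup>2 * (\<integral>v. jump_cut_hat z1 z2 i (u, v) \<partial>\<mu> t))" for u
    using int1 nn by (subst nn_integral_eq_integral) auto
  then show "(\<integral>\<^sup>+u. (\<integral>\<^sup>+v. ennreal (M\<^sup>2 * jump_cut_hat z1 z2 i (u, v)) \<partial>\<mu> t) \<partial>\<mu> t) = ennreal (Rcut z1 z2 i t)"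
    unfolding Rcut_def using int2 nn1 by (simp add: nn_integral_eq_integral)
qed

lemma Rcut_measurable[measurable]: "Rcut z1 z2 i \<in> borel_measurable borel"
  using Rcut_continuous by (rule borel_measurable_continuous_onI)

lemma Rcut_integral_limit:
  assumes t: "0 \<le> t" "t \<le> T" and z: "0 < z1" "z1 < z2"
  shows "(\<lambda>m. \<Sum>j\<in>{..<idx (s m) t}. h (s m) * Q (s m) j (jump_cut z1 z2 i))
    \<longlonglongrightarrow> (\<integral>\<tau>. indicator {0..<t} \<tau> * Rcut z1 z2 i \<tau> \<partial>lborel)"
proof -
  obtain B where B: "0 \<le> B" "\<And>p. \<bar>jump_cut_hat z1 z2 i p\<bar> \<le> B" using jump_cut_hat_bounded by blast
  show ?thesis
  proof (rule step_limit[OF t, where B="B * M\<^sup>2"])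
    show "\<bar>Q (s m) k (jump_cut z1 z2 i)\<bar> \<le> B * M\<^sup>2" if "k \<le> N (s m)" for m k
      using s_ge_1 that B(1)
    proof (intro Q_bound)
      fix x y assume "x \<in> grid (s m)" "y \<in> grid (s m)"
      then show "\<bar>jump_cut z1 z2 i x y\<bar> \<le> B"
        using B(2)[of "(x / (1 + x), y / (1 + y))"] by (simp add: jump_cut_hat_site grid_pos)
    qed
    show "(\<lambda>m. Q (s m) (idx (s m) \<tau>) (jump_cut z1 z2 i)) \<longlonglongrightarrow> Rcut z1 z2 i \<tau>" if "0 \<le> \<tau>" "\<tau> < t" for \<tau>
      using that t by (intro Q_jump_cut_limit) auto
  qed measurable
qed

lemma h_idx_limit: "0 \<le> t \<Longrightarrow> (\<lambda>i. h (s i) * real (idx (s i) t)) \<longlonglongrightarrow> t"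
proof (rule real_tendsto_sandwich)
  assume t: "0 \<le> t"
  show "\<forall>\<^sub>F i in sequentially. t - h (s i) \<le> h (s i) * real (idx (s i) t)"
    using idx_bounds(2)[OF t] by (intro always_eventually allI) (simp add: less_eq_real_def algebra_simps)
  show "\<forall>\<^sub>F i in sequentially. h (s i) * real (idx (s i) t) \<le> t"
    using idx_bounds(1)[OF t] by simp
  show "(\<lambda>i. t - h (s i)) \<longlonglongrightarrow> t" using tendsto_diff[OF tendsto_const h_s_tendsto, of t] by simp
qed simp

lemma jump_sum_limit:
  assumes t: "0 \<le> t" "t \<le> T" and z: "0 < z1" "z1 < z2"
  shows "(\<lambda>i. \<Sum>j\<in>{..<idx (s i) t}. h (s i) * Q (s i) j (jump z1 z2))
    \<longlonglongrightarrow> Ebar z1 z2 0 + t * (z2 - z1) - Ebar z1 z2 t"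
proof -
  have "(\<lambda>i. E (s i) (idx (s i) 0) (plateau z1 z2) + h (s i) * real (idx (s i) t) * (z2 - z1)
      - E (s i) (idx (s i) t) (plateau z1 z2)) \<longlonglongrightarrow> Ebar z1 z2 0 + t * (z2 - z1) - Ebar z1 z2 t"
    using T_pos by (intro tendsto_intros E_limit h_idx_limit t z) auto
  moreover have "\<forall>\<^sub>F i in sequentially. E (s i) (idx (s i) 0) (plateau z1 z2) + h (s i) * real (idx (s i) t) * (z2 - z1)
      - E (s i) (idx (s i) t) (plateau z1 z2) = (\<Sum>j\<in>{..<idx (s i) t}. h (s i) * Q (s i) j (jump z1 z2))"
    using eventually_ge_at_top[of "nat \<lceil>max z2 (1 / z1)\<rceil>"]
  proof eventually_elim
    case (elim i)
    then have i: "z2 \<le> real (s i)" "1 / z1 \<le> real (s i)" using s_ge[of i] by linarith+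
    then have "1 / real (s i) \<le> z1" using z s_ge_1[of i] by (simp add: field_simps)
    then have "plateau z1 z2 (1 / real (s i)) = z2 - z1" using z by (simp add: plateau_def)
    then show ?case using evolution_plateau[OF s_ge_1 le0 z(2) i(1), of "idx (s i) t"]
      by (simp add: atLeast0LessThan)
  qed
  ultimately show ?thesis by (rule Lim_transform_eventually)
qed

lemma Rcut_integral_tendsto:
  assumes t: "0 \<le> t" "t \<le> T" and z: "0 < z1" "z1 < z2"
  shows "(\<lambda>i. \<integral>\<tau>. indicator {0..<t} \<tau> * Rcut z1 z2 i \<tau> \<partial>lborel)
    \<longlonglongrightarrow> Ebar z1 z2 0 + t * (z2 - z1) - Ebar z1 z2 t"
    (is "?I \<longlonglongrightarrow> ?\<rho>")
proof -
  obtain err where err: "err \<longlonglongrightarrow> 0"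
    "\<And>i n k. 1 \<le> i \<Longrightarrow> z2 < real i \<Longrightarrow> 2 / real i \<le> z1 / 2 \<Longrightarrow>
     1 \<le> n \<Longrightarrow> z2 < real n \<Longrightarrow> k \<le> N n \<Longrightarrow>
     (\<Sum>j\<in>{..<k}. h n * Q n j (jump z1 z2)) - (\<Sum>j\<in>{..<k}. h n * Q n j (jump_cut z1 z2 i)) \<le> err i"
    by (rule truncation_error[OF z], rule that)
  have lim: "(\<lambda>m. (\<Sum>j\<in>{..<idx (s m) t}. h (s m) * Q (s m) j (jump z1 z2))
     - (\<Sum>j\<in>{..<idx (s m) t}. h (s m) * Q (s m) j (jump_cut z1 z2 i))) \<longlonglongrightarrow> ?\<rho> - ?I i" for i
    by (intro tendsto_diff jump_sum_limit Rcut_integral_limit t z)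
  have lower: "0 \<le> ?\<rho> - ?I i" for i
  proof (rule tendsto_lowerbound[OF lim])
    show "\<forall>\<^sub>F m in sequentially. 0 \<le> (\<Sum>j\<in>{..<idx (s m) t}. h (s m) * Q (s m) j (jump z1 z2))
     - (\<Sum>j\<in>{..<idx (s m) t}. h (s m) * Q (s m) j (jump_cut z1 z2 i))"
    proof (intro always_eventually allI)
      fix m
      have "(\<Sum>j\<in>{..<idx (s m) t}. h (s m) * Q (s m) j (jump_cut z1 z2 i))
        \<le> (\<Sum>j\<in>{..<idx (s m) t}. h (s m) * Q (s m) j (jump z1 z2))"
        using h_pos[of "s m"] s_ge_1[of m] idx_le[OF t, of "s m"] z
        by (intro sum_mono mult_left_mono Q_mono jump_cut_le) (auto simp: grid_pos)
      then show "0 \<le> (\<Sum>j\<in>{..<idx (s m) t}. h (s m) * Q (s m) j (jump z1 z2))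
     - (\<Sum>j\<in>{..<idx (s m) t}. h (s m) * Q (s m) j (jump_cut z1 z2 i))" by simp
    qed
  qed simp
  have "\<forall>\<^sub>F i in sequentially. ?\<rho> - ?I i \<le> err i"
    using eventually_ge_at_top[of "Suc (nat \<lceil>max z2 (4 / z1)\<rceil>)"]
  proof eventually_elim
    case (elim i)
    then have i: "1 \<le> i" "z2 < real i" "4 / z1 \<le> real i" by linarith+
    then have i': "2 / real i \<le> z1 / 2" using z by (simp add: field_simps)
    show ?case
    proof (rule tendsto_upperbound[OF lim])
      show "\<forall>\<^sub>F m in sequentially. (\<Sum>j\<in>{..<idx (s m) t}. h (s m) * Q (s m) j (jump z1 z2))
       - (\<Sum>j\<in>{..<idx (s m) t}. h (s m) * Q (s m) j (jump_cut z1 z2 i)) \<le> err i"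
        using eventually_gt_at_top[of "nat \<lceil>z2\<rceil>"]
      proof eventually_elim
        case (elim m)
        then have "z2 < real (s m)" using s_ge[of m] by linarith
        then show ?case using i i' s_ge_1 idx_le[OF t] by (intro err(2)) auto
      qed
    qed simp
  qed
  then have "(\<lambda>i. ?\<rho> - ?I i) \<longlonglongrightarrow> 0"
    using lower by (intro real_tendsto_sandwich[OF _ _ tendsto_const err(1)]) auto
  from tendsto_diff[OF tendsto_const this, of ?\<rho>] show ?thesis by simp
qed

lemma limit_identity:
  assumes t: "0 \<le> t" "t \<le> T" and z: "0 < z1" "z1 < z2"
  shows "(\<integral>\<^sup>+\<tau>. indicator {0..<t} \<tau> * (\<integral>\<^sup>+u. (\<integral>\<^sup>+v. ennreal (M\<^sup>2 * jump_hat z1 z2 (u, v)) \<partial>\<mu> \<tau>) \<partial>\<mu> \<tau>) \<partial>lborel)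
      = ennreal (Ebar z1 z2 0 + t * (z2 - z1) - Ebar z1 z2 t)"
    and "0 \<le> Ebar z1 z2 0 + t * (z2 - z1) - Ebar z1 z2 t"
proof -
  define \<rho> where "\<rho> = Ebar z1 z2 0 + t * (z2 - z1) - Ebar z1 z2 t"
  define I where "I i = (\<integral>\<tau>. indicator {0..<t} \<tau> * Rcut z1 z2 i \<tau> \<partial>lborel)" for i
  define G where "G i \<tau> = (\<integral>\<^sup>+u. (\<integral>\<^sup>+v. ennreal (M\<^sup>2 * jump_cut_hat z1 z2 i (u, v)) \<partial>\<mu> \<tau>) \<partial>\<mu> \<tau>)" for i \<tau>
  define G' where "G' \<tau> = (\<integral>\<^sup>+u. (\<integral>\<^sup>+v. ennreal (M\<^sup>2 * jump_hat z1 z2 (u, v)) \<partial>\<mu> \<tau>) \<partial>\<mu> \<tau>)" for \<tau>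
  have I\<rho>: "I \<longlonglongrightarrow> \<rho>" unfolding I_def \<rho>_def by (rule Rcut_integral_tendsto[OF t z])
  have I0: "0 \<le> I i" for i unfolding I_def using Rcut_integrals(2)[OF z(2)] by simp
  show "0 \<le> Ebar z1 z2 0 + t * (z2 - z1) - Ebar z1 z2 t"
    using LIMSEQ_le_const[OF I\<rho>, of 0] I0 by (auto simp: \<rho>_def)
  have M2: "0 \<le> M\<^sup>2" by simp
  have G_eq: "G i \<tau> = ennreal (Rcut z1 z2 i \<tau>)" for i \<tau>
    unfolding G_def by (rule Rcut_integrals(1)[OF z(2)])
  have Gm: "(\<lambda>\<tau>. indicator {0..<t} \<tau> * G i \<tau>) \<in> borel_measurable lborel" for i
    unfolding G_eq by measurable
  have inc: "incseq (\<lambda>i. ennreal (M\<^sup>2 * jump_cut_hat z1 z2 i p))" for p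
    using incseqD[OF jump_cut_hat_incseq[OF z(2)], of _ _ p] M2
    by (intro monoI ennreal_leI mult_left_mono) auto
  have lim: "(\<lambda>i. ennreal (M\<^sup>2 * jump_cut_hat z1 z2 i p)) \<longlonglongrightarrow> ennreal (M\<^sup>2 * jump_hat z1 z2 p)" for p
    by (intro tendsto_ennrealI tendsto_intros jump_cut_hat_limit)
  have G_lim: "(\<lambda>i. G i \<tau>) \<longlonglongrightarrow> G' \<tau>" and G_inc: "incseq (\<lambda>i. G i \<tau>)" for \<tau>
  proof -
    interpret real_distribution "\<mu> \<tau>" by (rule \<mu>_real_distribution)
    have inc1: "incseq (\<lambda>i u. \<integral>\<^sup>+v. ennreal (M\<^sup>2 * jump_cut_hat z1 z2 i (u, v)) \<partial>\<mu> \<tau>)"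
      using incseqD[OF inc] by (intro monoI le_funI nn_integral_mono) auto
    show "incseq (\<lambda>i. G i \<tau>)"
      unfolding G_def using incseqD[OF inc] by (intro monoI nn_integral_mono) auto
    show "(\<lambda>i. G i \<tau>) \<longlonglongrightarrow> G' \<tau>"
      unfolding G_def G'_def
    proof (rule nn_integral_LIMSEQ[OF inc1])
      show "(\<lambda>u. \<integral>\<^sup>+v. ennreal (M\<^sup>2 * jump_cut_hat z1 z2 i (u, v)) \<partial>\<mu> \<tau>) \<in> borel_measurable (\<mu> \<tau>)" for i
        by (intro borel_measurable_nn_integral) simp
      fix u
      show "(\<lambda>i. \<integral>\<^sup>+v. ennreal (M\<^sup>2 * jump_cut_hat z1 z2 i (u, v)) \<partial>\<mu> \<tau>)
        \<longlonglongrightarrow> (\<integral>\<^sup>+v. ennreal (M\<^sup>2 * jump_hat z1 z2 (u, v)) \<partial>\<mu> \<tau>)"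
      proof (rule nn_integral_LIMSEQ[OF _ _ lim])
        show "incseq (\<lambda>i v. ennreal (M\<^sup>2 * jump_cut_hat z1 z2 i (u, v)))"
          using incseqD[OF inc] by (intro monoI le_funI) auto
      qed simp
    qed
  qed
  have "(\<lambda>i. \<integral>\<^sup>+\<tau>. indicator {0..<t} \<tau> * G i \<tau> \<partial>lborel) \<longlonglongrightarrow> (\<integral>\<^sup>+\<tau>. indicator {0..<t} \<tau> * G' \<tau> \<partial>lborel)"
  proof (rule nn_integral_LIMSEQ[OF _ Gm])
    show "incseq (\<lambda>i \<tau>. indicator {0..<t} \<tau> * G i \<tau>)"
      using incseqD[OF G_inc] by (intro monoI le_funI mult_left_mono) auto
    show "(\<lambda>i. indicator {0..<t} \<tau> * G i \<tau>) \<longlonglongrightarrow> indicator {0..<t} \<tau> * G' \<tau>" for \<tau>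
      using G_lim by (cases "\<tau> \<in> {0..<t}") auto
  qed
  moreover have "(\<integral>\<^sup>+\<tau>. indicator {0..<t} \<tau> * G i \<tau> \<partial>lborel) = ennreal (I i)" for i
  proof -
    obtain D where D: "\<And>\<tau>. \<tau> \<in> {0..T} \<Longrightarrow> norm (Rcut z1 z2 i \<tau>) \<le> D"
    proof -
      have "compact (Rcut z1 z2 i ` {0..T})"
        by (intro compact_continuous_image continuous_on_subset[OF Rcut_continuous]) auto
      then have "bounded (Rcut z1 z2 i ` {0..T})" by (rule compact_imp_bounded)
      then obtain D where "\<And>y. y \<in> Rcut z1 z2 i ` {0..T} \<Longrightarrow> norm y \<le> D" unfolding bounded_iff by blast
      then show ?thesis by (intro that[of D]) blast
    qed
    have "integrable lborel (\<lambda>\<tau>. indicator {0..<t} \<tau> * Rcut z1 z2 i \<tau>)"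
    proof (rule Bochner_Integration.integrable_bound)
      show "integrable lborel (\<lambda>\<tau>. D * indicator {0..T} \<tau>)"
        by (intro integrable_mult_right integrable_real_indicator) (auto simp: emeasure_lborel_Icc_eq)
      show "AE \<tau> in lborel. norm (indicator {0..<t} \<tau> * Rcut z1 z2 i \<tau>) \<le> norm (D * indicator {0..T} \<tau>)"
        using D t by (intro AE_I2) (auto split: split_indicator intro: order_trans[OF _ abs_ge_self])
    qed measurable
    then have "(\<integral>\<^sup>+\<tau>. ennreal (indicator {0..<t} \<tau> * Rcut z1 z2 i \<tau>) \<partial>lborel) = ennreal (I i)"
      unfolding I_def using Rcut_integrals(2)[OF z(2)] by (intro nn_integral_eq_integral) auto
    moreover have "indicator {0..<t} \<tau> * G i \<tau> = ennreal (indicator {0..<t} \<tau> * Rcut z1 z2 i \<tau>)" for \<tau>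
      by (simp add: G_eq split: split_indicator)
    ultimately show ?thesis by simp
  qed
  moreover have "(\<lambda>i. ennreal (I i)) \<longlonglongrightarrow> ennreal \<rho>" by (rule tendsto_ennrealI[OF I\<rho>])
  ultimately have "(\<integral>\<^sup>+\<tau>. indicator {0..<t} \<tau> * G' \<tau> \<partial>lborel) = ennreal \<rho>"
    by (simp add: LIMSEQ_unique)
  then show "(\<integral>\<^sup>+\<tau>. indicator {0..<t} \<tau> * (\<integral>\<^sup>+u. (\<integral>\<^sup>+v. ennreal (M\<^sup>2 * jump_hat z1 z2 (u, v)) \<partial>\<mu> \<tau>) \<partial>\<mu> \<tau>) \<partial>lborel)
      = ennreal (Ebar z1 z2 0 + t * (z2 - z1) - Ebar z1 z2 t)" by (simp add: G'_def \<rho>_def)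
qed

lemma \<mu>_measurable[measurable]: "\<mu> \<in> measurable borel (subprob_algebra borel)"
proof (rule measurable_subprob_algebra_generated[where G="range atMost" and \<Omega>=UNIV])
  show "sets borel = sigma_sets UNIV (range atMost :: real set set)"
    by (subst borel_eq_atMost) simp
  show "Int_stable (range atMost :: real set set)"
    by (auto simp: Int_stable_def)
  fix t :: real
  interpret real_distribution "\<mu> t" by (rule \<mu>_real_distribution)
  show "subprob_space (\<mu> t)" by (rule prob_space_imp_subprob_space) unfold_locales
  show "sets (\<mu> t) = sets borel" by simp
next
  have "emeasure (\<mu> t) UNIV = 1" for t
  proof -
    interpret real_distribution "\<mu> t" by (rule \<mu>_real_distribution)
    show ?thesis using emeasure_space_1 by simp
  qed
  then show "(\<lambda>t. emeasure (\<mu> t) UNIV) \<in> borel_measurable borel" by simp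
next
  fix A :: "real set" assume "A \<in> range atMost"
  then obtain x where A: "A = {..x}" by auto
  have "(\<lambda>t. cdf (\<mu> t) x) \<in> borel_measurable borel"
  proof (rule borel_measurable_LIMSEQ_real)
    fix k :: nat
    have step: "isCont (cts_step x (x + 1 / real (Suc k))) y" for y
      using cts_step_uniformly_continuous[of x "x + 1 / real (Suc k)"]
      by (auto dest!: uniformly_continuous_imp_continuous simp: continuous_on_eq_continuous_at)
    show "(\<lambda>t. \<integral>u. cts_step x (x + 1 / real (Suc k)) u \<partial>\<mu> t) \<in> borel_measurable borel"
      by (intro borel_measurable_continuous_onI \<mu>_integral_continuous[OF step, where B=1])
        (rule cts_step_bound, simp)
  next
    fix t :: real
    interpret real_distribution "\<mu> t" by (rule \<mu>_real_distribution)
    have "(\<lambda>k. cdf (\<mu> t) (x + 1 / real (Suc k))) \<longlonglongrightarrow> cdf (\<mu> t) x"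
      by (rule cdf_right_sequence[OF LIMSEQ_add_inverse_Suc]) simp
    show "(\<lambda>k. \<integral>u. cts_step x (x + 1 / real (Suc k)) u \<partial>\<mu> t) \<longlonglongrightarrow> cdf (\<mu> t) x"
    proof (rule real_tendsto_sandwich[OF _ _ tendsto_const \<open>_ \<longlonglongrightarrow> cdf (\<mu> t) x\<close>])
      show "\<forall>\<^sub>F k in sequentially. cdf (\<mu> t) x \<le> (\<integral>u. cts_step x (x + 1 / real (Suc k)) u \<partial>\<mu> t)"
        by (intro always_eventually allI cdf_cts_step) simp
      show "\<forall>\<^sub>F k in sequentially. (\<integral>u. cts_step x (x + 1 / real (Suc k)) u \<partial>\<mu> t) \<le> cdf (\<mu> t) (x + 1 / real (Suc k))"
        by (intro always_eventually allI cdf_cts_step) simp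
    qed
  qed
  then have "(\<lambda>t. ennreal (cdf (\<mu> t) x)) \<in> borel_measurable borel" by measurable
  moreover have "ennreal (cdf (\<mu> t) x) = emeasure (\<mu> t) A" for t
  proof -
    interpret real_distribution "\<mu> t" by (rule \<mu>_real_distribution)
    show ?thesis by (simp add: A cdf_def emeasure_eq_measure)
  qed
  ultimately show "(\<lambda>t. emeasure (\<mu> t) A) \<in> borel_measurable borel" by simp
qed auto

end

lemma AE_eq_of_interval_integrals:
  fixes f g :: "real \<Rightarrow> ennreal"
  assumes [measurable]: "f \<in> borel_measurable borel" "g \<in> borel_measurable borel"
    and eq: "\<And>z1 z2. 0 < z1 \<Longrightarrow> z1 < z2 \<Longrightarrow>
      (\<integral>\<^sup>+z. f z * indicator {z1..z2} z \<partial>lborel) = (\<integral>\<^sup>+z. g z * indicator {z1..z2} z \<partial>lborel)"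
    and fin: "\<And>z1 z2. 0 < z1 \<Longrightarrow> z1 < z2 \<Longrightarrow> (\<integral>\<^sup>+z. g z * indicator {z1..z2} z \<partial>lborel) < \<infinity>"
  shows "AE z in lborel. 0 < z \<longrightarrow> f z = g z"
proof -
  have loc: "AE z in lborel. z \<in> {p..q} \<longrightarrow> f z = g z" if pq: "0 < p" "p < q" for p q
  proof -
    let ?f = "\<lambda>z. f z * indicator {p..q} z" and ?g = "\<lambda>z. g z * indicator {p..q} z"
    have e: "emeasure (density lborel ?f) {..x} = emeasure (density lborel ?g) {..x}" for x
    proof (cases "x \<le> p")
      case True
      have ae: "AE z in lborel. z \<noteq> p" by (rule AE_lborel_singleton)
      have "emeasure (density lborel ?f) {..x} = (\<integral>\<^sup>+(z::real). 0 \<partial>lborel)"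
        by (subst emeasure_density, simp, simp, rule nn_integral_cong_AE)
          (use ae True in \<open>auto elim!: eventually_mono split: split_indicator\<close>)
      moreover have "emeasure (density lborel ?g) {..x} = (\<integral>\<^sup>+(z::real). 0 \<partial>lborel)"
        by (subst emeasure_density, simp, simp, rule nn_integral_cong_AE)
          (use ae True in \<open>auto elim!: eventually_mono split: split_indicator\<close>)
      ultimately show ?thesis by simp
    next
      case False
      have *: "emeasure (density lborel (\<lambda>z. F z * indicator {p..q} z)) {..x} = (\<integral>\<^sup>+z. F z * indicator {p..min x q} z \<partial>lborel)"
        if [measurable]: "F \<in> borel_measurable borel" for F :: "real \<Rightarrow> ennreal"
        by (subst emeasure_density) (auto intro!: nn_integral_cong split: split_indicator)
      show ?thesis using False pq by (simp add: * eq)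
    qed
    have fin': "finite_borel_measure (density lborel F)"
      if [measurable]: "F \<in> borel_measurable borel" and "(\<integral>\<^sup>+z. F z \<partial>lborel) < \<infinity>" for F
    proof (intro finite_borel_measure.intro finite_measureI finite_borel_measure_axioms.intro)
      show "emeasure (density lborel F) (space (density lborel F)) \<noteq> \<infinity>"
        using that(2) by (simp add: emeasure_density)
    qed simp
    have "density lborel ?f = density lborel ?g"
    proof (rule cdf_unique')
      show "finite_borel_measure (density lborel ?f)" using fin[OF pq] by (intro fin') (auto simp: eq[OF pq])
      show "finite_borel_measure (density lborel ?g)" using fin[OF pq] by (intro fin') auto
      show "cdf (density lborel ?f) = cdf (density lborel ?g)" by (auto simp: cdf_def measure_def e)
    qed
    then have "AE z in lborel. ?f z = ?g z"
      by (subst (asm) sigma_finite_measure.density_unique_iff[OF sigma_finite_lborel]) auto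
    then show ?thesis by eventually_elim (auto split: split_indicator_asm)
  qed
  have "AE z in lborel. \<forall>k::nat. z \<in> {1 / real (Suc k)..real k + 2} \<longrightarrow> f z = g z"
  proof (subst AE_all_countable, intro allI loc)
    fix k :: nat
    have "1 / real (Suc k) \<le> 1" by simp
    then show "1 / real (Suc k) < real k + 2" by linarith
  qed simp
  then show ?thesis
  proof eventually_elim
    case (elim z)
    show ?case
    proof
      assume z: "0 < z"
      obtain k where k: "max z (1 / z) < real k" using reals_Archimedean2 by blast
      then have "1 / real (Suc k) \<le> z" using z by (simp add: field_simps)
      then show "f z = g z" using elim k by (auto dest!: spec[of _ k])
    qed
  qed
qed

lemma plateau_eq_nn_integral:
  assumes "z1 < z2"
  shows "ennreal (plateau z1 z2 x) = (\<integral>\<^sup>+z. indicator {z1..z2} z * indicator {x..} z \<partial>lborel)"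
proof -
  have "(\<integral>\<^sup>+z. indicator {z1..z2} z * indicator {x..} z \<partial>lborel) = (\<integral>\<^sup>+z. indicator {max z1 x..z2} z \<partial>lborel)"
    by (intro nn_integral_cong) (auto split: split_indicator)
  also have "\<dots> = ennreal (plateau z1 z2 x)"
    using assms by (auto simp: emeasure_lborel_Icc_eq plateau_def min_def max_def)
  finally show ?thesis by simp
qed

lemma plateau_diff_eq_nn_integral:
  assumes "z1 < z2" "0 < y"
  shows "ennreal (plateau z1 z2 x - plateau z1 z2 (x + y)) = (\<integral>\<^sup>+z. indicator {z1..z2} z * indicator {x..<x + y} z \<partial>lborel)"
proof -
  have "ennreal (plateau z1 z2 x) = (\<integral>\<^sup>+z. indicator {z1..z2} z * indicator {x..<x + y} z + indicator {z1..z2} z * indicator {x + y..} z \<partial>lborel)"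
    unfolding plateau_eq_nn_integral[OF assms(1)] using assms(2)
    by (intro nn_integral_cong) (auto split: split_indicator)
  also have "\<dots> = (\<integral>\<^sup>+z. indicator {z1..z2} z * indicator {x..<x + y} z \<partial>lborel) + ennreal (plateau z1 z2 (x + y))"
    unfolding plateau_eq_nn_integral[OF assms(1)] by (intro nn_integral_add) auto
  finally show ?thesis
    using assms(1) by (simp add: ennreal_minus[symmetric] plateau_def)
qed

lemma plateau_hat_eq_nn_integral:
  assumes "0 < z1" "z1 < z2"
  shows "ennreal (plateau_hat z1 z2 u) = (\<integral>\<^sup>+z. indicator {z1..z2} z * indicator {..z / (1 + z)} u \<partial>lborel)"
proof (cases "u < 1")
  case True
  have "(\<integral>\<^sup>+z. indicator {z1..z2} z * indicator {u / (1 - u)..} z \<partial>lborel) = (\<integral>\<^sup>+z. indicator {z1..z2} z * indicator {..z / (1 + z)} u \<partial>lborel)"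
    using True assms div_one_minus_le_iff[of u] by (intro nn_integral_cong) (auto split: split_indicator)
  then show ?thesis using True assms by (simp add: plateau_hat_def plateau_eq_nn_integral)
next
  case False
  have "z / (1 + z) < 1" if "z1 \<le> z" for z using that assms by (simp add: divide_simps)
  then have "(\<integral>\<^sup>+z. indicator {z1..z2} z * indicator {..z / (1 + z)} u \<partial>lborel) = (\<integral>\<^sup>+(z::real). 0 \<partial>lborel)"
    using False by (intro nn_integral_cong) (force split: split_indicator)
  then show ?thesis using False by (simp add: plateau_hat_def)
qed

context coagulation_limit
begin

lemma Ebar_measurable:
  assumes z: "0 < z1" "z1 < z2"
  shows "Ebar z1 z2 \<in> borel_measurable borel"
  unfolding Ebar_def using plateau_hat_isCont[OF z] plateau_hat_bounds[OF z(2)]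
  by (intro borel_measurable_times borel_measurable_const borel_measurable_continuous_onI
    \<mu>_integral_continuous[where B="z2 - z1"]) auto

text \<open>The limit satisfies the balance law with the dust counted in \<open>cdf (\<mu> t)\<close>, so the dust has to be
  shown to vanish for almost every time.\<close>

lemma no_dust: "AE t in lborel. 0 \<le> t \<and> t \<le> T \<longrightarrow> cdf (\<mu> t) 0 = 0"
proof -
  define D where "D t = cdf (\<mu> t) 0" for t
  have D0: "0 \<le> D t" for t by (simp add: D_def cdf_def)
  have Dm[measurable]: "D \<in> borel_measurable borel"
    unfolding D_def cdf_def by (rule measure_measurable_subprob_algebra2[where N=borel]) auto

  define \<theta> where "\<theta> = (1 - a - b) / 2"
  have \<theta>: "0 < \<theta>" using ab_sum by (simp add: \<theta>_def)
  have \<theta>': "0 < 0 + (1 - a - b) / 2" using ab_sum by simp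
  obtain C where C: "0 \<le> C" "\<And>n \<delta> k1 k2. 1 \<le> n \<Longrightarrow> 0 < \<delta> \<Longrightarrow> \<delta> < real n \<Longrightarrow> k1 \<le> k2 \<Longrightarrow> k2 \<le> N n \<Longrightarrow>
    (\<Sum>j\<in>{k1..<k2}. h n * E n j (\<lambda>x. x powr 0 * of_bool (x \<le> \<delta>)))
      \<le> C * sqrt (h n * real (k2 - k1)) * \<delta> powr (0 + (1 - a - b) / 2)"
    by (rule small_masses[OF \<theta>'], rule that)
  have bound: "(\<integral>\<tau>. indicator {0..<T} \<tau> * Ebar (\<delta> / 2) \<delta> \<tau> \<partial>lborel) \<le> (\<delta> / 2) * (C * sqrt T * \<delta> powr \<theta>)"
    if \<delta>: "0 < \<delta>" for \<delta>
  proof -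
    have z: "0 < \<delta> / 2" "\<delta> / 2 < \<delta>" using \<delta> by auto
    have pl: "plateau (\<delta> / 2) \<delta> x \<le> (\<delta> / 2) * (x powr 0 * of_bool (x \<le> \<delta>))" if "0 < x" for x
    proof (cases "x \<le> \<delta>")
      case True
      then show ?thesis using plateau_le[of "\<delta> / 2" \<delta> x] that by simp
    qed (use \<delta> in \<open>simp add: plateau_def\<close>)
    have "(\<lambda>i. \<Sum>j\<in>{..<idx (s i) T}. h (s i) * E (s i) j (plateau (\<delta> / 2) \<delta>))
      \<longlonglongrightarrow> (\<integral>\<tau>. indicator {0..<T} \<tau> * Ebar (\<delta> / 2) \<delta> \<tau> \<partial>lborel)"
    proof (rule step_limit[where B="M * (\<delta> - \<delta> / 2)"])
      show "\<bar>E (s i) k (plateau (\<delta> / 2) \<delta>)\<bar> \<le> M * (\<delta> - \<delta> / 2)" if "k \<le> N (s i)" for i k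
        using E_plateau_bounds[OF s_ge_1 that z(2)] by simp
      show "Ebar (\<delta> / 2) \<delta> \<in> borel_measurable borel" by (rule Ebar_measurable[OF z])
    qed (use T_pos E_limit[OF _ _ z] in auto)
    then show ?thesis
    proof (rule tendsto_upperbound)
      show "\<forall>\<^sub>F i in sequentially. (\<Sum>j\<in>{..<idx (s i) T}. h (s i) * E (s i) j (plateau (\<delta> / 2) \<delta>))
        \<le> (\<delta> / 2) * (C * sqrt T * \<delta> powr \<theta>)"
        using eventually_gt_at_top[of "nat \<lceil>\<delta>\<rceil>"]
      proof eventually_elim
        case (elim i)
        then have si: "\<delta> < real (s i)" using s_ge[of i] by linarith
        have k: "idx (s i) T \<le> N (s i)" using T_pos by (intro idx_le) auto
        have "(\<Sum>j\<in>{..<idx (s i) T}. h (s i) * E (s i) j (plateau (\<delta> / 2) \<delta>))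
          \<le> (\<Sum>j\<in>{..<idx (s i) T}. h (s i) * E (s i) j (\<lambda>x. (\<delta> / 2) * (x powr 0 * of_bool (x \<le> \<delta>))))"
          using h_pos[of "s i"] s_ge_1 k
          by (intro sum_mono mult_left_mono E_mono pl) (auto simp: grid_pos)
        also have "\<dots> = (\<delta> / 2) * (\<Sum>j\<in>{0..<idx (s i) T}. h (s i) * E (s i) j (\<lambda>x. x powr 0 * of_bool (x \<le> \<delta>)))"
          unfolding E_cmult by (simp add: sum_distrib_left mult_ac atLeast0LessThan)
        also have "\<dots> \<le> (\<delta> / 2) * (C * sqrt (h (s i) * real (idx (s i) T - 0)) * \<delta> powr \<theta>)"
          using C(2)[OF s_ge_1 \<delta> si le0 k] \<delta> by (intro mult_left_mono) (auto simp: \<theta>_def)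
        also have "\<dots> \<le> (\<delta> / 2) * (C * sqrt T * \<delta> powr \<theta>)"
          using h_k_le[OF k] C(1) \<delta> by (intro mult_left_mono mult_right_mono) auto
        finally show ?case .
      qed
    qed simp
  qed
  have le: "M * (\<delta> / 2) * D t \<le> Ebar (\<delta> / 2) \<delta> t" if \<delta>: "0 < \<delta>" for \<delta> t
  proof -
    interpret real_distribution "\<mu> t" by (rule \<mu>_real_distribution)
    have z: "0 < \<delta> / 2" "\<delta> / 2 < \<delta>" using \<delta> by auto
    have "(\<delta> / 2) * D t = (\<integral>u. (\<delta> / 2) * indicator {..0} u \<partial>\<mu> t)" by (simp add: D_def cdf_def)
    also have "\<dots> \<le> (\<integral>u. plateau_hat (\<delta> / 2) \<delta> u \<partial>\<mu> t)"
    proof (rule integral_mono)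
      show "integrable (\<mu> t) (\<lambda>u. (\<delta> / 2) * indicator {..0} u)"
        using \<delta> by (intro integrable_const_bound[where B="\<delta> / 2"]) (auto split: split_indicator)
      show "integrable (\<mu> t) (plateau_hat (\<delta> / 2) \<delta>)"
        using plateau_hat_bounds[OF z(2)] plateau_hat_measurable[OF z]
        by (intro integrable_const_bound[where B="\<delta> - \<delta> / 2"]) auto
      show "(\<delta> / 2) * indicator {..0} u \<le> plateau_hat (\<delta> / 2) \<delta> u" for u
      proof (cases "u \<le> 0")
        case True
        have "0 \<le> \<delta> / 2 / (1 + \<delta> / 2)" using \<delta> by simp
        then have "u \<le> \<delta> / 2 / (1 + \<delta> / 2)" using True by linarith
        then show ?thesis using plateau_hat_eq_max[OF z, of u] True by simp
      qed (use plateau_hat_bounds(1)[OF z(2)] in simp)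
    qed
    finally show ?thesis using M_pos by (simp add: Ebar_def mult.assoc)
  qed
  have intD: "integrable lborel (\<lambda>\<tau>. indicator {0..<T} \<tau> * D \<tau>)"
  proof (rule Bochner_Integration.integrable_bound)
    show "integrable lborel (indicator {0..T} :: real \<Rightarrow> real)"
      by (intro integrable_real_indicator) (auto simp: emeasure_lborel_Icc_eq)
    have "D \<tau> \<le> 1" for \<tau>
    proof -
      interpret real_distribution "\<mu> \<tau>" by (rule \<mu>_real_distribution)
      show ?thesis by (simp add: D_def cdf_def)
    qed
    then show "AE \<tau> in lborel. norm (indicator {0..<T} \<tau> * D \<tau>) \<le> norm (indicator {0..T} \<tau> :: real)"
      using D0 by (auto intro!: AE_I2 split: split_indicator)
  qed measurable
  have small: "(\<integral>\<tau>. indicator {0..<T} \<tau> * D \<tau> \<partial>lborel) \<le> C * sqrt T * \<delta> powr \<theta> / M" if \<delta>: "0 < \<delta>" for \<delta>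
  proof -
    have z: "0 < \<delta> / 2" "\<delta> / 2 < \<delta>" using \<delta> by auto
    note Em = Ebar_measurable[OF z]
    have Eb: "0 \<le> Ebar (\<delta> / 2) \<delta> t \<and> Ebar (\<delta> / 2) \<delta> t \<le> M * (\<delta> - \<delta> / 2)" if "0 \<le> t" "t \<le> T" for t
      by (intro conjI LIMSEQ_le_const[OF E_limit[OF that z]] LIMSEQ_le_const2[OF E_limit[OF that z]]
        exI[of _ 0] allI impI E_plateau_bounds s_ge_1 idx_le that z(2))
    have intE: "integrable lborel (\<lambda>\<tau>. indicator {0..<T} \<tau> * Ebar (\<delta> / 2) \<delta> \<tau>)"
    proof (rule Bochner_Integration.integrable_bound)
      show "integrable lborel (\<lambda>\<tau>. (M * (\<delta> - \<delta> / 2)) * indicator {0..T} \<tau>)"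
        by (intro integrable_mult_right integrable_real_indicator) (auto simp: emeasure_lborel_Icc_eq)
      show "AE \<tau> in lborel. norm (indicator {0..<T} \<tau> * Ebar (\<delta> / 2) \<delta> \<tau>) \<le> norm ((M * (\<delta> - \<delta> / 2)) * indicator {0..T} \<tau>)"
        using Eb by (intro AE_I2) (auto split: split_indicator intro: order_trans[OF _ abs_ge_self])
    qed (use Em in measurable)
    have "M * (\<delta> / 2) * (\<integral>\<tau>. indicator {0..<T} \<tau> * D \<tau> \<partial>lborel) = (\<integral>\<tau>. M * (\<delta> / 2) * (indicator {0..<T} \<tau> * D \<tau>) \<partial>lborel)"
      by simp
    also have "\<dots> \<le> (\<integral>\<tau>. indicator {0..<T} \<tau> * Ebar (\<delta> / 2) \<delta> \<tau> \<partial>lborel)"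
      using le[OF \<delta>] by (intro integral_mono integrable_mult_right intD intE) (auto split: split_indicator)
    also have "\<dots> \<le> (\<delta> / 2) * (C * sqrt T * \<delta> powr \<theta>)" by (rule bound[OF \<delta>])
    finally show ?thesis using \<delta> M_pos by (simp add: field_simps)
  qed
  have "((\<lambda>\<delta>. C * sqrt T * \<delta> powr \<theta> / M) \<longlongrightarrow> C * sqrt T * 0 / M) (at_right 0)"
    using \<theta> by (intro tendsto_intros tendsto_zero_powrI[where b=\<theta>])
      (use M_pos in \<open>auto intro!: eventually_mono[OF eventually_at_right_less]\<close>)
  then have "(\<integral>\<tau>. indicator {0..<T} \<tau> * D \<tau> \<partial>lborel) \<le> C * sqrt T * 0 / M"
    by (rule tendsto_lowerbound)
      (auto intro!: eventually_mono[OF eventually_at_right_less] small)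
  moreover have "0 \<le> (\<integral>\<tau>. indicator {0..<T} \<tau> * D \<tau> \<partial>lborel)" using D0 by simp
  ultimately have "(\<integral>\<tau>. indicator {0..<T} \<tau> * D \<tau> \<partial>lborel) = 0" by simp
  then have "AE \<tau> in lborel. indicator {0..<T} \<tau> * D \<tau> = 0"
    using intD D0 by (subst (asm) integral_nonneg_eq_0_iff_AE) auto
  moreover have "AE \<tau> in lborel. \<tau> \<noteq> T" by (rule AE_lborel_singleton)
  ultimately show ?thesis
    by eventually_elim (auto simp: D_def split: split_indicator_asm)
qed

end

section \<open>The solution\<close>

abbreviation half_line :: "real measure" where "half_line \<equiv> restrict_space borel {0<..}"

lemma measurable_half_line: "f \<in> borel_measurable borel \<Longrightarrow> f \<in> borel_measurable half_line"
  by (rule measurable_restrict_space1)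

lemma id_half_line: "(\<lambda>x. x) \<in> measurable half_line borel"
  by (rule measurable_restrict_space1) simp

lemma sets_half_line_iff: "A \<in> sets half_line \<longleftrightarrow> A \<subseteq> {0<..} \<and> A \<in> sets borel"
  by (auto simp: sets_restrict_space_iff)

definition uncompact :: "real \<Rightarrow> real" where
  "uncompact u = (if 0 < u \<and> u < 1 then u / (1 - u) else 1)"

lemma uncompact_pos: "0 < uncompact u" by (simp add: uncompact_def)

lemma uncompact_measurable[measurable]: "uncompact \<in> measurable borel half_line"
  by (rule measurable_restrict_space2) (auto simp: uncompact_pos, simp add: uncompact_def[abs_def])

lemma uncompact_borel[measurable]: "uncompact \<in> borel_measurable borel"
  unfolding uncompact_def by measurable

lemma hat_isCont_bounded:
  assumes g: "continuous_on {0<..} g" and C: "compact C" "C \<subseteq> {0<..}" and zero: "\<And>x. x \<in> {0<..} - C \<Longrightarrow> g x = 0"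
  shows "\<And>u. isCont (hat g) u" and "\<exists>B. \<forall>u. \<bar>hat g u\<bar> \<le> B"
proof -
  have "compact (g ` C)" using g C by (intro compact_continuous_image continuous_on_subset[OF g])
  then have "bounded (g ` C)" by (rule compact_imp_bounded)
  then obtain B where B: "\<And>y. y \<in> g ` C \<Longrightarrow> norm y \<le> B" unfolding bounded_iff by blast
  have "\<bar>hat g u\<bar> \<le> \<bar>B\<bar>" for u
    using B[of "g (u / (1 - u))"] zero[of "u / (1 - u)"] by (cases "u / (1 - u) \<in> C") (auto simp: hat_def)
  then show "\<exists>B. \<forall>u. \<bar>hat g u\<bar> \<le> B" by blast
  define C' where "C' = (\<lambda>x. x / (1 + x)) ` C"
  have "compact C'" unfolding C'_def
    using C by (intro compact_continuous_image continuous_intros) auto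
  then have open_C': "open (- C')" by (simp add: compact_imp_closed open_Compl)
  have sub: "C' \<subseteq> {0<..<1}" using C by (auto simp: C'_def)
  have "continuous_on {0<..<1} (\<lambda>u. g (u / (1 - u)))"
    by (rule continuous_on_compose2[OF g]) (auto intro!: continuous_intros)
  then have "continuous_on {0<..<1} (hat g)"
    by (rule continuous_on_eq) (auto simp: hat_def)
  moreover have z0: "hat g u = 0" if "u \<in> - C'" for u
  proof (cases "0 < u \<and> u < 1")
    case True
    then have "u / (1 - u) / (1 + u / (1 - u)) = u" by (simp add: field_simps)
    then have "u / (1 - u) \<notin> C" using that unfolding C'_def by force
    then show ?thesis using zero True by (simp add: hat_def)
  qed (auto simp: hat_def)
  have "continuous_on (- C') (\<lambda>_. 0 :: real)" by simp
  then have "continuous_on (- C') (hat g)"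
    by (rule continuous_on_eq) (simp only: z0)
  ultimately have "continuous_on ({0<..<1} \<union> - C') (hat g)"
    using open_C' by (intro continuous_on_open_Un) auto
  moreover have "{0<..<1} \<union> - C' = UNIV" using sub by auto
  ultimately show "isCont (hat g) u" for u by (simp add: continuous_on_eq_continuous_at)
qed

lemma radon_sigma_finite:
  assumes "\<nu> \<in> radon_measures"
  shows "sigma_finite_measure \<nu>"
proof
  have sets: "sets \<nu> = sets half_line" and fin: "\<And>C. compact C \<Longrightarrow> C \<subseteq> {0<..} \<Longrightarrow> emeasure \<nu> C < \<infinity>"
    using assms by (auto simp: radon_measures_def)
  have space: "space \<nu> = {0<..}" using sets_eq_imp_space_eq[OF sets] by (simp add: space_restrict_space)
  define A where "A k = {1 / real (Suc k)..real k + 2}" for k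
  have A: "A k \<subseteq> {0<..}" for k by (auto simp: A_def intro: less_le_trans[rotated])
  have un: "(\<Union>k. A k) = {0<..}"
  proof (intro equalityI subsetI)
    fix z :: real assume z: "z \<in> {0<..}"
    obtain k where k: "max z (1 / z) < real k" using reals_Archimedean2 by blast
    then have "1 / real (Suc k) \<le> z" using z by (simp add: field_simps)
    then show "z \<in> (\<Union>k. A k)" using k by (auto simp: A_def intro!: exI[of _ k])
  qed (use A in auto)
  show "\<exists>A. countable A \<and> A \<subseteq> sets \<nu> \<and> \<Union> A = space \<nu> \<and> (\<forall>a\<in>A. emeasure \<nu> a \<noteq> \<infinity>)"
  proof (intro exI[of _ "range A"] conjI ballI)
    show "range A \<subseteq> sets \<nu>" unfolding sets using A by (auto simp: sets_half_line_iff A_def)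
    fix B assume "B \<in> range A"
    then obtain k where "B = A k" by blast
    then show "emeasure \<nu> B \<noteq> \<infinity>" using fin[of "A k"] A[of k] by (auto simp: A_def)
  qed (use un space in auto)
qed

lemma density_times_x_inverse:
  assumes sets: "sets \<nu> = sets half_line"
  shows "density (times_x \<nu>) (\<lambda>x. ennreal (1 / x)) = \<nu>"
proof -
  have space: "space \<nu> = {0<..}" using sets_eq_imp_space_eq[OF sets] by (simp add: space_restrict_space)
  have m: "f \<in> borel_measurable borel \<Longrightarrow> f \<in> borel_measurable \<nu>" for f :: "real \<Rightarrow> ennreal"
    using measurable_half_line[of f] measurable_cong_sets[OF sets refl] by blast
  have "density (times_x \<nu>) (\<lambda>x. ennreal (1 / x)) = density \<nu> (\<lambda>x. ennreal x * ennreal (1 / x))"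
    unfolding times_x_def by (intro density_density_eq m) auto
  also have "\<dots> = density \<nu> (\<lambda>_. 1)"
  proof (rule density_cong)
    show "AE x in \<nu>. ennreal x * ennreal (1 / x) = 1"
      by (intro AE_I2) (simp add: space ennreal_mult[symmetric])
  qed (auto intro!: m)
  finally show ?thesis by (simp add: density_1)
qed

context coagulation_limit
begin

abbreviation sol_density :: "real \<Rightarrow> ennreal" where
  "sol_density u \<equiv> ennreal (indicator {0<..<1} u * M / uncompact u)"

definition sol :: "real \<Rightarrow> real measure" where
  "sol t = distr (density (\<mu> t) sol_density) half_line uncompact"

lemma sets_sol: "sets (sol t) = sets half_line" by (simp add: sol_def)

lemma space_sol: "space (sol t) = {0<..}"
  by (simp add: sol_def space_restrict_space)

lemma \<mu>_sets: "sets (\<mu> t) = sets borel"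
proof -
  interpret real_distribution "\<mu> t" by (rule \<mu>_real_distribution)
  show ?thesis by simp
qed

lemma measurable_\<mu>: "f \<in> borel_measurable borel \<Longrightarrow> f \<in> borel_measurable (\<mu> t)"
  using measurable_cong_sets[OF \<mu>_sets refl] by blast

lemma nn_integral_sol:
  assumes f: "f \<in> borel_measurable half_line"
  shows "(\<integral>\<^sup>+x. f x \<partial>sol t) = (\<integral>\<^sup>+u. sol_density u * f (uncompact u) \<partial>\<mu> t)"
proof -
  have fb: "(\<lambda>u. f (uncompact u)) \<in> borel_measurable borel"
    by (rule measurable_compose[OF uncompact_measurable f])
  have "(\<integral>\<^sup>+x. f x \<partial>sol t) = (\<integral>\<^sup>+u. f (uncompact u) \<partial>density (\<mu> t) sol_density)"
    unfolding sol_def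
  proof (rule nn_integral_distr)
    show "uncompact \<in> measurable (density (\<mu> t) sol_density) half_line"
      using uncompact_measurable measurable_cong_sets[OF \<mu>_sets refl] by simp
  qed (use f in simp)
  also have "\<dots> = (\<integral>\<^sup>+u. sol_density u * f (uncompact u) \<partial>\<mu> t)"
    using fb by (intro nn_integral_density measurable_\<mu>) auto
  finally show ?thesis .
qed

lemma emeasure_xsol:
  assumes A: "A \<in> sets half_line"
  shows "emeasure (times_x (sol t)) A = (\<integral>\<^sup>+u. ennreal (indicator {0<..<1} u * M) * indicator A (uncompact u) \<partial>\<mu> t)"
proof -
  have "emeasure (times_x (sol t)) A = (\<integral>\<^sup>+x. ennreal x * indicator A x \<partial>sol t)"
    unfolding times_x_def using A id_half_line sets_sol
    by (intro emeasure_density) (auto simp: measurable_cong_sets[OF sets_sol refl])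
  also have "\<dots> = (\<integral>\<^sup>+u. sol_density u * (ennreal (uncompact u) * indicator A (uncompact u)) \<partial>\<mu> t)"
    using A id_half_line by (intro nn_integral_sol) auto
  also have "\<dots> = (\<integral>\<^sup>+u. ennreal (indicator {0<..<1} u * M) * indicator A (uncompact u) \<partial>\<mu> t)"
  proof (intro nn_integral_cong)
    fix u
    have "sol_density u * ennreal (uncompact u) = ennreal (indicator {0<..<1} u * M)"
      using uncompact_pos[of u] M_pos by (simp add: ennreal_mult[symmetric])
    then show "sol_density u * (ennreal (uncompact u) * indicator A (uncompact u))
      = ennreal (indicator {0<..<1} u * M) * indicator A (uncompact u)" by (simp add: mult.assoc[symmetric])
  qed
  finally show ?thesis .
qed

lemma xsol_total: "emeasure (times_x (sol t)) {0<..} \<le> ennreal M"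
proof -
  interpret real_distribution "\<mu> t" by (rule \<mu>_real_distribution)
  have "emeasure (times_x (sol t)) {0<..} = (\<integral>\<^sup>+u. ennreal (indicator {0<..<1} u * M) * indicator {0<..} (uncompact u) \<partial>\<mu> t)"
    by (rule emeasure_xsol) (simp add: sets_half_line_iff)
  also have "\<dots> \<le> (\<integral>\<^sup>+u. ennreal M \<partial>\<mu> t)"
    using M_pos by (intro nn_integral_mono) (auto split: split_indicator)
  also have "\<dots> = ennreal M" using emeasure_space_1 by simp
  finally show ?thesis .
qed

lemma xsol_bounded: "times_x (sol t) \<in> bounded_radon_measures"
proof -
  have sets: "sets (times_x (sol t)) = sets half_line" by (simp add: times_x_def sets_sol)
  have space: "space (times_x (sol t)) = {0<..}" by (simp add: times_x_def space_sol)
  have fin: "emeasure (times_x (sol t)) {0<..} < \<infinity>"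
    using xsol_total[of t] by (simp add: order_le_less_trans)
  moreover have "emeasure (times_x (sol t)) C < \<infinity>" if "C \<subseteq> {0<..}" for C
    using emeasure_mono[OF that, of "times_x (sol t)"] fin sets by (auto simp: sets_half_line_iff intro: order_le_less_trans)
  ultimately show ?thesis by (simp add: bounded_radon_measures_def radon_measures_def sets space)
qed

lemma sol_radon: "sol t \<in> radon_measures"
proof -
  have "emeasure (sol t) C < \<infinity>" if C: "compact C" "C \<subseteq> {0<..}" for C
  proof (cases "C = {}")
    case False
    then obtain l where l: "l \<in> C" "\<And>x. x \<in> C \<Longrightarrow> l \<le> x" using compact_attains_inf[OF C(1)] by blast
    then have l0: "0 < l" using C by auto
    have Cs: "C \<in> sets half_line" using C by (auto simp: sets_half_line_iff compact_imp_closed)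
    have "emeasure (sol t) C = (\<integral>\<^sup>+x. indicator C x \<partial>sol t)" using Cs by (simp add: sets_sol)
    also have "\<dots> = (\<integral>\<^sup>+u. sol_density u * indicator C (uncompact u) \<partial>\<mu> t)"
      using Cs by (intro nn_integral_sol) auto
    also have "\<dots> \<le> (\<integral>\<^sup>+u. ennreal (M / l) \<partial>\<mu> t)"
    proof (intro nn_integral_mono)
      fix u
      show "sol_density u * indicator C (uncompact u) \<le> ennreal (M / l)"
        using l l0 M_pos by (auto split: split_indicator intro!: ennreal_leI divide_left_mono simp: uncompact_pos)
    qed
    also have "\<dots> = ennreal (M / l)"
    proof -
      interpret real_distribution "\<mu> t" by (rule \<mu>_real_distribution)
      show ?thesis using emeasure_space_1 by simp
    qed
    finally show ?thesis by (simp add: order_le_less_trans)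
  qed simp
  then show ?thesis by (simp add: radon_measures_def sets_sol)
qed

lemma test_function_measurable: "\<phi> \<in> test_functions \<Longrightarrow> \<phi> \<in> borel_measurable half_line"
  by (auto simp: test_functions_def intro: borel_measurable_continuous_on_restrict)

lemma integral_sol:
  assumes \<phi>: "\<phi> \<in> borel_measurable half_line"
  shows "(\<integral>x. \<phi> x \<partial>sol t) = (\<integral>u. hat (\<lambda>x. M / x * \<phi> x) u \<partial>\<mu> t)"
proof -
  have fb: "(\<lambda>u. \<phi> (uncompact u)) \<in> borel_measurable borel"
    by (rule measurable_compose[OF uncompact_measurable \<phi>])
  have "(\<integral>x. \<phi> x \<partial>sol t) = (\<integral>u. \<phi> (uncompact u) \<partial>density (\<mu> t) sol_density)"
    unfolding sol_def
  proof (rule integral_distr)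
    show "uncompact \<in> measurable (density (\<mu> t) sol_density) half_line"
      using uncompact_measurable measurable_cong_sets[OF \<mu>_sets refl] by simp
  qed (use \<phi> in simp)
  also have "\<dots> = (\<integral>u. (indicator {0<..<1} u * M / uncompact u) *\<^sub>R \<phi> (uncompact u) \<partial>\<mu> t)"
    using fb uncompact_pos M_pos by (intro integral_density measurable_\<mu>) (auto simp: less_imp_le)
  also have "\<dots> = (\<integral>u. hat (\<lambda>x. M / x * \<phi> x) u \<partial>\<mu> t)"
    by (intro Bochner_Integration.integral_cong) (auto simp: hat_def uncompact_def)
  finally show ?thesis .
qed

lemma sol_weak_star: "sol \<in> weak_star_continuous_maps T radon_measures"
proof -
  have "continuous_on {0..T} (\<lambda>t. \<integral>x. \<phi> x \<partial>sol t)" if \<phi>: "\<phi> \<in> test_functions" for \<phi>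
  proof -
    obtain C where C: "continuous_on {0<..} \<phi>" "compact C" "C \<subseteq> {0<..}" "\<And>x. x \<in> {0<..} - C \<Longrightarrow> \<phi> x = 0"
      using \<phi> by (auto simp: test_functions_def)
    have g: "continuous_on {0<..} (\<lambda>x. M / x * \<phi> x)" using C(1) by (intro continuous_intros) auto
    obtain B where B: "\<And>u. \<bar>hat (\<lambda>x. M / x * \<phi> x) u\<bar> \<le> B"
      using hat_isCont_bounded(2)[OF g C(2,3)] C(4) by auto
    have "continuous_on UNIV (\<lambda>t. \<integral>u. hat (\<lambda>x. M / x * \<phi> x) u \<partial>\<mu> t)"
      using hat_isCont_bounded(1)[OF g C(2,3)] C(4) B by (intro \<mu>_integral_continuous[where B=B]) auto
    then show ?thesis
      unfolding integral_sol[OF test_function_measurable[OF \<phi>]] by (rule continuous_on_subset) simp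
  qed
  then show ?thesis using sol_radon by (simp add: weak_star_continuous_maps_def)
qed

lemma integral_xsol:
  assumes \<phi>: "\<phi> \<in> borel_measurable half_line"
  shows "(\<integral>x. \<phi> x \<partial>times_x (sol t)) = (\<integral>x. x * \<phi> x \<partial>sol t)"
  unfolding times_x_def using \<phi> id_half_line
  by (subst integral_density) (auto simp: measurable_cong_sets[OF sets_sol refl] space_sol intro!: AE_I2)

lemma xsol_weak_star: "(\<lambda>t. times_x (sol t)) \<in> weak_star_continuous_maps T bounded_radon_measures"
proof -
  have "continuous_on {0..T} (\<lambda>t. \<integral>x. \<phi> x \<partial>times_x (sol t))" if \<phi>: "\<phi> \<in> test_functions" for \<phi>
  proof -
    have "(\<lambda>x. x * \<phi> x) \<in> test_functions"
      using \<phi> unfolding test_functions_def by (auto intro!: continuous_intros)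
    then show ?thesis
      using sol_weak_star integral_xsol[OF test_function_measurable[OF \<phi>]]
      by (simp add: weak_star_continuous_maps_def)
  qed
  then show ?thesis using xsol_bounded by (simp add: weak_star_continuous_maps_def)
qed

lemma xsol_interval:
  assumes z: "0 < z"
  shows "measure (times_x (sol t)) {0<..z} = M * (cdf (\<mu> t) (z / (1 + z)) - cdf (\<mu> t) 0)"
proof -
  interpret real_distribution "\<mu> t" by (rule \<mu>_real_distribution)
  have pz: "0 < z / (1 + z)" "z / (1 + z) < 1" using z by auto
  have "emeasure (times_x (sol t)) {0<..z} = (\<integral>\<^sup>+u. ennreal M * indicator {0<..z / (1 + z)} u \<partial>\<mu> t)"
  proof (subst emeasure_xsol)
    show "(\<integral>\<^sup>+u. ennreal (indicator {0<..<1} u * M) * indicator {0<..z} (uncompact u) \<partial>\<mu> t)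
      = (\<integral>\<^sup>+u. ennreal M * indicator {0<..z / (1 + z)} u \<partial>\<mu> t)"
    proof (intro nn_integral_cong)
      fix u
      define p where "p = z / (1 + z)"
      have p: "0 < p" "p < 1" using pz by (auto simp: p_def)
      have "u / (1 - u) \<le> z \<longleftrightarrow> u \<le> p" if "u < 1"
        using div_one_minus_le_iff[OF that, of z] z by (simp add: p_def)
      then show "ennreal (indicator {0<..<1} u * M) * indicator {0<..z} (uncompact u) = ennreal M * indicator {0<..z / (1 + z)} u"
        unfolding p_def[symmetric] using p by (auto simp: uncompact_def split: split_indicator)
    qed
  qed (auto simp: sets_half_line_iff)
  also have "\<dots> = ennreal M * emeasure (\<mu> t) {0<..z / (1 + z)}"
    by (subst nn_integral_cmult_indicator) auto
  also have "\<dots> = ennreal (M * prob {0<..z / (1 + z)})"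
    using M_pos by (simp add: emeasure_eq_measure ennreal_mult)
  finally have "measure (times_x (sol t)) {0<..z} = M * prob {0<..z / (1 + z)}"
    using M_pos by (simp add: measure_def)
  also have "prob {0<..z / (1 + z)} = cdf (\<mu> t) (z / (1 + z)) - cdf (\<mu> t) 0"
    using cdf_diff_eq[of 0 "z / (1 + z)"] pz by simp
  finally show ?thesis .
qed

definition K_ext :: "real \<times> real \<Rightarrow> real" where
  "K_ext p = indicator ({0<..} \<times> {0<..}) p * K (fst p) (snd p)"

lemma K_ext_measurable[measurable]: "K_ext \<in> borel_measurable (borel \<Otimes>\<^sub>M borel)"
proof -
  have "(\<lambda>p. indicator ({0<..} \<times> {0<..}) p *\<^sub>R (\<lambda>(x, y). K x y) p) \<in> borel_measurable borel"
    by (rule borel_measurable_continuous_on_indicator[OF _ K_cont]) (auto intro!: borel_open open_Times)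
  then show ?thesis by (simp add: K_ext_def[abs_def] borel_prod case_prod_beta)
qed

lemma K_ext_nonneg: "0 \<le> K_ext p"
  using K_nonneg by (auto simp: K_ext_def indicator_def)

definition flux_density :: "real \<Rightarrow> real \<Rightarrow> real \<Rightarrow> ennreal" where
  "flux_density z u v = (if uncompact u \<le> z \<and> z - uncompact u < uncompact v
     then ennreal (indicator {0<..<1} u * indicator {0<..<1} v * M\<^sup>2 * K_ext (uncompact u, uncompact v) / uncompact v) else 0)"

lemma flux_density_measurable[measurable]:
  assumes [measurable]: "f \<in> borel_measurable X" "g \<in> borel_measurable X" "k \<in> borel_measurable X"
  shows "(\<lambda>x. flux_density (f x) (g x) (k x)) \<in> borel_measurable X"
  unfolding flux_density_def by measurable

lemma sol_sigma_finite: "sigma_finite_measure (sol t)"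
  by (rule radon_sigma_finite[OF sol_radon])

lemma flux_sol: "flux K (sol t) z = (\<integral>\<^sup>+u. (\<integral>\<^sup>+v. flux_density z u v \<partial>\<mu> t) \<partial>\<mu> t)"
proof -
  interpret S: sigma_finite_measure "sol t" by (rule sol_sigma_finite)
  define F where "F p = (if fst p \<le> z \<and> z - fst p < snd p then ennreal (fst p * K_ext p) else 0)" for p
  have Fm[measurable]: "F \<in> borel_measurable (borel \<Otimes>\<^sub>M borel)" unfolding F_def by measurable
  have id: "(\<lambda>x. x) \<in> measurable (sol t) borel"
    using id_half_line measurable_cong_sets[OF sets_sol refl] by blast
  have pr: "(\<lambda>p. (fst p, snd p)) \<in> measurable (sol t \<Otimes>\<^sub>M sol t) (borel \<Otimes>\<^sub>M borel)"
    by (intro measurable_Pair measurable_compose[OF measurable_fst id] measurable_compose[OF measurable_snd id])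
  have Fs: "F \<in> borel_measurable (sol t \<Otimes>\<^sub>M sol t)"
    using measurable_compose[OF pr Fm] by simp
  have "flux K (sol t) z = (\<integral>\<^sup>+p. F p \<partial>(sol t \<Otimes>\<^sub>M sol t))"
    unfolding flux_def
    by (intro nn_integral_cong)
      (auto simp: F_def Omega_def K_ext_def space_pair_measure space_sol split: split_indicator)
  also have "\<dots> = (\<integral>\<^sup>+x. (\<integral>\<^sup>+y. F (x, y) \<partial>sol t) \<partial>sol t)"
    by (rule S.nn_integral_fst[OF Fs, symmetric])
  also have "\<dots> = (\<integral>\<^sup>+u. sol_density u * (\<integral>\<^sup>+y. F (uncompact u, y) \<partial>sol t) \<partial>\<mu> t)"
  proof (rule nn_integral_sol)
    show "(\<lambda>x. \<integral>\<^sup>+y. F (x, y) \<partial>sol t) \<in> borel_measurable half_line"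
      using S.borel_measurable_nn_integral_fst[OF Fs] measurable_cong_sets[OF sets_sol refl] by blast
  qed
  also have "\<dots> = (\<integral>\<^sup>+u. (\<integral>\<^sup>+v. flux_density z u v \<partial>\<mu> t) \<partial>\<mu> t)"
  proof (rule nn_integral_cong)
    fix u
    have "(\<integral>\<^sup>+y. F (uncompact u, y) \<partial>sol t) = (\<integral>\<^sup>+v. sol_density v * F (uncompact u, uncompact v) \<partial>\<mu> t)"
      by (intro nn_integral_sol measurable_half_line) measurable
    then have "sol_density u * (\<integral>\<^sup>+y. F (uncompact u, y) \<partial>sol t)
      = (\<integral>\<^sup>+v. sol_density u * (sol_density v * F (uncompact u, uncompact v)) \<partial>\<mu> t)"
      by (simp only:) (intro nn_integral_cmult[symmetric] measurable_\<mu>, measurable)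
    also have "\<dots> = (\<integral>\<^sup>+v. flux_density z u v \<partial>\<mu> t)"
    proof (rule nn_integral_cong)
      fix v
      have pos: "0 < uncompact u" "0 < uncompact v" by (simp_all add: uncompact_pos)
      have e: "ennreal p * (ennreal q * ennreal r) = ennreal (p * (q * r))" if "0 \<le> p" "0 \<le> q" "0 \<le> r" for p q r
        using that by (simp add: ennreal_mult)
      have "sol_density u * (sol_density v * ennreal (uncompact u * K_ext (uncompact u, uncompact v)))
        = ennreal ((indicator {0<..<1} u * M / uncompact u) * ((indicator {0<..<1} v * M / uncompact v) * (uncompact u * K_ext (uncompact u, uncompact v))))"
        using pos M_pos K_ext_nonneg by (intro e) auto
      also have "(indicator {0<..<1} u * M / uncompact u) * ((indicator {0<..<1} v * M / uncompact v) * (uncompact u * K_ext (uncompact u, uncompact v)))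
        = indicator {0<..<1} u * indicator {0<..<1} v * M\<^sup>2 * K_ext (uncompact u, uncompact v) / uncompact v"
        using pos by (simp add: power2_eq_square)
      finally show "sol_density u * (sol_density v * F (uncompact u, uncompact v))
        = flux_density z u v" by (simp add: F_def flux_density_def)
    qed
    finally show "sol_density u * (\<integral>\<^sup>+y. F (uncompact u, y) \<partial>sol t)
      = (\<integral>\<^sup>+v. flux_density z u v \<partial>\<mu> t)" .
  qed
  finally show ?thesis .
qed

lemma flux_density_integral:
  assumes z: "0 < z1" "z1 < z2"
  shows "(\<integral>\<^sup>+z. flux_density z u v * indicator {z1..z2} z \<partial>lborel) = ennreal (M\<^sup>2 * jump_hat z1 z2 (u, v))"
proof (cases "0 < u \<and> u < 1 \<and> 0 < v \<and> v < 1")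
  case True
  define x y where "x = u / (1 - u)" and "y = v / (1 - v)"
  have xy: "0 < x" "0 < y" "uncompact u = x" "uncompact v = y" using True by (auto simp: x_def y_def uncompact_def)
  have "flux_density z u v * indicator {z1..z2} z = ennreal (M\<^sup>2 * K x y / y) * (indicator {z1..z2} z * indicator {x..<x + y} z)" for z
    using xy True by (auto simp: flux_density_def K_ext_def split: split_indicator)
  then have "(\<integral>\<^sup>+z. flux_density z u v * indicator {z1..z2} z \<partial>lborel)
    = ennreal (M\<^sup>2 * K x y / y) * ennreal (plateau z1 z2 x - plateau z1 z2 (x + y))"
    unfolding plateau_diff_eq_nn_integral[OF z(2) xy(2)] by (simp add: nn_integral_cmult)
  also have "\<dots> = ennreal (M\<^sup>2 * K x y / y * (plateau z1 z2 x - plateau z1 z2 (x + y)))"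
    using plateau_diff(1)[OF z(2) xy(2)] K_nonneg[OF xy(1,2)] xy by (intro ennreal_mult[symmetric]) auto
  also have "M\<^sup>2 * K x y / y * (plateau z1 z2 x - plateau z1 z2 (x + y)) = M\<^sup>2 * jump_hat z1 z2 (u, v)"
    using True by (simp add: jump_hat_def jump_def x_def y_def)
  finally show ?thesis .
next
  case False
  then have "flux_density z u v = 0" for z by (auto simp: flux_density_def)
  then show ?thesis using False by (auto simp: jump_hat_def)
qed

definition flux_at :: "real \<Rightarrow> real \<Rightarrow> ennreal" where
  "flux_at t z = (\<integral>\<^sup>+u. (\<integral>\<^sup>+v. flux_density z u v \<partial>\<mu> t) \<partial>\<mu> t)"

lemma flux_at_measurable[measurable]: "(\<lambda>(t, z). flux_at t z) \<in> borel_measurable (borel \<Otimes>\<^sub>M borel)"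
proof -
  have inner: "(\<lambda>(q, u). \<integral>\<^sup>+v. flux_density (snd q) u v \<partial>\<mu> (fst q)) \<in> borel_measurable ((borel \<Otimes>\<^sub>M borel) \<Otimes>\<^sub>M borel)"
  proof -
    have "(\<lambda>r. \<integral>\<^sup>+v. flux_density (snd (fst r)) (snd r) v \<partial>\<mu> (fst (fst r)))
      \<in> borel_measurable ((borel \<Otimes>\<^sub>M borel) \<Otimes>\<^sub>M borel)"
      by (rule nn_integral_measurable_subprob_algebra2[where N=borel]) measurable
    then show ?thesis by (simp add: case_prod_beta)
  qed
  have "(\<lambda>q. \<integral>\<^sup>+u. (\<integral>\<^sup>+v. flux_density (snd q) u v \<partial>\<mu> (fst q)) \<partial>\<mu> (fst q)) \<in> borel_measurable (borel \<Otimes>\<^sub>M borel)"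
    by (rule nn_integral_measurable_subprob_algebra2[OF inner]) measurable
  then show ?thesis by (simp add: flux_at_def case_prod_beta)
qed

lemma flux_at_measurable'[measurable (raw)]:
  "f \<in> borel_measurable X \<Longrightarrow> g \<in> borel_measurable X \<Longrightarrow> (\<lambda>x. flux_at (f x) (g x)) \<in> borel_measurable X"
  using measurable_compose[OF measurable_Pair flux_at_measurable, of f X g] by simp

definition total_flux :: "real \<Rightarrow> real \<Rightarrow> ennreal" where
  "total_flux t z = (\<integral>\<^sup>+\<tau>. flux_at \<tau> z * indicator {0..t} \<tau> \<partial>lborel)"

lemma integrated_flux_sol: "integrated_flux K sol t z = total_flux t z"
  by (simp add: integrated_flux_def total_flux_def flux_sol flux_at_def)

lemma total_flux_measurable: "(\<lambda>(t, z). total_flux t z) \<in> borel_measurable (borel \<Otimes>\<^sub>M borel)"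
proof -
  have "(\<lambda>q. \<integral>\<^sup>+\<tau>. flux_at \<tau> (snd q) * (if 0 \<le> \<tau> \<and> \<tau> \<le> fst q then 1 else 0) \<partial>lborel) \<in> borel_measurable (borel \<Otimes>\<^sub>M borel)"
    by measurable
  then show ?thesis
    unfolding total_flux_def by (simp add: case_prod_beta indicator_def of_bool_def cong: if_cong)
qed

lemma total_flux_measurable'[measurable (raw)]:
  "f \<in> borel_measurable X \<Longrightarrow> g \<in> borel_measurable X \<Longrightarrow> (\<lambda>x. total_flux (f x) (g x)) \<in> borel_measurable X"
  using measurable_compose[OF measurable_Pair total_flux_measurable, of f X g] by simp

lemma flux_at_integral:
  assumes z: "0 < z1" "z1 < z2"
  shows "(\<integral>\<^sup>+z. flux_at t z * indicator {z1..z2} z \<partial>lborel) = (\<integral>\<^sup>+u. (\<integral>\<^sup>+v. ennreal (M\<^sup>2 * jump_hat z1 z2 (u, v)) \<partial>\<mu> t) \<partial>\<mu> t)"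
proof -
  interpret real_distribution "\<mu> t" by (rule \<mu>_real_distribution)
  interpret P: pair_sigma_finite lborel "\<mu> t" by unfold_locales
  have "(\<integral>\<^sup>+z. flux_at t z * indicator {z1..z2} z \<partial>lborel)
    = (\<integral>\<^sup>+z. (\<integral>\<^sup>+u. (\<integral>\<^sup>+v. flux_density z u v * indicator {z1..z2} z \<partial>\<mu> t) \<partial>\<mu> t) \<partial>lborel)"
    unfolding flux_at_def by (simp add: nn_integral_multc)
  also have "\<dots> = (\<integral>\<^sup>+u. (\<integral>\<^sup>+z. (\<integral>\<^sup>+v. flux_density z u v * indicator {z1..z2} z \<partial>\<mu> t) \<partial>lborel) \<partial>\<mu> t)"
    by (rule P.Fubini'[symmetric]) measurable
  also have "\<dots> = (\<integral>\<^sup>+u. (\<integral>\<^sup>+v. (\<integral>\<^sup>+z. flux_density z u v * indicator {z1..z2} z \<partial>lborel) \<partial>\<mu> t) \<partial>\<mu> t)"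
    by (intro nn_integral_cong P.Fubini'[symmetric]) measurable
  finally show ?thesis by (simp only: flux_density_integral[OF z])
qed

lemma total_flux_integral:
  assumes t: "0 \<le> t" "t \<le> T" and z: "0 < z1" "z1 < z2"
  shows "(\<integral>\<^sup>+z. total_flux t z * indicator {z1..z2} z \<partial>lborel) = ennreal (Ebar z1 z2 0 + t * (z2 - z1) - Ebar z1 z2 t)"
proof -
  have "(\<integral>\<^sup>+z. total_flux t z * indicator {z1..z2} z \<partial>lborel)
    = (\<integral>\<^sup>+z. (\<integral>\<^sup>+\<tau>. flux_at \<tau> z * indicator {0..t} \<tau> * indicator {z1..z2} z \<partial>lborel) \<partial>lborel)"
    unfolding total_flux_def by (simp add: nn_integral_multc)
  also have "\<dots> = (\<integral>\<^sup>+\<tau>. (\<integral>\<^sup>+z. flux_at \<tau> z * indicator {0..t} \<tau> * indicator {z1..z2} z \<partial>lborel) \<partial>lborel)"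
    by (rule lborel_pair.Fubini'[symmetric]) measurable
  also have "\<dots> = (\<integral>\<^sup>+\<tau>. indicator {0..t} \<tau> * (\<integral>\<^sup>+z. flux_at \<tau> z * indicator {z1..z2} z \<partial>lborel) \<partial>lborel)"
    by (intro nn_integral_cong) (simp add: nn_integral_cmult[symmetric] mult_ac)
  also have "\<dots> = (\<integral>\<^sup>+\<tau>. indicator {0..<t} \<tau> * (\<integral>\<^sup>+z. flux_at \<tau> z * indicator {z1..z2} z \<partial>lborel) \<partial>lborel)"
    using AE_lborel_singleton[of t]
    by (intro nn_integral_cong_AE) (auto elim!: eventually_mono split: split_indicator)
  also have "\<dots> = ennreal (Ebar z1 z2 0 + t * (z2 - z1) - Ebar z1 z2 t)"
    by (simp only: flux_at_integral[OF z] limit_identity(1)[OF t z])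
  finally show ?thesis .
qed

text \<open>Mass in \<open>[0, z]\<close>, dust included.\<close>

definition cumulative :: "real \<Rightarrow> real \<Rightarrow> real" where "cumulative t z = M * cdf (\<mu> t) (z / (1 + z))"

lemma cumulative_nonneg: "0 \<le> cumulative t z"
  using M_pos by (simp add: cumulative_def cdf_def)

lemma cumulative_measurable[measurable (raw)]:
  assumes [measurable]: "f \<in> borel_measurable X" "g \<in> borel_measurable X"
  shows "(\<lambda>x. cumulative (f x) (g x)) \<in> borel_measurable X"
proof -
  have "{q \<in> space ((borel \<Otimes>\<^sub>M borel) \<Otimes>\<^sub>M borel). snd q \<le> snd (fst q) / (1 + snd (fst q))} \<in> sets ((borel \<Otimes>\<^sub>M borel) \<Otimes>\<^sub>M (borel :: real measure))"
    by measurable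
  also have "{q \<in> space ((borel \<Otimes>\<^sub>M borel) \<Otimes>\<^sub>M borel). snd q \<le> snd (fst q) / (1 + snd (fst q))}
    = (SIGMA p:space (borel \<Otimes>\<^sub>M borel). {..snd p / (1 + snd p)})"
    by (auto simp: space_pair_measure)
  finally have "(\<lambda>p. measure (\<mu> (fst p)) {..snd p / (1 + snd p)}) \<in> borel_measurable (borel \<Otimes>\<^sub>M borel)"
    by (rule measure_measurable_subprob_algebra2) measurable
  from measurable_compose[OF measurable_Pair this, of f X g]
  show ?thesis by (simp add: cumulative_def cdf_def)
qed

lemma cumulative_integral:
  assumes z: "0 < z1" "z1 < z2"
  shows "(\<integral>\<^sup>+z. ennreal (cumulative t z) * indicator {z1..z2} z \<partial>lborel) = ennreal (Ebar z1 z2 t)"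
proof -
  interpret real_distribution "\<mu> t" by (rule \<mu>_real_distribution)
  interpret P: pair_sigma_finite lborel "\<mu> t" by unfold_locales
  have int: "integrable (\<mu> t) (plateau_hat z1 z2)"
    using plateau_hat_bounds[OF z(2)] plateau_hat_measurable[OF z]
    by (intro integrable_const_bound[where B="z2 - z1"]) auto
  have inner: "(\<integral>\<^sup>+u. indicator {z1..z2} z * (if u \<le> z / (1 + z) then 1 else 0) \<partial>\<mu> t) = indicator {z1..z2} z * ennreal (cdf (\<mu> t) (z / (1 + z)))" for z
  proof -
    have "(\<integral>\<^sup>+u. (if u \<le> z / (1 + z) then 1 else 0) \<partial>\<mu> t) = (\<integral>\<^sup>+u. indicator {..z / (1 + z)} u \<partial>\<mu> t)"
      by (intro nn_integral_cong) auto
    then show ?thesis by (simp add: nn_integral_cmult cdf_def emeasure_eq_measure)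
  qed
  have "ennreal (Ebar z1 z2 t) = ennreal M * (\<integral>\<^sup>+u. ennreal (plateau_hat z1 z2 u) \<partial>\<mu> t)"
    using M_pos int plateau_hat_bounds(1)[OF z(2)] by (simp add: Ebar_def nn_integral_eq_integral ennreal_mult)
  also have "\<dots> = ennreal M * (\<integral>\<^sup>+u. (\<integral>\<^sup>+z. indicator {z1..z2} z * (if u \<le> z / (1 + z) then 1 else 0) \<partial>lborel) \<partial>\<mu> t)"
    unfolding plateau_hat_eq_nn_integral[OF z] by (simp add: indicator_def of_bool_def)
  also have "\<dots> = ennreal M * (\<integral>\<^sup>+z. (\<integral>\<^sup>+u. indicator {z1..z2} z * (if u \<le> z / (1 + z) then 1 else 0) \<partial>\<mu> t) \<partial>lborel)"
    by (subst P.Fubini') (simp, simp)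
  also have "\<dots> = ennreal M * (\<integral>\<^sup>+z. indicator {z1..z2} z * ennreal (cdf (\<mu> t) (z / (1 + z))) \<partial>lborel)"
    by (simp only: inner)
  also have "\<dots> = (\<integral>\<^sup>+z. ennreal M * (indicator {z1..z2} z * ennreal (cdf (\<mu> t) (z / (1 + z)))) \<partial>lborel)"
  proof (rule nn_integral_cmult[symmetric])
    have "(\<lambda>z. inverse M * cumulative t z) \<in> borel_measurable borel" by measurable
    moreover have "inverse M * cumulative t z = cdf (\<mu> t) (z / (1 + z))" for z using M_pos by (simp add: cumulative_def)
    ultimately have [measurable]: "(\<lambda>z. cdf (\<mu> t) (z / (1 + z))) \<in> borel_measurable borel" by simp
    show "(\<lambda>z. indicator {z1..z2} z * ennreal (cdf (\<mu> t) (z / (1 + z)))) \<in> borel_measurable lborel" by measurable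
  qed
  also have "\<dots> = (\<integral>\<^sup>+z. ennreal (cumulative t z) * indicator {z1..z2} z \<partial>lborel)"
    using M_pos by (intro nn_integral_cong) (simp add: cumulative_def ennreal_mult cdf_def mult_ac)
  finally show ?thesis by simp
qed

lemma Ebar_nonneg: "z1 < z2 \<Longrightarrow> 0 \<le> Ebar z1 z2 t"
  using M_pos plateau_hat_bounds(1) by (simp add: Ebar_def)

lemma AE_balance:
  assumes t: "0 \<le> t" "t \<le> T"
  shows "AE z in lborel. 0 < z \<longrightarrow> total_flux t z + ennreal (cumulative t z) = ennreal (cumulative 0 z + t)"
proof (rule AE_eq_of_interval_integrals)
  have r: "(\<integral>\<^sup>+z. ennreal (cumulative 0 z + t) * indicator {z1..z2} z \<partial>lborel) = ennreal (Ebar z1 z2 0 + t * (z2 - z1))"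
    if z: "0 < z1" "z1 < z2" for z1 z2
  proof -
    have "(\<integral>\<^sup>+z. ennreal (cumulative 0 z + t) * indicator {z1..z2} z \<partial>lborel)
      = (\<integral>\<^sup>+z. ennreal (cumulative 0 z) * indicator {z1..z2} z + ennreal t * indicator {z1..z2} z \<partial>lborel)"
      using t cumulative_nonneg by (intro nn_integral_cong) (simp add: distrib_right)
    also have "\<dots> = (\<integral>\<^sup>+z. ennreal (cumulative 0 z) * indicator {z1..z2} z \<partial>lborel) + (\<integral>\<^sup>+z. ennreal t * indicator {z1..z2} z \<partial>lborel)"
      by (intro nn_integral_add) measurable
    also have "\<dots> = ennreal (Ebar z1 z2 0) + ennreal t * ennreal (z2 - z1)"
      using z by (simp add: cumulative_integral nn_integral_cmult_indicator)
    also have "\<dots> = ennreal (Ebar z1 z2 0 + t * (z2 - z1))"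
      using z t Ebar_nonneg[OF z(2)] by (simp add: ennreal_mult)
    finally show ?thesis .
  qed
  fix z1 z2 :: real assume z: "0 < z1" "z1 < z2"
  have "(\<integral>\<^sup>+z. (total_flux t z + ennreal (cumulative t z)) * indicator {z1..z2} z \<partial>lborel)
    = (\<integral>\<^sup>+z. total_flux t z * indicator {z1..z2} z + ennreal (cumulative t z) * indicator {z1..z2} z \<partial>lborel)"
    by (simp add: distrib_right)
  also have "\<dots> = (\<integral>\<^sup>+z. total_flux t z * indicator {z1..z2} z \<partial>lborel) + (\<integral>\<^sup>+z. ennreal (cumulative t z) * indicator {z1..z2} z \<partial>lborel)"
    by (intro nn_integral_add) measurable
  also have "\<dots> = ennreal (Ebar z1 z2 0 + t * (z2 - z1))"
    using limit_identity(2)[OF t z] Ebar_nonneg[OF z(2)]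
    by (simp add: total_flux_integral[OF t z] cumulative_integral[OF z] ennreal_plus[symmetric] del: ennreal_plus)
  finally show "(\<integral>\<^sup>+z. (total_flux t z + ennreal (cumulative t z)) * indicator {z1..z2} z \<partial>lborel)
      = (\<integral>\<^sup>+z. ennreal (cumulative 0 z + t) * indicator {z1..z2} z \<partial>lborel)" by (simp add: r[OF z])
  show "(\<integral>\<^sup>+z. ennreal (cumulative 0 z + t) * indicator {z1..z2} z \<partial>lborel) < \<infinity>" by (simp add: r[OF z])
qed measurable

lemma cumulative_right_limit: "(\<lambda>k. cumulative t (z + 1 / real (Suc k))) \<longlonglongrightarrow> cumulative t z" if z: "0 \<le> z"
proof -
  interpret real_distribution "\<mu> t" by (rule \<mu>_real_distribution)
  have "(\<lambda>k. (z + 1 / real (Suc k)) / (1 + (z + 1 / real (Suc k)))) \<longlonglongrightarrow> z / (1 + z)"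
    using z by (intro tendsto_intros LIMSEQ_add_inverse_Suc) auto
  moreover have "z / (1 + z) < (z + 1 / real (Suc k)) / (1 + (z + 1 / real (Suc k)))" for k
  proof -
    have less: "z / (1 + z) < w / (1 + w)" if "z < w" for w
    proof -
      have "w / (1 + w) - z / (1 + z) = (w - z) / ((1 + w) * (1 + z))" using z that by (simp add: field_simps)
      moreover have "0 < (w - z) / ((1 + w) * (1 + z))" using z that by simp
      ultimately show ?thesis by linarith
    qed
    show ?thesis by (rule less) simp
  qed
  ultimately have "(\<lambda>k. cdf (\<mu> t) ((z + 1 / real (Suc k)) / (1 + (z + 1 / real (Suc k))))) \<longlonglongrightarrow> cdf (\<mu> t) (z / (1 + z))"
    by (rule cdf_right_sequence)
  then show ?thesis unfolding cumulative_def by (intro tendsto_intros)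
qed

definition cumulative0 :: "real \<Rightarrow> real" where "cumulative0 z = measure m0 {0<..z}"

lemma finite_borel_distr:
  assumes "finite_measure \<nu>" "sets \<nu> = sets half_line"
  shows "finite_borel_measure (distr \<nu> borel (\<lambda>x. x))"
    and "cdf (distr \<nu> borel (\<lambda>x. x)) z = measure \<nu> {0<..z}"
    and "A \<in> sets half_line \<Longrightarrow> emeasure (distr \<nu> borel (\<lambda>x. x)) A = emeasure \<nu> A"
proof -
  have m: "(\<lambda>x. x) \<in> measurable \<nu> borel"
    using id_half_line measurable_cong_sets[OF assms(2) refl] by blast
  have space: "space \<nu> = {0<..}"
    using sets_eq_imp_space_eq[OF assms(2)] by (simp add: space_restrict_space)
  interpret finite_measure \<nu> by fact
  show "finite_borel_measure (distr \<nu> borel (\<lambda>x. x))"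
    using finite_measure_distr[OF m] by (simp add: finite_borel_measure_def finite_borel_measure_axioms_def)
  have "{..z} \<inter> {0<..} = {0<..z}" by auto
  then show "cdf (distr \<nu> borel (\<lambda>x. x)) z = measure \<nu> {0<..z}"
    unfolding cdf_def by (subst measure_distr[OF m]) (auto simp: space)
  show "emeasure (distr \<nu> borel (\<lambda>x. x)) A = emeasure \<nu> A" if "A \<in> sets half_line"
  proof -
    have "A \<subseteq> {0<..}" "A \<in> sets borel" using that by (auto simp: sets_half_line_iff)
    then show ?thesis by (subst emeasure_distr[OF m]) (auto simp: space Int_absorb2)
  qed
qed

lemma cumulative0_right_limit: "(\<lambda>k. cumulative0 (z + 1 / real (Suc k))) \<longlonglongrightarrow> cumulative0 z"
proof -
  interpret finite_borel_measure "distr m0 borel (\<lambda>x. x)"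
    by (rule finite_borel_distr(1)[OF finite_m0 sets_m0])
  have "(\<lambda>k. cdf (distr m0 borel (\<lambda>x. x)) (z + 1 / real (Suc k))) \<longlonglongrightarrow> cdf (distr m0 borel (\<lambda>x. x)) z"
    by (rule cdf_right_sequence[OF LIMSEQ_add_inverse_Suc]) simp
  then show ?thesis by (simp add: cumulative0_def finite_borel_distr(2)[OF finite_m0 sets_m0])
qed

lemma cumulative_compare:
  assumes z: "0 < z1" "z1 < z2"
  shows "cumulative 0 z1 \<le> cumulative0 z2" "cumulative0 z1 \<le> cumulative 0 z2"
proof -
  interpret m0: finite_measure m0 by (rule finite_m0)
  define p q where "p = z1 / (1 + z1)" and "q = z2 / (1 + z2)"
  have pq: "0 < p" "p < q" "q < 1" "p / (1 - p) = z1" "q / (1 - q) = z2"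
    using z by (auto simp: p_def q_def field_simps)
  have E0: "M * (\<integral>u. plateau_hat z1 z2 u \<partial>\<mu> 0) = (\<integral>u. plateau z1 z2 u \<partial>m0)"
    using Ebar_0[OF z] by (simp add: Ebar_def)
  have sets: "{0<..x} \<in> sets m0" for x by (auto simp: sets_m0 sets_half_line_iff)
  have int: "integrable m0 (plateau z1 z2)"
    using z by (intro m0.integrable_const_bound[where B="z2 - z1"]) (auto simp: plateau_def intro: measurable_m0)
  have ind: "integrable m0 (\<lambda>u. (z2 - z1) * indicator {0<..x} u)" for x
    using sets[of x] m0.emeasure_finite[of "{0<..x}"]
    by (intro integrable_mult_right integrable_real_indicator) (auto simp: less_top[symmetric])
  have eq: "(\<integral>u. (z2 - z1) * indicator {0<..x} u \<partial>m0) = (z2 - z1) * cumulative0 x" for x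
  proof -
    have "{0<..x} \<inter> {0<..} = {0<..x}" by auto
    then show ?thesis by (simp add: cumulative0_def space_m0)
  qed
  have lo: "(z2 - z1) * cumulative0 z1 \<le> (\<integral>u. plateau z1 z2 u \<partial>m0)"
    unfolding eq[symmetric] using z by (intro integral_mono ind int) (auto simp: plateau_def split: split_indicator)
  have hi: "(\<integral>u. plateau z1 z2 u \<partial>m0) \<le> (z2 - z1) * cumulative0 z2"
    unfolding eq[symmetric] using z by (intro integral_mono ind int) (auto simp: plateau_def space_m0 split: split_indicator)
  note c = plateau_hat_cdf(3,4)[OF \<mu>_real_distribution[of 0] pq(1-3), unfolded pq(4,5)]
  have "(z2 - z1) * cumulative 0 z1 \<le> M * (\<integral>u. plateau_hat z1 z2 u \<partial>\<mu> 0)"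
  proof -
    have "(z2 - z1) * cdf (\<mu> 0) p \<le> (\<integral>u. plateau_hat z1 z2 u \<partial>\<mu> 0)"
      using c(1) z by (simp add: pos_le_divide_eq mult.commute)
    from mult_left_mono[OF this, of M] M_pos show ?thesis by (simp add: cumulative_def p_def mult_ac)
  qed
  then have "(z2 - z1) * cumulative 0 z1 \<le> (z2 - z1) * cumulative0 z2" using hi E0 by linarith
  then show "cumulative 0 z1 \<le> cumulative0 z2" using z by simp
  have "M * (\<integral>u. plateau_hat z1 z2 u \<partial>\<mu> 0) \<le> (z2 - z1) * cumulative 0 z2"
  proof -
    have "(\<integral>u. plateau_hat z1 z2 u \<partial>\<mu> 0) \<le> (z2 - z1) * cdf (\<mu> 0) q"
      using c(2) z by (simp add: pos_divide_le_eq mult.commute)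
    from mult_left_mono[OF this, of M] M_pos show ?thesis by (simp add: cumulative_def q_def mult_ac)
  qed
  then have "(z2 - z1) * cumulative0 z1 \<le> (z2 - z1) * cumulative 0 z2" using lo E0 by linarith
  then show "cumulative0 z1 \<le> cumulative 0 z2" using z by simp
qed

lemma cumulative_0_eq: "0 < z \<Longrightarrow> cumulative 0 z = cumulative0 z"
proof (rule antisym)
  assume z: "0 < z"
  show "cumulative 0 z \<le> cumulative0 z"
    using cumulative_compare(1)[OF z] by (intro LIMSEQ_le_const[OF cumulative0_right_limit]) auto
  show "cumulative0 z \<le> cumulative 0 z"
    using cumulative_compare(2)[OF z] z by (intro LIMSEQ_le_const[OF cumulative_right_limit]) auto
qed

lemma dust_0: "cdf (\<mu> 0) 0 = 0"
proof -
  have "(\<lambda>k. cumulative0 (0 + 1 / real (Suc k))) \<longlonglongrightarrow> cumulative0 0" by (rule cumulative0_right_limit)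
  moreover have "(\<lambda>k. cumulative 0 (0 + 1 / real (Suc k))) \<longlonglongrightarrow> cumulative 0 0" by (rule cumulative_right_limit) simp
  moreover have "cumulative 0 (0 + 1 / real (Suc k)) = cumulative0 (0 + 1 / real (Suc k))" for k by (rule cumulative_0_eq) simp
  ultimately have "cumulative 0 0 = cumulative0 0" by (simp add: LIMSEQ_unique)
  then show ?thesis using M_pos by (simp add: cumulative_def cumulative0_def)
qed

lemma xsol_finite: "finite_measure (times_x (sol t))"
  using xsol_bounded[of t] by (intro finite_measureI) (auto simp: bounded_radon_measures_def)

lemma sets_xsol: "sets (times_x (sol t)) = sets half_line"
  by (simp add: times_x_def sets_sol)

lemma sol_0: "sol 0 = f0"
proof -
  have "measure (times_x (sol 0)) {0<..z} = measure m0 {0<..z}" for z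
  proof (cases "0 < z")
    case True
    then show ?thesis using xsol_interval[OF True, of 0] cumulative_0_eq[OF True] dust_0 by (simp add: cumulative_def cumulative0_def)
  qed simp
  then have "cdf (distr (times_x (sol 0)) borel (\<lambda>x. x)) = cdf (distr m0 borel (\<lambda>x. x))"
    by (auto simp: finite_borel_distr(2)[OF xsol_finite sets_xsol] finite_borel_distr(2)[OF finite_m0 sets_m0])
  then have eq: "distr (times_x (sol 0)) borel (\<lambda>x. x) = distr m0 borel (\<lambda>x. x)"
    by (intro cdf_unique' finite_borel_distr(1) xsol_finite sets_xsol finite_m0 sets_m0)
  have "times_x (sol 0) = m0"
  proof (rule measure_eqI)
    fix A assume "A \<in> sets (times_x (sol 0))"
    then have A: "A \<in> sets half_line" by (simp add: sets_xsol)
    show "emeasure (times_x (sol 0)) A = emeasure m0 A"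
      using finite_borel_distr(3)[OF xsol_finite sets_xsol A, of 0] finite_borel_distr(3)[OF finite_m0 sets_m0 A]
      by (simp add: eq)
  qed (simp add: sets_xsol sets_m0)
  moreover have "sets f0 = sets half_line" using f0_radon by (simp add: radon_measures_def)
  ultimately show ?thesis
    using density_times_x_inverse[OF sets_sol, of 0] density_times_x_inverse[of f0] by simp
qed

lemma integral_x_sol:
  assumes z: "0 < z" and d: "cdf (\<mu> t) 0 = 0"
  shows "(LINT x:{0<..z}|sol t. x) = cumulative t z"
proof -
  have "(LINT x:{0<..z}|sol t. x) = (\<integral>x. indicator {0<..z} x \<partial>times_x (sol t))"
  proof -
    have "indicator {0<..z} \<in> borel_measurable half_line"
      by (intro borel_measurable_indicator) (auto simp: sets_half_line_iff)
    from integral_xsol[OF this, of t] show ?thesis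
      by (simp only: set_lebesgue_integral_def real_scaleR_def mult.commute)
  qed
  also have "\<dots> = measure (times_x (sol t)) {0<..z}"
  proof -
    have "{0<..z} \<inter> {0<..} = {0<..z}" by auto
    then show ?thesis by (simp add: times_x_def space_sol)
  qed
  finally show ?thesis using xsol_interval[OF z, of t] d by (simp add: cumulative_def)
qed

lemma sol_weak_flux: "weak_flux_solution K T f0 sol"
  unfolding weak_flux_solution_def
proof (intro conjI ballI)
  show "sol \<in> weak_star_continuous_maps T radon_measures" by (rule sol_weak_star)
  show "(\<lambda>t. times_x (sol t)) \<in> weak_star_continuous_maps T bounded_radon_measures" by (rule xsol_weak_star)
  show "sol 0 = f0" by (rule sol_0)
  fix t assume "t \<in> {0..T}"
  then have "0 \<le> t" "t \<le> T" by auto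
  from AE_balance[OF this]
  show "AE z in lborel. z \<in> {0<..} \<longrightarrow> integrated_flux K sol t z < \<infinity>"
  proof eventually_elim
    case (elim z)
    show ?case
    proof
      assume "z \<in> {0<..}"
      have "total_flux t z \<le> total_flux t z + ennreal (cumulative t z)" by simp
      also have "\<dots> = ennreal (cumulative 0 z + t)" using elim \<open>z \<in> {0<..}\<close> by simp
      also have "\<dots> < \<infinity>" by simp
      finally show "integrated_flux K sol t z < \<infinity>" by (simp add: integrated_flux_sol)
    qed
  qed
next
  have bal: "AE p in lborel \<Otimes>\<^sub>M lborel. 0 \<le> fst p \<longrightarrow> fst p \<le> T \<longrightarrow> 0 < snd p \<longrightarrow>
     total_flux (fst p) (snd p) + ennreal (cumulative (fst p) (snd p)) = ennreal (cumulative 0 (snd p) + fst p)"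
  proof (rule lborel_pair.AE_pair_measure)
    show "{p \<in> space (lborel \<Otimes>\<^sub>M lborel). 0 \<le> fst p \<longrightarrow> fst p \<le> T \<longrightarrow> 0 < snd p \<longrightarrow>
     total_flux (fst p) (snd p) + ennreal (cumulative (fst p) (snd p)) = ennreal (cumulative 0 (snd p) + fst p)} \<in> sets (lborel \<Otimes>\<^sub>M lborel)"
      by measurable
    show "AE t in lborel. AE z in lborel. 0 \<le> fst (t, z) \<longrightarrow> fst (t, z) \<le> T \<longrightarrow> 0 < snd (t, z) \<longrightarrow>
     total_flux (fst (t, z)) (snd (t, z)) + ennreal (cumulative (fst (t, z)) (snd (t, z))) = ennreal (cumulative 0 (snd (t, z)) + fst (t, z))"
    proof (rule AE_I2)
      fix t :: real
      show "AE z in lborel. 0 \<le> fst (t, z) \<longrightarrow> fst (t, z) \<le> T \<longrightarrow> 0 < snd (t, z) \<longrightarrow>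
     total_flux (fst (t, z)) (snd (t, z)) + ennreal (cumulative (fst (t, z)) (snd (t, z))) = ennreal (cumulative 0 (snd (t, z)) + fst (t, z))"
      proof (cases "0 \<le> t \<and> t \<le> T")
        case True
        then show ?thesis using AE_balance[of t] by (auto elim!: eventually_mono)
      qed auto
    qed
  qed
  have dust: "AE p in lborel \<Otimes>\<^sub>M (lborel :: real measure). 0 \<le> fst p \<and> fst p \<le> T \<longrightarrow> cumulative (fst p) 0 = 0"
  proof (rule lborel_pair.AE_pair_measure)
    show "{p \<in> space (lborel \<Otimes>\<^sub>M lborel). 0 \<le> fst p \<and> fst p \<le> T \<longrightarrow> cumulative (fst p) 0 = 0} \<in> sets (lborel \<Otimes>\<^sub>M (lborel :: real measure))"
      by measurable
    show "AE t in lborel. AE z in (lborel :: real measure). 0 \<le> fst (t, z) \<and> fst (t, z) \<le> T \<longrightarrow> cumulative (fst (t, z)) 0 = 0"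
      using no_dust by eventually_elim (simp add: cumulative_def)
  qed
  have "AE p in lborel \<Otimes>\<^sub>M lborel. fst p \<in> {0..T} \<longrightarrow> snd p \<in> {0<..} \<longrightarrow>
     (LINT x:{0<..snd p}|sol (fst p). x) - (LINT x:{0<..snd p}|f0. x)
          = - enn2real (integrated_flux K sol (fst p) (snd p)) + fst p"
    using bal dust
  proof eventually_elim
    case (elim p)
    show ?case
    proof (intro impI)
      assume p: "fst p \<in> {0..T}" "snd p \<in> {0<..}"
      define t z where "t = fst p" and "z = snd p"
      have tz: "0 \<le> t" "t \<le> T" "0 < z" using p by (auto simp: t_def z_def)
      have b: "total_flux t z + ennreal (cumulative t z) = ennreal (cumulative 0 z + t)"
        using elim(1) tz by (simp add: t_def z_def)
      have d: "cdf (\<mu> t) 0 = 0" using elim(2) tz M_pos by (simp add: t_def cumulative_def)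
      have "total_flux t z \<noteq> \<infinity>" using b by auto
      then obtain r where r: "0 \<le> r" "total_flux t z = ennreal r" by (cases "total_flux t z") auto
      have "ennreal (r + cumulative t z) = ennreal (cumulative 0 z + t)" using b r cumulative_nonneg by simp
      then have "r + cumulative t z = cumulative 0 z + t"
        using r(1) tz cumulative_nonneg[of t z] cumulative_nonneg[of 0 z] by (subst (asm) ennreal_inj) auto
      moreover have "(LINT x:{0<..z}|f0. x) = cumulative 0 z"
        using integral_x_sol[OF tz(3) dust_0] by (simp add: sol_0)
      ultimately show "(LINT x:{0<..snd p}|sol (fst p). x) - (LINT x:{0<..snd p}|f0. x)
          = - enn2real (integrated_flux K sol (fst p) (snd p)) + fst p"
        using integral_x_sol[OF tz(3) d] r
        unfolding t_def[symmetric] z_def[symmetric] by (simp add: integrated_flux_sol)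
    qed
  qed
  then show "AE (t, z) in (lborel :: (real \<times> real) measure). t \<in> {0..T} \<longrightarrow> z \<in> {0<..} \<longrightarrow>
        (LINT x:{0<..z}|sol t. x) - (LINT x:{0<..z}|f0. x) = - enn2real (integrated_flux K sol t z) + t"
    unfolding lborel_prod by (simp add: case_prod_beta)
qed

end

theorem theorem2p1:
  fixes K :: "real \<Rightarrow> real \<Rightarrow> real"
    and c1 c2 \<gamma> lam T :: real
    and f0 :: "real measure"
  assumes "continuous_on ({0<..} \<times> {0<..}) (\<lambda>(x, y). K x y)"
    and "\<And>x y. x > 0 \<Longrightarrow> y > 0 \<Longrightarrow> K x y \<ge> 0"
    and "0 < c1" and "c1 \<le> c2"
    and "\<bar>\<gamma> + 2 * lam\<bar> < 1" and "\<gamma> < 1"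
    and "\<And>x y. x > 0 \<Longrightarrow> y > 0 \<Longrightarrow>
           c1 * (x powr (\<gamma> + lam) * y powr (- lam) + x powr (- lam) * y powr (\<gamma> + lam)) \<le> K x y"
    and "\<And>x y. x > 0 \<Longrightarrow> y > 0 \<Longrightarrow>
           K x y \<le> c2 * (x powr (\<gamma> + lam) * y powr (- lam) + x powr (- lam) * y powr (\<gamma> + lam))"
    and "T > 0"
    and "f0 \<in> radon_measures"
    and "times_x f0 \<in> bounded_radon_measures"
  shows "\<exists>f. weak_flux_solution K T f0 f"
proof -
  interpret coagulation K c1 c2 "\<gamma> + lam" "- lam" T f0
    by unfold_locales (use assms in auto)
  obtain s \<mu> where s: "strict_mono s" "\<And>i. 1 \<le> s i" "\<And>t. on_unit (\<mu> t)"
    "\<And>t. 0 \<le> t \<Longrightarrow> t \<le> T \<Longrightarrow> weak_conv_m (\<lambda>i. law (s i) (idx (s i) t)) (\<mu> t)"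
    "\<And>t. \<mu> t = \<mu> (max 0 (min T t))"
    by (rule limit_laws, rule that)
  interpret coagulation_limit K c1 c2 "\<gamma> + lam" "- lam" T f0 s \<mu>
    by unfold_locales (fact s)+
  show ?thesis using sol_weak_flux by blast
qed

end
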